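(* Assume that the target theory $T$ has joining of bounds for $\mathcal L_S^{\mathcal I}$. For any formula $A$ of $\mathcal L_S$ and any tuples $\boldsymbol a,\boldsymbol b$ having the types of the positive $\mathcal I$-witnesses of $A$, $T$ proves $\boldsymbol a\vee_A\boldsymbol b=\boldsymbol b\vee_A\boldsymbol a$ and, for every tuple $\boldsymbol c$ having the types of the negative $\mathcal I$-witnesses of $A$, $T$ proves the implication $$\text{if } |A|^{\boldsymbol a}_{\boldsymbol c}\ \text{ then }\ |A|^{\boldsymbol a\vee_A\boldsymbol b}_{\boldsymbol c}.$$
   Context: Source language $\mathcal L_S$: finite types generated by $\sigma\to\tau$ from ground types, with constants, logical equality symbols $\equiv_\sigma$ and possibly other relation symbols; formulas are built from atomic formulas and $\bot$ with $\wedge,\to,\forall x^\sigma,\exists x^\sigma$ (disjunction is not primitive). $\mathcal L_S^{\mathcal I}$ adds a unary predicate symbol $\mathcal I_\sigma(x^\sigma)$ for each finite type $\sigma$. Target theory $T$: its types and terms include those of $\mathcal L_S$, and it has witnessing types generated from some ground witnessing types by $\rho\to\tau$ and $\rho^*$ (non-empty finite subsets of $\rho$), with combinators, singleton, union, indexed union and membership, satisfying their usual properties; equality is ordinary equality, and $T$ has enough extensionality to identify functions and finite sets that are extensionally equal. Boldface letters are (possibly empty) tuples; $\forall\boldsymbol b\in\boldsymbol B$ means $\forall b_1\in B_1\cdots\forall b_n\in B_n$. A base interpretation of $\mathcal L_S^{\mathcal I}$ assigns to each relation symbol $R$ of $\mathcal L_S^{\mathcal I}$ (possibly empty) tuples of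 witnessing types $\boldsymbol\tau_R^+$, $\boldsymbol\tau_R^-$ and a relation $\langle R(\boldsymbol x)\rangle^{\boldsymbol c}_{\boldsymbol d}$ of $\mathcal L_T$ with $\boldsymbol c:\boldsymbol\tau_R^+$, $\boldsymbol d:\boldsymbol\tau_R^-$; for $\equiv_\sigma$ both tuples are empty and $\langle x\equiv_\sigma y\rangle$ is $x=y$. One such base interpretation is fixed. Write $|R(\boldsymbol t)|^{\boldsymbol c}_{\boldsymbol d}$ for $\langle R(\boldsymbol t)\rangle^{\boldsymbol c}_{\boldsymbol d}$, put $|\bot|:\equiv\bot$, and define the $\mathcal I$-interpretation of formulas of $\mathcal L_S$ inductively: $$\begin{array}{lcl}|A\wedge B|^{\boldsymbol a,\boldsymbol c}_{\boldsymbol b,\boldsymbol d}&\text{is}&|A|^{\boldsymbol a}_{\boldsymbol b}\wedge|B|^{\boldsymbol c}_{\boldsymbol d}\\ |A\to B|^{\boldsymbol f,\boldsymbol g}_{\boldsymbol a,\boldsymbol d}&\text{is}&\forall\boldsymbol b\in\boldsymbol g\boldsymbol a\boldsymbol d\,|A|^{\boldsymbol a}_{\boldsymbol b}\to|B|^{\boldsymbol f\boldsymbol a}_{\boldsymbol d}\\ |\forall x^\sigma A(x)|^{\boldsymbol f,\boldsymbol g}_{\boldsymbol u,\boldsymbol b}&\text{is}&\forall x^\sigma(\forall\boldsymbol v\in\boldsymbol g\boldsymbol u\boldsymbol b\,|\mathcal I_\sigma(x)|^{\boldsymbol u}_{\boldsymbol v}\to|A(x)|^{\boldsymbol f\boldsymbol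 u}_{\boldsymbol b})\\ |\exists x^\sigma A(x)|^{\boldsymbol u,\boldsymbol a}_{\boldsymbol V,\boldsymbol B}&\text{is}&\exists x^\sigma(\forall\boldsymbol v\in\boldsymbol V\,|\mathcal I_\sigma(x)|^{\boldsymbol u}_{\boldsymbol v}\wedge\forall\boldsymbol b\in\boldsymbol B\,|A(x)|^{\boldsymbol a}_{\boldsymbol b}).\end{array}$$ The superscript variables are the positive $\mathcal I$-witnesses of the formula (of types $\boldsymbol\tau_A^+$), the subscripts the negative $\mathcal I$-witnesses. Joining of bounds. $T$ has joining of bounds for $\mathcal L_S^{\mathcal I}$ if for each relation symbol $R$ of $\mathcal L_S^{\mathcal I}$ there is in $T$ a tuple of maps $\vee_R:\boldsymbol\tau_R^+\times\boldsymbol\tau_R^+\to\boldsymbol\tau_R^+$ such that $T$ proves $\boldsymbol a\vee_R\boldsymbol b=\boldsymbol b\vee_R\boldsymbol a$ and: if $\langle R(\boldsymbol x)\rangle^{\boldsymbol a}_{\boldsymbol c}$ then $\langle R(\boldsymbol x)\rangle^{\boldsymbol a\vee_R\boldsymbol b}_{\boldsymbol c}$. It is extended to all formulas as follows. $\vee_{R(t_1,\dots,t_n)}$ is $\vee_R$. For conjunction, $(\boldsymbol a,\boldsymbol c)\vee_{A\wedge B}(\boldsymbol a',\boldsymbol c')$ is $\boldsymbol a\vee_A\boldsymbol a',\ \boldsymbol c\vee_B\boldsymbol c'$. For implication, $(\boldsymbol f,\boldsymbol g)\vee_{A\to B}(\boldsymbol f',\boldsymbol g')$ is $\lambda\boldsymbol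 a.(\boldsymbol f\boldsymbol a\vee_B\boldsymbol f'\boldsymbol a),\ \lambda\boldsymbol a,\boldsymbol d.(\boldsymbol g\boldsymbol a\boldsymbol d\cup\boldsymbol g'\boldsymbol a\boldsymbol d)$. For universal quantification, $(\boldsymbol f,\boldsymbol g)\vee_{\forall xA(x)}(\boldsymbol f',\boldsymbol g')$ is $\lambda\boldsymbol u.(\boldsymbol f\boldsymbol u\vee_A\boldsymbol f'\boldsymbol u),\ \lambda\boldsymbol u,\boldsymbol b.(\boldsymbol g\boldsymbol u\boldsymbol b\cup\boldsymbol g'\boldsymbol u\boldsymbol b)$. For existential quantification, $(\boldsymbol u,\boldsymbol a)\vee_{\exists xA(x)}(\boldsymbol u',\boldsymbol a')$ is $\boldsymbol u\vee_{\mathcal I_\sigma}\boldsymbol u',\ \boldsymbol a\vee_A\boldsymbol a'$. *)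

theory Defs
  imports Main
begin

section \<open>Types and terms\<close>

text \<open>
  One datatype of type expressions serves both languages, since the types and terms of the target
  theory include those of the source language. \<open>FinSet \<rho>\<close> is the type \<open>\<rho>*\<close> of non-empty finite
  subsets of \<open>\<rho>\<close>. Which type expressions are types of the source language, witnessing types, or
  types of the target theory is settled by the records below.
\<close>

datatype 'g ty = Ground 'g | Fun "'g ty" "'g ty" (infixr \<open>\<rightarrow>\<^sub>t\<close> 65) | FinSet "'g ty"

definition funs :: "'g ty list \<Rightarrow> 'g ty \<Rightarrow> 'g ty" (infixr \<open>\<Rrightarrow>\<^sub>t\<close> 64) where
  "\<tau>s \<Rrightarrow>\<^sub>t \<tau> = foldr Fun \<tau>s \<tau>"

text \<open>
  Variables are de Bruijn indices that also carry their type. Terms contain no binders: abstraction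
  is defined below from the combinators \<open>K\<^sub>\<rho>\<^sub>\<sigma> : \<rho> \<rightarrow> \<sigma> \<rightarrow> \<rho>\<close> and
  \<open>S\<^sub>\<rho>\<^sub>\<sigma>\<^sub>\<tau> : (\<rho> \<rightarrow> \<sigma> \<rightarrow> \<tau>) \<rightarrow> (\<rho> \<rightarrow> \<sigma>) \<rightarrow> \<rho> \<rightarrow> \<tau>\<close>.
  \<open>Sing\<close>, \<open>Cup\<close>, \<open>IUn\<close> are singleton, binary union and indexed union.
\<close>

datatype ('g, 'k) tm =
    Var nat "'g ty"
  | Con 'k "'g ty"
  | App "('g, 'k) tm" "('g, 'k) tm" (infixl \<open>\<cdot>\<close> 70)
  | KK "'g ty" "'g ty"
  | SS "'g ty" "'g ty" "'g ty"
  | Sing "'g ty"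
  | Cup "'g ty"
  | IUn "'g ty" "'g ty"

type_synonym ('g, 'k) sub = "nat \<Rightarrow> 'g ty \<Rightarrow> ('g, 'k) tm"

primrec tsub :: "('g, 'k) sub \<Rightarrow> ('g, 'k) tm \<Rightarrow> ('g, 'k) tm" where
  "tsub s (Var i \<tau>) = s i \<tau>"
| "tsub s (Con k \<tau>) = Con k \<tau>"
| "tsub s (t \<cdot> u) = tsub s t \<cdot> tsub s u"
| "tsub s (KK \<rho> \<sigma>) = KK \<rho> \<sigma>"
| "tsub s (SS \<rho> \<sigma> \<tau>) = SS \<rho> \<sigma> \<tau>"
| "tsub s (Sing \<rho>) = Sing \<rho>"
| "tsub s (Cup \<rho>) = Cup \<rho>"
| "tsub s (IUn \<rho> \<tau>) = IUn \<rho> \<tau>"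

definition shift :: "nat \<Rightarrow> ('g, 'k) tm \<Rightarrow> ('g, 'k) tm" where
  "shift n = tsub (\<lambda>i \<tau>. Var (i + n) \<tau>)"

definition up :: "('g, 'k) sub \<Rightarrow> ('g, 'k) sub" where
  "up s = (\<lambda>i \<tau>. case i of 0 \<Rightarrow> Var 0 \<tau> | Suc j \<Rightarrow> shift 1 (s j \<tau>))"

definition single :: "('g, 'k) tm \<Rightarrow> ('g, 'k) sub" where
  "single t = (\<lambda>i \<tau>. case i of 0 \<Rightarrow> t | Suc j \<Rightarrow> Var j \<tau>)"

definition apps :: "('g, 'k) tm \<Rightarrow> ('g, 'k) tm list \<Rightarrow> ('g, 'k) tm" where
  "apps f ts = foldl App f ts"

text \<open>The tuple \<open>\<^bold>f\<^bold>a\<close>, i.e. \<open>f\<^sub>1a\<^sub>1\<dots>a\<^sub>n, \<dots>, f\<^sub>ma\<^sub>1\<dots>a\<^sub>n\<close>.\<close>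

definition tapp :: "('g, 'k) tm list \<Rightarrow> ('g, 'k) tm list \<Rightarrow> ('g, 'k) tm list" (infixl \<open>\<bullet>\<close> 70) where
  "fs \<bullet> ts = map (\<lambda>f. apps f ts) fs"

abbreviation shifts :: "nat \<Rightarrow> ('g, 'k) tm list \<Rightarrow> ('g, 'k) tm list" where
  "shifts n \<equiv> map (shift n)"

text \<open>
  Binding a tuple of variables of types \<open>\<tau>\<^sub>1,\<dots>,\<tau>\<^sub>n\<close> one after the other turns a context \<open>\<Gamma>\<close> into
  \<open>rev \<tau>s @ \<Gamma>\<close>, in which the bound tuple is \<open>bvars \<tau>s\<close>.
\<close>

primrec bvars :: "'g ty list \<Rightarrow> ('g, 'k) tm list" where
  "bvars [] = []"
| "bvars (\<tau> # \<tau>s) = Var (length \<tau>s) \<tau> # bvars \<tau>s"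

text \<open>The variables of the segment \<open>\<tau>s\<close> of a context \<open>\<Delta> @ \<tau>s @ \<Gamma>\<close> with \<open>length \<Delta> = k\<close>.\<close>

definition seg :: "nat \<Rightarrow> 'g ty list \<Rightarrow> ('g, 'k) tm list" where
  "seg k \<tau>s = map (\<lambda>i. Var (k + i) (\<tau>s ! i)) [0..<length \<tau>s]"

subsection \<open>Abstraction by combinators\<close>

primrec type_of :: "('g, 'k) tm \<Rightarrow> 'g ty" where
  "type_of (Var i \<tau>) = \<tau>"
| "type_of (Con k \<tau>) = \<tau>"
| "type_of (t \<cdot> u) = (case type_of t of \<rho> \<rightarrow>\<^sub>t \<tau> \<Rightarrow> \<tau> | _ \<Rightarrow> type_of t)"
| "type_of (KK \<rho> \<sigma>) = \<rho> \<rightarrow>\<^sub>t \<sigma> \<rightarrow>\<^sub>t \<rho>"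
| "type_of (SS \<rho> \<sigma> \<tau>) = (\<rho> \<rightarrow>\<^sub>t \<sigma> \<rightarrow>\<^sub>t \<tau>) \<rightarrow>\<^sub>t (\<rho> \<rightarrow>\<^sub>t \<sigma>) \<rightarrow>\<^sub>t \<rho> \<rightarrow>\<^sub>t \<tau>"
| "type_of (Sing \<rho>) = \<rho> \<rightarrow>\<^sub>t FinSet \<rho>"
| "type_of (Cup \<rho>) = FinSet \<rho> \<rightarrow>\<^sub>t FinSet \<rho> \<rightarrow>\<^sub>t FinSet \<rho>"
| "type_of (IUn \<rho> \<tau>) = FinSet \<rho> \<rightarrow>\<^sub>t (\<rho> \<rightarrow>\<^sub>t FinSet \<tau>) \<rightarrow>\<^sub>t FinSet \<tau>"

primrec occurs0 :: "('g, 'k) tm \<Rightarrow> bool" where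
  "occurs0 (Var i \<tau>) \<longleftrightarrow> i = 0"
| "occurs0 (Con k \<tau>) \<longleftrightarrow> False"
| "occurs0 (t \<cdot> u) \<longleftrightarrow> occurs0 t \<or> occurs0 u"
| "occurs0 (KK \<rho> \<sigma>) \<longleftrightarrow> False"
| "occurs0 (SS \<rho> \<sigma> \<tau>) \<longleftrightarrow> False"
| "occurs0 (Sing \<rho>) \<longleftrightarrow> False"
| "occurs0 (Cup \<rho>) \<longleftrightarrow> False"
| "occurs0 (IUn \<rho> \<tau>) \<longleftrightarrow> False"

text \<open>
  \<open>lam \<rho> t\<close> abstracts the variable with index 0 and type \<open>\<rho>\<close> from \<open>t\<close> and lowers the other indices.
  A subterm without that variable is never decomposed, because it may have subterms whose types are
  not witnessing types, where \<open>T\<close> has no combinators.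
\<close>

fun lam :: "'g ty \<Rightarrow> ('g, 'k) tm \<Rightarrow> ('g, 'k) tm" where
  "lam \<rho> (t \<cdot> u) =
     (if occurs0 (t \<cdot> u)
      then SS \<rho> (type_of u) (type_of (t \<cdot> u)) \<cdot> lam \<rho> t \<cdot> lam \<rho> u
      else KK (type_of (t \<cdot> u)) \<rho> \<cdot> tsub (\<lambda>i \<tau>. Var (i - 1) \<tau>) (t \<cdot> u))"
| "lam \<rho> t =
     (if occurs0 t
      then SS \<rho> (\<rho> \<rightarrow>\<^sub>t \<rho>) \<rho> \<cdot> KK \<rho> (\<rho> \<rightarrow>\<^sub>t \<rho>) \<cdot> KK \<rho> \<rho>
      else KK (type_of t) \<rho> \<cdot> tsub (\<lambda>i \<tau>. Var (i - 1) \<tau>) t)"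

definition lams :: "'g ty list \<Rightarrow> ('g, 'k) tm \<Rightarrow> ('g, 'k) tm" where
  "lams \<tau>s t = foldr lam \<tau>s t"


section \<open>The target theory\<close>

datatype ('g, 'k, 'p) fm =
    FRel 'p "('g, 'k) tm list"
  | FEq "('g, 'k) tm" "('g, 'k) tm"
  | FMem "('g, 'k) tm" "('g, 'k) tm"
  | FBot
  | FAnd "('g, 'k, 'p) fm" "('g, 'k, 'p) fm"
  | FOr "('g, 'k, 'p) fm" "('g, 'k, 'p) fm"
  | FImp "('g, 'k, 'p) fm" "('g, 'k, 'p) fm"
  | FAll "'g ty" "('g, 'k, 'p) fm"
  | FEx "'g ty" "('g, 'k, 'p) fm"

abbreviation FIff :: "('g, 'k, 'p) fm \<Rightarrow> ('g, 'k, 'p) fm \<Rightarrow> ('g, 'k, 'p) fm" where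
  "FIff \<phi> \<psi> \<equiv> FAnd (FImp \<phi> \<psi>) (FImp \<psi> \<phi>)"

primrec fsub :: "('g, 'k) sub \<Rightarrow> ('g, 'k, 'p) fm \<Rightarrow> ('g, 'k, 'p) fm" where
  "fsub s (FRel p ts) = FRel p (map (tsub s) ts)"
| "fsub s (FEq t u) = FEq (tsub s t) (tsub s u)"
| "fsub s (FMem t u) = FMem (tsub s t) (tsub s u)"
| "fsub s FBot = FBot"
| "fsub s (FAnd \<phi> \<psi>) = FAnd (fsub s \<phi>) (fsub s \<psi>)"
| "fsub s (FOr \<phi> \<psi>) = FOr (fsub s \<phi>) (fsub s \<psi>)"
| "fsub s (FImp \<phi> \<psi>) = FImp (fsub s \<phi>) (fsub s \<psi>)"
| "fsub s (FAll \<tau> \<phi>) = FAll \<tau> (fsub (up s) \<phi>)"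
| "fsub s (FEx \<tau> \<phi>) = FEx \<tau> (fsub (up s) \<phi>)"

definition fshift :: "('g, 'k, 'p) fm \<Rightarrow> ('g, 'k, 'p) fm" where
  "fshift = fsub (\<lambda>i \<tau>. Var (Suc i) \<tau>)"

record ('g, 'k, 'p) target =
  ttypes :: "'g ty set"
  wground :: "'g set"
  tconsts :: "('k \<times> 'g ty) set"
  trels :: "'p set"
  tarity :: "'p \<Rightarrow> 'g ty list"
  axs :: "('g, 'k, 'p) fm set"

inductive_set wtypes :: "('g, 'k, 'p) target \<Rightarrow> 'g ty set" for T where
  "g \<in> wground T \<Longrightarrow> Ground g \<in> wtypes T"
| "\<rho> \<in> wtypes T \<Longrightarrow> \<tau> \<in> wtypes T \<Longrightarrow> (\<rho> \<rightarrow>\<^sub>t \<tau>) \<in> wtypes T"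
| "\<rho> \<in> wtypes T \<Longrightarrow> FinSet \<rho> \<in> wtypes T"

text \<open>A context \<open>\<Gamma>\<close> lists the types of the free variables, index 0 first.\<close>

inductive has_type :: "('g, 'k, 'p) target \<Rightarrow> 'g ty list \<Rightarrow> ('g, 'k) tm \<Rightarrow> 'g ty \<Rightarrow> bool"
  for T \<Gamma> where
  "i < length \<Gamma> \<Longrightarrow> \<Gamma> ! i = \<tau> \<Longrightarrow> has_type T \<Gamma> (Var i \<tau>) \<tau>"
| "(k, \<tau>) \<in> tconsts T \<Longrightarrow> has_type T \<Gamma> (Con k \<tau>) \<tau>"
| "has_type T \<Gamma> t (\<rho> \<rightarrow>\<^sub>t \<tau>) \<Longrightarrow> has_type T \<Gamma> u \<rho> \<Longrightarrow> has_type T \<Gamma> (t \<cdot> u) \<tau>"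
| "\<rho> \<in> wtypes T \<Longrightarrow> \<sigma> \<in> wtypes T \<Longrightarrow> has_type T \<Gamma> (KK \<rho> \<sigma>) (\<rho> \<rightarrow>\<^sub>t \<sigma> \<rightarrow>\<^sub>t \<rho>)"
| "\<rho> \<in> wtypes T \<Longrightarrow> \<sigma> \<in> wtypes T \<Longrightarrow> \<tau> \<in> wtypes T \<Longrightarrow>
     has_type T \<Gamma> (SS \<rho> \<sigma> \<tau>) ((\<rho> \<rightarrow>\<^sub>t \<sigma> \<rightarrow>\<^sub>t \<tau>) \<rightarrow>\<^sub>t (\<rho> \<rightarrow>\<^sub>t \<sigma>) \<rightarrow>\<^sub>t \<rho> \<rightarrow>\<^sub>t \<tau>)"
| "\<rho> \<in> wtypes T \<Longrightarrow> has_type T \<Gamma> (Sing \<rho>) (\<rho> \<rightarrow>\<^sub>t FinSet \<rho>)"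
| "\<rho> \<in> wtypes T \<Longrightarrow> has_type T \<Gamma> (Cup \<rho>) (FinSet \<rho> \<rightarrow>\<^sub>t FinSet \<rho> \<rightarrow>\<^sub>t FinSet \<rho>)"
| "\<rho> \<in> wtypes T \<Longrightarrow> \<tau> \<in> wtypes T \<Longrightarrow>
     has_type T \<Gamma> (IUn \<rho> \<tau>) (FinSet \<rho> \<rightarrow>\<^sub>t (\<rho> \<rightarrow>\<^sub>t FinSet \<tau>) \<rightarrow>\<^sub>t FinSet \<tau>)"

abbreviation has_types ::
  "('g, 'k, 'p) target \<Rightarrow> 'g ty list \<Rightarrow> ('g, 'k) tm list \<Rightarrow> 'g ty list \<Rightarrow> bool" where
  "has_types T \<Gamma> ts \<tau>s \<equiv> list_all2 (has_type T \<Gamma>) ts \<tau>s"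

primrec is_fm :: "('g, 'k, 'p) target \<Rightarrow> 'g ty list \<Rightarrow> ('g, 'k, 'p) fm \<Rightarrow> bool" where
  "is_fm T \<Gamma> (FRel p ts) \<longleftrightarrow> p \<in> trels T \<and> has_types T \<Gamma> ts (tarity T p)"
| "is_fm T \<Gamma> (FEq t u) \<longleftrightarrow> (\<exists>\<tau>. has_type T \<Gamma> t \<tau> \<and> has_type T \<Gamma> u \<tau>)"
| "is_fm T \<Gamma> (FMem t u) \<longleftrightarrow>
     (\<exists>\<rho>\<in>wtypes T. has_type T \<Gamma> t \<rho> \<and> has_type T \<Gamma> u (FinSet \<rho>))"
| "is_fm T \<Gamma> FBot \<longleftrightarrow> True"
| "is_fm T \<Gamma> (FAnd \<phi> \<psi>) \<longleftrightarrow> is_fm T \<Gamma> \<phi> \<and> is_fm T \<Gamma> \<psi>"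
| "is_fm T \<Gamma> (FOr \<phi> \<psi>) \<longleftrightarrow> is_fm T \<Gamma> \<phi> \<and> is_fm T \<Gamma> \<psi>"
| "is_fm T \<Gamma> (FImp \<phi> \<psi>) \<longleftrightarrow> is_fm T \<Gamma> \<phi> \<and> is_fm T \<Gamma> \<psi>"
| "is_fm T \<Gamma> (FAll \<tau> \<phi>) \<longleftrightarrow> \<tau> \<in> ttypes T \<and> is_fm T (\<tau> # \<Gamma>) \<phi>"
| "is_fm T \<Gamma> (FEx \<tau> \<phi>) \<longleftrightarrow> \<tau> \<in> ttypes T \<and> is_fm T (\<tau> # \<Gamma>) \<phi>"

text \<open>
  Natural deduction for intuitionistic many-sorted predicate logic with equality, relative to the
  axioms of \<open>T\<close>. Classical logic and the existence of elements of the sorts are obtained by putting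
  the relevant sentences among the axioms, so no choice between these variants is made here.
\<close>

inductive deriv ::
  "('g, 'k, 'p) target \<Rightarrow> 'g ty list \<Rightarrow> ('g, 'k, 'p) fm set \<Rightarrow> ('g, 'k, 'p) fm \<Rightarrow> bool"
  for T where
  axiom: "\<phi> \<in> axs T \<Longrightarrow> deriv T \<Gamma> H \<phi>"
| hyp: "\<phi> \<in> H \<Longrightarrow> is_fm T \<Gamma> \<phi> \<Longrightarrow> deriv T \<Gamma> H \<phi>"
| botE: "deriv T \<Gamma> H FBot \<Longrightarrow> is_fm T \<Gamma> \<phi> \<Longrightarrow> deriv T \<Gamma> H \<phi>"
| andI: "deriv T \<Gamma> H \<phi> \<Longrightarrow> deriv T \<Gamma> H \<psi> \<Longrightarrow> deriv T \<Gamma> H (FAnd \<phi> \<psi>)"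
| andE1: "deriv T \<Gamma> H (FAnd \<phi> \<psi>) \<Longrightarrow> deriv T \<Gamma> H \<phi>"
| andE2: "deriv T \<Gamma> H (FAnd \<phi> \<psi>) \<Longrightarrow> deriv T \<Gamma> H \<psi>"
| orI1: "deriv T \<Gamma> H \<phi> \<Longrightarrow> is_fm T \<Gamma> \<psi> \<Longrightarrow> deriv T \<Gamma> H (FOr \<phi> \<psi>)"
| orI2: "deriv T \<Gamma> H \<psi> \<Longrightarrow> is_fm T \<Gamma> \<phi> \<Longrightarrow> deriv T \<Gamma> H (FOr \<phi> \<psi>)"
| orE: "deriv T \<Gamma> H (FOr \<phi> \<psi>) \<Longrightarrow> deriv T \<Gamma> (insert \<phi> H) \<chi> \<Longrightarrow> deriv T \<Gamma> (insert \<psi> H) \<chi> \<Longrightarrow>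
    deriv T \<Gamma> H \<chi>"
| impI: "deriv T \<Gamma> (insert \<phi> H) \<psi> \<Longrightarrow> is_fm T \<Gamma> \<phi> \<Longrightarrow> deriv T \<Gamma> H (FImp \<phi> \<psi>)"
| impE: "deriv T \<Gamma> H (FImp \<phi> \<psi>) \<Longrightarrow> deriv T \<Gamma> H \<phi> \<Longrightarrow> deriv T \<Gamma> H \<psi>"
| allI: "deriv T (\<tau> # \<Gamma>) (fshift ` H) \<phi> \<Longrightarrow> \<tau> \<in> ttypes T \<Longrightarrow> deriv T \<Gamma> H (FAll \<tau> \<phi>)"
| allE: "deriv T \<Gamma> H (FAll \<tau> \<phi>) \<Longrightarrow> has_type T \<Gamma> t \<tau> \<Longrightarrow> deriv T \<Gamma> H (fsub (single t) \<phi>)"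
| exI: "deriv T \<Gamma> H (fsub (single t) \<phi>) \<Longrightarrow> has_type T \<Gamma> t \<tau> \<Longrightarrow> is_fm T \<Gamma> (FEx \<tau> \<phi>) \<Longrightarrow>
    deriv T \<Gamma> H (FEx \<tau> \<phi>)"
| exE: "deriv T \<Gamma> H (FEx \<tau> \<phi>) \<Longrightarrow> deriv T (\<tau> # \<Gamma>) (insert \<phi> (fshift ` H)) (fshift \<psi>) \<Longrightarrow>
    is_fm T \<Gamma> \<psi> \<Longrightarrow> deriv T \<Gamma> H \<psi>"
| eqI: "has_type T \<Gamma> t \<tau> \<Longrightarrow> deriv T \<Gamma> H (FEq t t)"
| eqE: "deriv T \<Gamma> H (FEq t u) \<Longrightarrow> has_type T \<Gamma> t \<tau> \<Longrightarrow> has_type T \<Gamma> u \<tau> \<Longrightarrow>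
    is_fm T (\<tau> # \<Gamma>) \<phi> \<Longrightarrow> deriv T \<Gamma> H (fsub (single t) \<phi>) \<Longrightarrow> deriv T \<Gamma> H (fsub (single u) \<phi>)"

definition proves :: "('g, 'k, 'p) target \<Rightarrow> 'g ty list \<Rightarrow> ('g, 'k, 'p) fm \<Rightarrow> bool" where
  "proves T \<Gamma> \<phi> \<longleftrightarrow> deriv T \<Gamma> {} \<phi>"

definition proves_eq ::
  "('g, 'k, 'p) target \<Rightarrow> 'g ty list \<Rightarrow> ('g, 'k) tm list \<Rightarrow> ('g, 'k) tm list \<Rightarrow> bool" where
  "proves_eq T \<Gamma> ts us \<longleftrightarrow> list_all2 (\<lambda>t u. proves T \<Gamma> (FEq t u)) ts us"

text \<open>
  The defining properties of combinators and set operations, and extensionality of functions and of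
  finite sets, for all witnessing types. Of the intended meaning of \<open>\<rho>*\<close>, only non-emptiness and
  the properties of the set operations are required; no axiom scheme of finiteness is imposed, so
  theories with such a scheme are among those admitted.
\<close>

definition witnessing_axioms :: "('g, 'k, 'p) target \<Rightarrow> bool" where
  "witnessing_axioms T \<longleftrightarrow> (\<forall>\<rho>\<in>wtypes T. \<forall>\<sigma>\<in>wtypes T. \<forall>\<tau>\<in>wtypes T.
     proves T [\<rho>, \<sigma>] (FEq (KK \<rho> \<sigma> \<cdot> Var 0 \<rho> \<cdot> Var 1 \<sigma>) (Var 0 \<rho>)) \<and>
     (let f = Var 0 (\<rho> \<rightarrow>\<^sub>t \<sigma> \<rightarrow>\<^sub>t \<tau>); g = Var 1 (\<rho> \<rightarrow>\<^sub>t \<sigma>); x = Var 2 \<rho>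
      in proves T [\<rho> \<rightarrow>\<^sub>t \<sigma> \<rightarrow>\<^sub>t \<tau>, \<rho> \<rightarrow>\<^sub>t \<sigma>, \<rho>]
           (FEq (SS \<rho> \<sigma> \<tau> \<cdot> f \<cdot> g \<cdot> x) (f \<cdot> x \<cdot> (g \<cdot> x)))) \<and>
     proves T [\<rho>, \<rho>]
       (FIff (FMem (Var 0 \<rho>) (Sing \<rho> \<cdot> Var 1 \<rho>)) (FEq (Var 0 \<rho>) (Var 1 \<rho>))) \<and>
     (let x = Var 0 \<rho>; A = Var 1 (FinSet \<rho>); B = Var 2 (FinSet \<rho>)
      in proves T [\<rho>, FinSet \<rho>, FinSet \<rho>]
           (FIff (FMem x (Cup \<rho> \<cdot> A \<cdot> B)) (FOr (FMem x A) (FMem x B)))) \<and>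
     (let y = Var 0 \<tau>; A = Var 1 (FinSet \<rho>); f = Var 2 (\<rho> \<rightarrow>\<^sub>t FinSet \<tau>)
      in proves T [\<tau>, FinSet \<rho>, \<rho> \<rightarrow>\<^sub>t FinSet \<tau>]
           (FIff (FMem y (IUn \<rho> \<tau> \<cdot> A \<cdot> f))
             (FEx \<rho> (FAnd (FMem (Var 0 \<rho>) (shift 1 A))
                          (FMem (shift 1 y) (shift 1 f \<cdot> Var 0 \<rho>)))))) \<and>
     proves T [FinSet \<rho>] (FEx \<rho> (FMem (Var 0 \<rho>) (Var 1 (FinSet \<rho>)))) \<and>
     (let f = Var 0 (\<rho> \<rightarrow>\<^sub>t \<tau>); g = Var 1 (\<rho> \<rightarrow>\<^sub>t \<tau>)
      in proves T [\<rho> \<rightarrow>\<^sub>t \<tau>, \<rho> \<rightarrow>\<^sub>t \<tau>]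
           (FImp (FAll \<rho> (FEq (shift 1 f \<cdot> Var 0 \<rho>) (shift 1 g \<cdot> Var 0 \<rho>))) (FEq f g))) \<and>
     (let A = Var 0 (FinSet \<rho>); B = Var 1 (FinSet \<rho>)
      in proves T [FinSet \<rho>, FinSet \<rho>]
           (FImp (FAll \<rho> (FIff (FMem (Var 0 \<rho>) (shift 1 A)) (FMem (Var 0 \<rho>) (shift 1 B))))
             (FEq A B))))"


section \<open>The source language\<close>

text \<open>\<open>Equiv \<sigma>\<close> is \<open>\<equiv>\<^sub>\<sigma>\<close>, \<open>Bnd \<sigma>\<close> is \<open>\<I>\<^sub>\<sigma>\<close>, and \<open>Rel r\<close> are the other relation symbols.\<close>

datatype ('g, 'r) rsym = Equiv "'g ty" | Rel 'r | Bnd "'g ty"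

datatype ('g, 'k, 'r) sfm =
    SRel "('g, 'r) rsym" "('g, 'k) tm list"
  | SBot
  | SAnd "('g, 'k, 'r) sfm" "('g, 'k, 'r) sfm"
  | SImp "('g, 'k, 'r) sfm" "('g, 'k, 'r) sfm"
  | SAll "'g ty" "('g, 'k, 'r) sfm"
  | SEx "'g ty" "('g, 'k, 'r) sfm"

record ('g, 'k, 'r) source =
  sground :: "'g set"
  sconsts :: "('k \<times> 'g ty) set"
  srels :: "'r set"
  sarity :: "'r \<Rightarrow> 'g ty list"

inductive_set stypes :: "('g, 'k, 'r) source \<Rightarrow> 'g ty set" for L where
  "g \<in> sground L \<Longrightarrow> Ground g \<in> stypes L"
| "\<sigma> \<in> stypes L \<Longrightarrow> \<tau> \<in> stypes L \<Longrightarrow> (\<sigma> \<rightarrow>\<^sub>t \<tau>) \<in> stypes L"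

definition source_language :: "('g, 'k, 'r) source \<Rightarrow> bool" where
  "source_language L \<longleftrightarrow>
     (\<forall>(k, \<sigma>)\<in>sconsts L. \<sigma> \<in> stypes L) \<and> (\<forall>r\<in>srels L. set (sarity L r) \<subseteq> stypes L)"

primrec arity :: "('g, 'k, 'r) source \<Rightarrow> ('g, 'r) rsym \<Rightarrow> 'g ty list" where
  "arity L (Equiv \<sigma>) = [\<sigma>, \<sigma>]"
| "arity L (Rel r) = sarity L r"
| "arity L (Bnd \<sigma>) = [\<sigma>]"

definition rsyms :: "('g, 'k, 'r) source \<Rightarrow> ('g, 'r) rsym set" where
  "rsyms L = Equiv ` stypes L \<union> Rel ` srels L"

definition rsymsI :: "('g, 'k, 'r) source \<Rightarrow> ('g, 'r) rsym set" where
  "rsymsI L = rsyms L \<union> Bnd ` stypes L"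

inductive shas_type :: "('g, 'k, 'r) source \<Rightarrow> 'g ty list \<Rightarrow> ('g, 'k) tm \<Rightarrow> 'g ty \<Rightarrow> bool"
  for L \<Gamma> where
  "i < length \<Gamma> \<Longrightarrow> \<Gamma> ! i = \<sigma> \<Longrightarrow> \<sigma> \<in> stypes L \<Longrightarrow> shas_type L \<Gamma> (Var i \<sigma>) \<sigma>"
| "(k, \<sigma>) \<in> sconsts L \<Longrightarrow> shas_type L \<Gamma> (Con k \<sigma>) \<sigma>"
| "shas_type L \<Gamma> t (\<sigma> \<rightarrow>\<^sub>t \<tau>) \<Longrightarrow> shas_type L \<Gamma> u \<sigma> \<Longrightarrow> shas_type L \<Gamma> (t \<cdot> u) \<tau>"

text \<open>
  Formulas of \<open>\<L>\<^sub>S\<close> (without the symbols \<open>\<I>\<^sub>\<sigma>\<close>). The context may contain types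
  foreign to \<open>\<L>\<^sub>S\<close>: the free variables of the formula are variables of \<open>T\<close>, and live in the same
  context as those of the witnesses.
\<close>

primrec is_sfm :: "('g, 'k, 'r) source \<Rightarrow> 'g ty list \<Rightarrow> ('g, 'k, 'r) sfm \<Rightarrow> bool" where
  "is_sfm L \<Gamma> (SRel R ts) \<longleftrightarrow> R \<in> rsyms L \<and> list_all2 (shas_type L \<Gamma>) ts (arity L R)"
| "is_sfm L \<Gamma> SBot \<longleftrightarrow> True"
| "is_sfm L \<Gamma> (SAnd A B) \<longleftrightarrow> is_sfm L \<Gamma> A \<and> is_sfm L \<Gamma> B"
| "is_sfm L \<Gamma> (SImp A B) \<longleftrightarrow> is_sfm L \<Gamma> A \<and> is_sfm L \<Gamma> B"
| "is_sfm L \<Gamma> (SAll \<sigma> A) \<longleftrightarrow> \<sigma> \<in> stypes L \<and> is_sfm L (\<sigma> # \<Gamma>) A"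
| "is_sfm L \<Gamma> (SEx \<sigma> A) \<longleftrightarrow> \<sigma> \<in> stypes L \<and> is_sfm L (\<sigma> # \<Gamma>) A"

definition target_theory :: "('g, 'k, 'r) source \<Rightarrow> ('g, 'k, 'p) target \<Rightarrow> bool" where
  "target_theory L T \<longleftrightarrow>
     stypes L \<subseteq> ttypes T \<and> wtypes T \<subseteq> ttypes T \<and>
     (\<forall>\<rho> \<tau>. (\<rho> \<rightarrow>\<^sub>t \<tau>) \<in> ttypes T \<longrightarrow> \<rho> \<in> ttypes T \<and> \<tau> \<in> ttypes T) \<and>
     (\<forall>\<rho>. FinSet \<rho> \<in> ttypes T \<longrightarrow> \<rho> \<in> ttypes T) \<and>
     sconsts L \<subseteq> tconsts T \<and> (\<forall>(k, \<tau>)\<in>tconsts T. \<tau> \<in> ttypes T) \<and>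
     (\<forall>p\<in>trels T. set (tarity T p) \<subseteq> ttypes T) \<and>
     (\<forall>\<phi>\<in>axs T. is_fm T [] \<phi>) \<and>
     witnessing_axioms T"


section \<open>Base interpretations and the \<open>\<I>\<close>-interpretation\<close>

text \<open>
  \<open>base R\<close> is the relation \<open>\<langle>R(\<^bold>x)\<rangle>\<^sup>\<^bold>c\<^sub>\<^bold>d\<close>, a formula in the context
  \<open>arity L R @ bpos R @ bneg R\<close> of the variables \<open>\<^bold>x, \<^bold>c, \<^bold>d\<close>.
\<close>

record ('g, 'k, 'p, 'r) base_interp =
  bpos :: "('g, 'r) rsym \<Rightarrow> 'g ty list"
  bneg :: "('g, 'r) rsym \<Rightarrow> 'g ty list"
  base :: "('g, 'r) rsym \<Rightarrow> ('g, 'k, 'p) fm"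

definition base_interpretation ::
  "('g, 'k, 'r) source \<Rightarrow> ('g, 'k, 'p) target \<Rightarrow> ('g, 'k, 'p, 'r) base_interp \<Rightarrow> bool" where
  "base_interpretation L T I \<longleftrightarrow>
     (\<forall>R\<in>rsymsI L. set (bpos I R) \<subseteq> wtypes T \<and> set (bneg I R) \<subseteq> wtypes T \<and>
        is_fm T (arity L R @ bpos I R @ bneg I R) (base I R)) \<and>
     (\<forall>\<sigma>\<in>stypes L. bpos I (Equiv \<sigma>) = [] \<and> bneg I (Equiv \<sigma>) = [] \<and>
        base I (Equiv \<sigma>) = FEq (Var 0 \<sigma>) (Var 1 \<sigma>))"

definition base_at :: "('g, 'k, 'p, 'r) base_interp \<Rightarrow> ('g, 'r) rsym \<Rightarrow> ('g, 'k) tm list \<Rightarrow>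
    ('g, 'k) tm list \<Rightarrow> ('g, 'k) tm list \<Rightarrow> ('g, 'k, 'p) fm" where
  "base_at I R ts cs ds = fsub (\<lambda>i \<tau>. (ts @ cs @ ds) ! i) (base I R)"

text \<open>The types of the positive and of the negative \<open>\<I>\<close>-witnesses of a formula.\<close>

fun pos :: "('g, 'k, 'p, 'r) base_interp \<Rightarrow> ('g, 'k, 'r) sfm \<Rightarrow> 'g ty list"
    and neg :: "('g, 'k, 'p, 'r) base_interp \<Rightarrow> ('g, 'k, 'r) sfm \<Rightarrow> 'g ty list" where
  "pos I (SRel R ts) = bpos I R"
| "pos I SBot = []"
| "pos I (SAnd A B) = pos I A @ pos I B"
| "pos I (SImp A B) = map (\<lambda>\<tau>. pos I A \<Rrightarrow>\<^sub>t \<tau>) (pos I B)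
     @ map (\<lambda>\<rho>. (pos I A @ neg I B) \<Rrightarrow>\<^sub>t FinSet \<rho>) (neg I A)"
| "pos I (SAll \<sigma> A) = map (\<lambda>\<tau>. bpos I (Bnd \<sigma>) \<Rrightarrow>\<^sub>t \<tau>) (pos I A)
     @ map (\<lambda>\<rho>. (bpos I (Bnd \<sigma>) @ neg I A) \<Rrightarrow>\<^sub>t FinSet \<rho>) (bneg I (Bnd \<sigma>))"
| "pos I (SEx \<sigma> A) = bpos I (Bnd \<sigma>) @ pos I A"
| "neg I (SRel R ts) = bneg I R"
| "neg I SBot = []"
| "neg I (SAnd A B) = neg I A @ neg I B"
| "neg I (SImp A B) = pos I A @ neg I B"
| "neg I (SAll \<sigma> A) = bpos I (Bnd \<sigma>) @ neg I A"
| "neg I (SEx \<sigma> A) = map FinSet (bneg I (Bnd \<sigma>)) @ map FinSet (neg I A)"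

text \<open>
  \<open>ball \<rho>s Bs \<phi>\<close> is \<open>\<forall>b\<^sub>1\<in>B\<^sub>1\<cdots>\<forall>b\<^sub>n\<in>B\<^sub>n \<phi>\<close>; if the whole lives in context
  \<open>\<Gamma>\<close>, then \<open>\<phi>\<close> lives in context \<open>rev \<rho>s @ \<Gamma>\<close>.
\<close>

fun ball :: "'g ty list \<Rightarrow> ('g, 'k) tm list \<Rightarrow> ('g, 'k, 'p) fm \<Rightarrow> ('g, 'k, 'p) fm" where
  "ball (\<rho> # \<rho>s) (B # Bs) \<phi> =
     FAll \<rho> (FImp (FMem (Var 0 \<rho>) (shift 1 B)) (ball \<rho>s (shifts 1 Bs) \<phi>))"
| "ball _ _ \<phi> = \<phi>"

definition splits :: "'a list \<Rightarrow> 'b list \<Rightarrow> 'b list \<times> 'b list" where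
  "splits xs ys = (take (length xs) ys, drop (length xs) ys)"

text \<open>
  \<open>interp I r A ps qs\<close> is \<open>|A[r]|\<close> with superscripts \<open>ps\<close> and subscripts \<open>qs\<close>. The substitution
  \<open>r\<close> of terms for the free variables of \<open>A\<close> keeps track of the renumbering of variables under the
  quantifiers introduced by the interpretation; the interpretation of \<open>A\<close> itself is
  \<open>interp I Var A\<close>.
\<close>

primrec interp :: "('g, 'k, 'p, 'r) base_interp \<Rightarrow> ('g, 'k) sub \<Rightarrow> ('g, 'k, 'r) sfm \<Rightarrow>
    ('g, 'k) tm list \<Rightarrow> ('g, 'k) tm list \<Rightarrow> ('g, 'k, 'p) fm" where
  "interp I r (SRel R ts) ps qs = base_at I R (map (tsub r) ts) ps qs"
| "interp I r SBot ps qs = FBot"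
| "interp I r (SAnd A B) ps qs =
     (let (a, c) = splits (pos I A) ps; (b, d) = splits (neg I A) qs
      in FAnd (interp I r A a b) (interp I r B c d))"
| "interp I r (SImp A B) ps qs =
     (let (f, g) = splits (pos I B) ps; (a, d) = splits (pos I A) qs; k = length (neg I A)
      in FImp
           (ball (neg I A) (g \<bullet> (a @ d))
             (interp I (\<lambda>i \<tau>. shift k (r i \<tau>)) A (shifts k a) (bvars (neg I A))))
           (interp I r B (f \<bullet> a) d))"
| "interp I r (SAll \<sigma> A) ps qs =
     (let (f, g) = splits (pos I A) ps; (u, b) = splits (bpos I (Bnd \<sigma>)) qs;
          vs = bneg I (Bnd \<sigma>); k = length vs
      in FAll \<sigma> (FImp
           (ball vs (shifts 1 (g \<bullet> (u @ b)))
             (base_at I (Bnd \<sigma>) [Var k \<sigma>] (shifts (k + 1) u) (bvars vs)))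
           (interp I (up r) A (shifts 1 (f \<bullet> u)) (shifts 1 b))))"
| "interp I r (SEx \<sigma> A) ps qs =
     (let (u, a) = splits (bpos I (Bnd \<sigma>)) ps; vs = bneg I (Bnd \<sigma>); (V, B) = splits vs qs;
          k = length vs; m = length (neg I A)
      in FEx \<sigma> (FAnd
           (ball vs (shifts 1 V)
             (base_at I (Bnd \<sigma>) [Var k \<sigma>] (shifts (k + 1) u) (bvars vs)))
           (ball (neg I A) (shifts 1 B)
             (interp I (\<lambda>i \<tau>. shift m (up r i \<tau>)) A (shifts (m + 1) a) (bvars (neg I A))))))"


section \<open>Joining of bounds\<close>

text \<open>A joining assigns to \<open>R\<close> the tuple of closed terms whose value at \<open>\<^bold>a, \<^bold>b\<close> is \<open>\<^bold>a \<or>\<^sub>R \<^bold>b\<close>.\<close>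

type_synonym ('g, 'k, 'r) joining = "('g, 'r) rsym \<Rightarrow> ('g, 'k) tm list"

definition joining_of_bounds :: "('g, 'k, 'r) source \<Rightarrow> ('g, 'k, 'p) target \<Rightarrow>
    ('g, 'k, 'p, 'r) base_interp \<Rightarrow> ('g, 'k, 'r) joining \<Rightarrow> bool" where
  "joining_of_bounds L T I J \<longleftrightarrow> (\<forall>R\<in>rsymsI L.
     has_types T [] (J R) (map (\<lambda>\<tau>. (bpos I R @ bpos I R) \<Rrightarrow>\<^sub>t \<tau>) (bpos I R)) \<and>
     (let a = seg 0 (bpos I R); b = seg (length (bpos I R)) (bpos I R)
      in proves_eq T (bpos I R @ bpos I R) (J R \<bullet> (a @ b)) (J R \<bullet> (b @ a))) \<and>
     (let n = length (arity L R); m = length (bpos I R);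
          x = seg 0 (arity L R); a = seg n (bpos I R); b = seg (n + m) (bpos I R);
          c = seg (n + m + m) (bneg I R)
      in proves T (arity L R @ bpos I R @ bpos I R @ bneg I R)
           (FImp (base_at I R x a c) (base_at I R x (J R \<bullet> (a @ b)) c))))"

text \<open>\<open>pointwise_un \<tau>s \<rho>s gs hs\<close> is the tuple of the \<open>\<lambda>\<^bold>x. g\<^sub>j\<^bold>x \<union> h\<^sub>j\<^bold>x\<close>, for \<open>\<^bold>x\<close> of types \<open>\<tau>s\<close>.\<close>

definition pointwise_un :: "'g ty list \<Rightarrow> 'g ty list \<Rightarrow> ('g, 'k) tm list \<Rightarrow> ('g, 'k) tm list \<Rightarrow>
    ('g, 'k) tm list" where
  "pointwise_un \<tau>s \<rho>s gs hs =
     (let n = length \<tau>s; x = bvars \<tau>s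
      in map2 (\<lambda>\<rho> (g, h). lams \<tau>s (Cup \<rho> \<cdot> apps (shift n g) x \<cdot> apps (shift n h) x))
           \<rho>s (zip gs hs))"

primrec join :: "('g, 'k, 'p, 'r) base_interp \<Rightarrow> ('g, 'k, 'r) joining \<Rightarrow> ('g, 'k, 'r) sfm \<Rightarrow>
    ('g, 'k) tm list \<Rightarrow> ('g, 'k) tm list \<Rightarrow> ('g, 'k) tm list" where
  "join I J (SRel R ts) ps qs = J R \<bullet> (ps @ qs)"
| "join I J SBot ps qs = []"
| "join I J (SAnd A B) ps qs =
     (let (a, c) = splits (pos I A) ps; (a', c') = splits (pos I A) qs
      in join I J A a a' @ join I J B c c')"
| "join I J (SImp A B) ps qs =
     (let (f, g) = splits (pos I B) ps; (f', g') = splits (pos I B) qs;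
          n = length (pos I A); a = bvars (pos I A)
      in map (lams (pos I A)) (join I J B (shifts n f \<bullet> a) (shifts n f' \<bullet> a))
         @ pointwise_un (pos I A @ neg I B) (neg I A) g g')"
| "join I J (SAll \<sigma> A) ps qs =
     (let (f, g) = splits (pos I A) ps; (f', g') = splits (pos I A) qs;
          us = bpos I (Bnd \<sigma>); n = length us; u = bvars us
      in map (lams us) (join I J A (shifts n f \<bullet> u) (shifts n f' \<bullet> u))
         @ pointwise_un (us @ neg I A) (bneg I (Bnd \<sigma>)) g g')"
| "join I J (SEx \<sigma> A) ps qs =
     (let (u, a) = splits (bpos I (Bnd \<sigma>)) ps; (u', a') = splits (bpos I (Bnd \<sigma>)) qs
      in J (Bnd \<sigma>) \<bullet> (u @ u') @ join I J A a a')"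

end

(*
  The formula is handled by induction, for arbitrary contexts and for arbitrary terms substituted
  for its free variables, because the interpretation renumbers variables under its quantifiers.

  The positive witnesses of an implication f, g are replaced by combinatory abstractions
  whose values are joins of values of f and unions of values of g. The value of
  such an abstraction at a tuple equals the join, or the union, of the values, by beta conversion in T.
  Hence a larger set only strengthens the bounded premise, while the induction hypothesis weakens
  the conclusion, and Leibniz' rule exchanges the join of the values with the value of the join.
  Commutativity needs, dually, that abstraction preserves provable equality, which follows from
  beta conversion and extensionality. All this requires that joins commute with substitution.
*)

theory Submission
  imports Defs
begin

section \<open>Substitution\<close>

text \<open>The obstacle is that \<open>T\<close> has combinators at witnessing types only, while
  joins are formed over contexts that also hold variables of other types, and terms of such types
  may occur inside the witnesses. Joins commute with substitution as literal identities of terms,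
  not merely provably. This rests on the form of \<open>lam\<close>: its choices depend on whether
  variable 0 occurs and on computed types, and a well-typed substitution lifted under the binder
  changes neither. Hence the typing hypotheses in the statements on abstraction. Literal identity
  matters because beta conversion produces a substituted join, which has to be recognised as the
  join of the values. Implication and universal quantification abstract joins in the same way, so
  the lemmas on \<open>map (lams \<tau>s)\<close> of a join are stated once for both, with the
  induction hypothesis, where one is needed, as a premise.\<close>

lemma tsub_tsub: "tsub s (tsub r t) = tsub (\<lambda>i \<tau>. tsub s (r i \<tau>)) t"
  by (induction t) auto

lemma tsub_Var [simp]: "tsub Var t = t"
  by (induction t) auto

lemma shift_0 [simp]: "shift 0 t = t"
  unfolding shift_def by (simp add: eta_contract_eq)

lemma shift_simps [simp]:
  "shift n (Var i \<tau>) = Var (i + n) \<tau>"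
  "shift n (Con k \<tau>) = Con k \<tau>"
  "shift n (t \<cdot> u) = shift n t \<cdot> shift n u"
  "shift n (KK \<rho> \<sigma>) = KK \<rho> \<sigma>"
  "shift n (SS \<rho> \<sigma> \<tau>) = SS \<rho> \<sigma> \<tau>"
  "shift n (Sing \<rho>) = Sing \<rho>"
  "shift n (Cup \<rho>) = Cup \<rho>"
  "shift n (IUn \<rho> \<tau>) = IUn \<rho> \<tau>"
  by (simp_all add: shift_def)

lemma shift_shift [simp]: "shift m (shift n t) = shift (n + m) t"
  by (simp add: shift_def tsub_tsub add.assoc)

lemma tsub_shift: "tsub s (shift n t) = tsub (\<lambda>i \<tau>. s (i + n) \<tau>) t"
  by (simp add: shift_def tsub_tsub)

lemma shift_tsub: "shift n (tsub s t) = tsub (\<lambda>i \<tau>. shift n (s i \<tau>)) t"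
  by (simp add: shift_def tsub_tsub)

lemma up_0 [simp]: "up s 0 \<tau> = Var 0 \<tau>"
  and up_Suc [simp]: "up s (Suc i) \<tau> = shift (Suc 0) (s i \<tau>)"
  by (simp_all add: up_def)

lemma single_0 [simp]: "single t 0 \<tau> = t"
  and single_Suc [simp]: "single t (Suc i) \<tau> = Var i \<tau>"
  by (simp_all add: single_def)

lemma tsub_single_shift [simp]: "tsub (single u) (shift (Suc 0) t) = t"
  by (simp add: tsub_shift eta_contract_eq)

lemma up_Var [simp]: "up Var = Var"
  by (intro ext) (simp add: up_def split: nat.split)

lemma tsub_up_shift [simp]: "tsub (up s) (shift (Suc 0) t) = shift (Suc 0) (tsub s t)"
  by (simp add: tsub_shift shift_tsub)

text \<open>This lets composition of substitutions pass a quantifier; with it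
  \<open>fsub_fsub\<close> holds without any typing.\<close>

lemma up_comp: "up (\<lambda>i \<tau>. tsub s (r i \<tau>)) = (\<lambda>i \<tau>. tsub (up s) (up r i \<tau>))"
proof (intro ext)
  fix i \<tau> show "up (\<lambda>i \<tau>. tsub s (r i \<tau>)) i \<tau> = tsub (up s) (up r i \<tau>)"
    by (cases i) simp_all
qed

lemma fsub_fsub: "fsub s (fsub r \<phi>) = fsub (\<lambda>i \<tau>. tsub s (r i \<tau>)) \<phi>"
  by (induction \<phi> arbitrary: s r) (simp_all add: tsub_tsub up_comp)

lemma fsub_Var [simp]: "fsub Var \<phi> = \<phi>"
  by (induction \<phi>) (simp_all add: map_idI)

lemma fshift_simps [simp]:
  "fshift (FRel p ts) = FRel p (shifts 1 ts)"
  "fshift (FEq t u) = FEq (shift 1 t) (shift 1 u)"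
  "fshift (FMem t u) = FMem (shift 1 t) (shift 1 u)"
  "fshift FBot = FBot"
  "fshift (FAnd \<phi> \<psi>) = FAnd (fshift \<phi>) (fshift \<psi>)"
  "fshift (FOr \<phi> \<psi>) = FOr (fshift \<phi>) (fshift \<psi>)"
  "fshift (FImp \<phi> \<psi>) = FImp (fshift \<phi>) (fshift \<psi>)"
  by (simp_all add: fshift_def shift_def)

lemma fsub_up_fshift: "fsub (up s) (fshift \<phi>) = fshift (fsub s \<phi>)"
  by (simp add: fshift_def fsub_fsub shift_def)

text \<open>The substitution lemma: it keeps \<open>allE\<close>, \<open>exI\<close> and
  \<open>eqE\<close> applicable after a substitution has been carried out.\<close>

lemma fsub_up_single: "fsub s (fsub (single t) \<phi>) = fsub (single (tsub s t)) (fsub (up s) \<phi>)"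
proof -
  have "tsub s (single t i \<tau>) = tsub (single (tsub s t)) (up s i \<tau>)" for i \<tau>
    by (cases i) simp_all
  then show ?thesis by (simp add: fsub_fsub)
qed

section \<open>Substitution under several binders and in tuples\<close>

abbreviation upn :: "nat \<Rightarrow> ('g, 'k) sub \<Rightarrow> ('g, 'k) sub" where
  "upn k s \<equiv> (up ^^ k) s"

lemma upn_apply: "upn k s i \<tau> = (if i < k then Var i \<tau> else shift k (s (i - k) \<tau>))"
proof (induction k arbitrary: i)
  case (Suc k)
  then show ?case by (cases i) auto
qed simp

text \<open>Iteration adds a lift on the outside, whereas \<open>ball\<close> and
  \<open>lams\<close> strip the outermost binder first and so leave \<open>up s\<close> on the
  inside.\<close>

lemma upn_up: "upn k (up s) = up (upn k s)"
  by (metis funpow_swap1)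

lemma tsub_upn_shift [simp]: "tsub (upn k s) (shift k t) = shift k (tsub s t)"
  by (simp add: tsub_shift shift_tsub upn_apply)

text \<open>Both quantifier clauses of the interpretation place \<open>k\<close> bounded quantifiers
  below one ordinary quantifier, so their witnesses are shifted by \<open>k + 1\<close>.\<close>

lemma tsub_upn_shift_Suc [simp]:
  "tsub (upn k (up s)) (shift (Suc k) t) = shift (Suc k) (tsub s t)"
proof -
  have "upn k (up s) = upn (Suc k) s"
    by (simp add: upn_up)
  then show ?thesis
    using tsub_upn_shift [of "Suc k" s t] by simp
qed

lemma tsub_apps [simp]: "tsub s (apps f ts) = apps (tsub s f) (map (tsub s) ts)"
  unfolding apps_def by (induction ts arbitrary: f) auto

lemma shift_apps [simp]: "shift n (apps f ts) = apps (shift n f) (shifts n ts)"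
  by (simp add: shift_def)

lemma map_tsub_tapp [simp]: "map (tsub s) (fs \<bullet> ts) = map (tsub s) fs \<bullet> map (tsub s) ts"
  by (simp add: tapp_def)

lemma shifts_tapp [simp]: "shifts n (fs \<bullet> ts) = shifts n fs \<bullet> shifts n ts"
  by (simp add: tapp_def)

lemma length_tapp [simp]: "length (fs \<bullet> ts) = length fs"
  by (simp add: tapp_def)

lemma tapp_append [simp]: "(fs @ gs) \<bullet> ts = fs \<bullet> ts @ gs \<bullet> ts"
  by (simp add: tapp_def)

lemma length_bvars [simp]: "length (bvars \<tau>s) = length \<tau>s"
  by (induction \<tau>s) auto

text \<open>The first component of a bound tuple is bound outermost and so has the greatest index,
  which is why contexts and \<open>msub\<close> reverse the list.\<close>

lemma bvars_eq: "bvars \<tau>s = map (\<lambda>i. Var (length \<tau>s - Suc i) (\<tau>s ! i)) [0..<length \<tau>s]"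
  by (induction \<tau>s) (simp_all del: upt_Suc add: upt_conv_Cons map_Suc_upt [symmetric] o_def)

lemma map_upn_bvars [simp]: "map (tsub (upn (length \<tau>s) s)) (bvars \<tau>s) = bvars \<tau>s"
  by (auto simp add: bvars_eq upn_apply)

text \<open>The lengths must agree because \<open>ball\<close> binds only as many variables as the
  shorter list has entries.\<close>

lemma fsub_ball:
  "length Bs = length \<rho>s \<Longrightarrow>
    fsub s (ball \<rho>s Bs \<phi>) = ball \<rho>s (map (tsub s) Bs) (fsub (upn (length \<rho>s) s) \<phi>)"
proof (induction \<rho>s Bs \<phi> arbitrary: s rule: ball.induct)
  case (1 \<rho> \<rho>s B Bs \<phi>)
  then show ?case by (simp add: o_def upn_up)
qed auto


section \<open>Typing\<close>

lemma wtypes_Fun: "(\<rho> \<rightarrow>\<^sub>t \<tau>) \<in> wtypes T \<longleftrightarrow> \<rho> \<in> wtypes T \<and> \<tau> \<in> wtypes T"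
  using wtypes.cases by (blast intro: wtypes.intros)

lemma wtypes_FinSet: "FinSet \<rho> \<in> wtypes T \<longleftrightarrow> \<rho> \<in> wtypes T"
  using wtypes.cases by (blast intro: wtypes.intros)

lemma funs_simps [simp]: "([] \<Rrightarrow>\<^sub>t \<tau>) = \<tau>" "((\<rho> # \<rho>s) \<Rrightarrow>\<^sub>t \<tau>) = (\<rho> \<rightarrow>\<^sub>t (\<rho>s \<Rrightarrow>\<^sub>t \<tau>))"
  by (simp_all add: funs_def)

lemma wtypes_funs: "(\<rho>s \<Rrightarrow>\<^sub>t \<tau>) \<in> wtypes T \<longleftrightarrow> set \<rho>s \<subseteq> wtypes T \<and> \<tau> \<in> wtypes T"
  by (induction \<rho>s) (auto simp: wtypes_Fun)

lemma has_type_Var0 [simp]: "has_type T (\<tau> # \<Gamma>) (Var 0 \<tau>) \<tau>"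
  by (simp add: has_type.intros)

text \<open>Types are unique, so the annotations that \<open>lam\<close> puts on its combinators by
  means of \<open>type_of\<close> are the right ones.\<close>

lemma type_of_has_type: "has_type T \<Gamma> t \<tau> \<Longrightarrow> type_of t = \<tau>"
  by (induction rule: has_type.induct) auto

definition sub_typed ::
  "('g, 'k, 'p) target \<Rightarrow> 'g ty list \<Rightarrow> 'g ty list \<Rightarrow> ('g, 'k) sub \<Rightarrow> bool" where
  "sub_typed T \<Gamma> \<Delta> s \<longleftrightarrow> (\<forall>i<length \<Gamma>. has_type T \<Delta> (s i (\<Gamma> ! i)) (\<Gamma> ! i))"

lemma has_type_tsub: "has_type T \<Gamma> t \<tau> \<Longrightarrow> sub_typed T \<Gamma> \<Delta> s \<Longrightarrow> has_type T \<Delta> (tsub s t) \<tau>"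
  by (induction rule: has_type.induct) (auto simp: sub_typed_def intro: has_type.intros)

lemma has_types_tsub:
  "has_types T \<Gamma> ts \<tau>s \<Longrightarrow> sub_typed T \<Gamma> \<Delta> s \<Longrightarrow> has_types T \<Delta> (map (tsub s) ts) \<tau>s"
  by (auto simp: list_all2_conv_all_nth has_type_tsub)

lemma sub_typed_Var: "sub_typed T \<Gamma> \<Gamma> Var"
  by (simp add: sub_typed_def has_type.intros)

lemma sub_typed_shift: "sub_typed T \<Gamma> (\<Delta> @ \<Gamma>) (\<lambda>i. Var (i + length \<Delta>))"
  by (simp add: sub_typed_def has_type.intros nth_append)

lemma sub_typed_Suc: "sub_typed T \<Gamma> (\<tau> # \<Gamma>) (\<lambda>i. Var (Suc i))"
  using sub_typed_shift [of T \<Gamma> "[\<tau>]"] by simp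

lemma has_type_shift:
  "has_type T \<Gamma> t \<tau> \<Longrightarrow> n = length \<Delta> \<Longrightarrow> has_type T (\<Delta> @ \<Gamma>) (shift n t) \<tau>"
  unfolding shift_def by (simp add: has_type_tsub sub_typed_shift)

lemma has_type_shift_Suc: "has_type T \<Gamma> t \<tau> \<Longrightarrow> has_type T (\<sigma> # \<Gamma>) (shift (Suc 0) t) \<tau>"
  using has_type_shift [of T \<Gamma> t \<tau> 1 "[\<sigma>]"] by simp

lemma has_types_shifts:
  "has_types T \<Gamma> ts \<tau>s \<Longrightarrow> n = length \<Delta> \<Longrightarrow> has_types T (\<Delta> @ \<Gamma>) (shifts n ts) \<tau>s"
  by (auto simp: list_all2_conv_all_nth has_type_shift)

lemma has_types_shifts_Suc:
  "has_types T \<Gamma> ts \<tau>s \<Longrightarrow> has_types T (\<sigma> # \<Gamma>) (shifts (Suc 0) ts) \<tau>s"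
  by (auto simp: list_all2_conv_all_nth has_type_shift_Suc)

lemma sub_typed_comp_shift:
  "sub_typed T \<Gamma> \<Delta> s \<Longrightarrow> n = length \<Delta>' \<Longrightarrow> sub_typed T \<Gamma> (\<Delta>' @ \<Delta>) (\<lambda>i \<tau>. shift n (s i \<tau>))"
  by (simp add: sub_typed_def has_type_shift)

lemma sub_typed_up: "sub_typed T \<Gamma> \<Delta> s \<Longrightarrow> sub_typed T (\<tau> # \<Gamma>) (\<tau> # \<Delta>) (up s)"
  unfolding sub_typed_def
  by (auto simp: less_Suc_eq_0_disj has_type_shift_Suc intro!: has_type.intros)

lemma sub_typed_single: "has_type T \<Gamma> t \<tau> \<Longrightarrow> sub_typed T (\<tau> # \<Gamma>) \<Gamma> (single t)"
  unfolding sub_typed_def by (auto simp: less_Suc_eq_0_disj intro: has_type.intros)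

lemma sub_typed_nth: "has_types T \<Gamma> ts \<tau>s \<Longrightarrow> sub_typed T \<tau>s \<Gamma> (\<lambda>i \<tau>. ts ! i)"
  by (simp add: sub_typed_def list_all2_conv_all_nth)

lemma has_type_apps: "has_type T \<Gamma> f (\<tau>s \<Rrightarrow>\<^sub>t \<tau>) \<Longrightarrow> has_types T \<Gamma> ts \<tau>s \<Longrightarrow> has_type T \<Gamma> (apps f ts) \<tau>"
proof (induction \<tau>s arbitrary: f ts)
  case (Cons \<rho> \<tau>s)
  then obtain u us where us: "ts = u # us" "has_type T \<Gamma> u \<rho>" "has_types T \<Gamma> us \<tau>s"
    by (auto simp: list_all2_Cons2)
  have "has_type T \<Gamma> (f \<cdot> u) (\<tau>s \<Rrightarrow>\<^sub>t \<tau>)"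
    using Cons.prems us by (auto intro: has_type.intros(3))
  from Cons.IH [OF this us(3)] show ?case
    by (simp add: us(1) apps_def)
qed (simp add: apps_def)

text \<open>\<open>F\<close> is the identity for tuples of values and \<open>FinSet\<close> for
  tuples of bounds.\<close>

lemma has_types_tapp:
  assumes "has_types T \<Gamma> fs (map (\<lambda>\<tau>. \<tau>s \<Rrightarrow>\<^sub>t F \<tau>) \<rho>s)" and "has_types T \<Gamma> ts \<tau>s"
  shows "has_types T \<Gamma> (fs \<bullet> ts) (map F \<rho>s)"
  using assms(1) by (auto simp: tapp_def list_all2_conv_all_nth intro!: has_type_apps [OF _ assms(2)])

lemma has_types_bvars: "has_types T (rev \<tau>s @ \<Gamma>) (bvars \<tau>s) \<tau>s"
  by (auto simp: bvars_eq list_all2_conv_all_nth nth_append rev_nth intro!: has_type.intros)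

lemma is_fm_fsub: "is_fm T \<Gamma> \<phi> \<Longrightarrow> sub_typed T \<Gamma> \<Delta> s \<Longrightarrow> is_fm T \<Delta> (fsub s \<phi>)"
proof (induction \<phi> arbitrary: \<Gamma> \<Delta> s)
  case (FEq t u)
  then show ?case by (auto intro: has_type_tsub)
next
  case (FMem t u)
  then show ?case by (auto intro: has_type_tsub)
qed (auto simp: has_types_tsub sub_typed_up)

lemma is_fm_eq: "has_type T \<Gamma> t \<tau> \<Longrightarrow> has_type T \<Gamma> u \<tau> \<Longrightarrow> is_fm T \<Gamma> (FEq t u)"
  by auto

lemma is_fm_mem:
  "\<rho> \<in> wtypes T \<Longrightarrow> has_type T \<Gamma> x \<rho> \<Longrightarrow> has_type T \<Gamma> A (FinSet \<rho>) \<Longrightarrow> is_fm T \<Gamma> (FMem x A)"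
  by auto

lemma is_fm_fshift: "is_fm T \<Gamma> \<phi> \<Longrightarrow> is_fm T (\<tau> # \<Gamma>) (fshift \<phi>)"
  unfolding fshift_def by (rule is_fm_fsub [OF _ sub_typed_Suc])

section \<open>Substitutions that agree on a context\<close>

text \<open>A substitution reads the annotation of a variable as well as its index, so agreement is
  asked only for the pairs that a well-typed term can contain. Over the empty context nothing is
  asked: closed terms and formulas are fixed by every substitution.\<close>

lemma tsub_cong:
  "has_type T \<Gamma> t \<tau> \<Longrightarrow> (\<And>i. i < length \<Gamma> \<Longrightarrow> s i (\<Gamma> ! i) = s' i (\<Gamma> ! i)) \<Longrightarrow> tsub s t = tsub s' t"
  by (induction rule: has_type.induct) auto

lemma fsub_cong:
  "is_fm T \<Gamma> \<phi> \<Longrightarrow> (\<And>i. i < length \<Gamma> \<Longrightarrow> s i (\<Gamma> ! i) = s' i (\<Gamma> ! i)) \<Longrightarrow> fsub s \<phi> = fsub s' \<phi>"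
proof (induction \<phi> arbitrary: \<Gamma> s s')
  case (FRel p ts)
  then have "tsub s t = tsub s' t" if "t \<in> set ts" for t
    using that by (fastforce simp: list_all2_conv_all_nth in_set_conv_nth intro: tsub_cong)
  then show ?case by simp
next
  case (FAll \<tau> \<phi>)
  have "fsub (up s) \<phi> = fsub (up s') \<phi>"
    by (rule FAll.IH [of "\<tau> # \<Gamma>"]) (use FAll.prems in \<open>auto simp: less_Suc_eq_0_disj\<close>)
  then show ?case by simp
next
  case (FEx \<tau> \<phi>)
  have "fsub (up s) \<phi> = fsub (up s') \<phi>"
    by (rule FEx.IH [of "\<tau> # \<Gamma>"]) (use FEx.prems in \<open>auto simp: less_Suc_eq_0_disj\<close>)
  then show ?case by simp
qed (simp; blast intro: tsub_cong)+

lemma fsub_closed: "is_fm T [] \<phi> \<Longrightarrow> fsub s \<phi> = \<phi>"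
  using fsub_cong [of T "[]" \<phi> s Var] by simp

lemma is_fm_ball:
  "wtypes T \<subseteq> ttypes T \<Longrightarrow> set \<rho>s \<subseteq> wtypes T \<Longrightarrow> has_types T \<Gamma> Bs (map FinSet \<rho>s) \<Longrightarrow>
    is_fm T (rev \<rho>s @ \<Gamma>) \<phi> \<Longrightarrow> is_fm T \<Gamma> (ball \<rho>s Bs \<phi>)"
proof (induction \<rho>s Bs \<phi> arbitrary: \<Gamma> rule: ball.induct)
  case (1 \<rho> \<rho>s B Bs \<phi>)
  have "has_type T (\<rho> # \<Gamma>) (Var 0 \<rho>) \<rho>" "has_type T (\<rho> # \<Gamma>) (shift (Suc 0) B) (FinSet \<rho>)"
    using 1 by (auto intro: has_type_shift_Suc)
  moreover have "is_fm T (\<rho> # \<Gamma>) (ball \<rho>s (shifts 1 Bs) \<phi>)"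
    by (rule "1.IH") (use 1 has_types_shifts_Suc in auto)
  ultimately show ?case using 1 by (auto intro!: bexI [of _ \<rho>])
qed auto

section \<open>Derivations and equality\<close>

locale target_calculus =
  fixes T :: "('g, 'k, 'p) target"
  assumes axs_closed: "\<And>\<phi>. \<phi> \<in> axs T \<Longrightarrow> is_fm T [] \<phi>"
    and wtypes_ttypes: "wtypes T \<subseteq> ttypes T"
    and witnessing: "witnessing_axioms T"
begin

text \<open>One induction yields weakening (with \<open>s = Var\<close>), passage to a larger
  context and instantiation of theorems. Axioms are closed and hence unaffected; below a binder
  \<open>s\<close> becomes \<open>up s\<close>, and \<open>fsub_up_fshift\<close> shows that this
  agrees with the shifted hypotheses.\<close>

lemma deriv_fsub:
  "deriv T \<Gamma> H \<phi> \<Longrightarrow> sub_typed T \<Gamma> \<Delta> s \<Longrightarrow> fsub s ` H \<subseteq> H' \<Longrightarrow> deriv T \<Delta> H' (fsub s \<phi>)"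
proof (induction arbitrary: \<Delta> s H' rule: deriv.induct)
  case (axiom \<phi> \<Gamma> H)
  then show ?case by (simp add: fsub_closed [OF axs_closed] deriv.axiom)
next
  case (hyp \<phi> H \<Gamma>)
  then show ?case by (auto intro: deriv.hyp is_fm_fsub)
next
  case (botE \<Gamma> H \<phi>)
  then show ?case by (simp add: deriv.botE is_fm_fsub)
next
  case (andI \<Gamma> H \<phi> \<psi>)
  then show ?case by (simp add: deriv.andI)
next
  case (andE1 \<Gamma> H \<phi> \<psi>)
  then show ?case by (metis deriv.andE1 fsub.simps(5))
next
  case (andE2 \<Gamma> H \<phi> \<psi>)
  then show ?case by (metis deriv.andE2 fsub.simps(5))
next
  case (orI1 \<Gamma> H \<phi> \<psi>)
  then show ?case by (simp add: deriv.orI1 is_fm_fsub)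
next
  case (orI2 \<Gamma> H \<psi> \<phi>)
  then show ?case by (simp add: deriv.orI2 is_fm_fsub)
next
  case (orE \<Gamma> H \<phi> \<psi> \<chi>)
  show ?case
  proof (rule deriv.orE)
    show "deriv T \<Delta> H' (FOr (fsub s \<phi>) (fsub s \<psi>))"
      using orE by simp
    show "deriv T \<Delta> (insert (fsub s \<phi>) H') (fsub s \<chi>)"
      by (rule orE.IH(2)) (use orE.prems in auto)
    show "deriv T \<Delta> (insert (fsub s \<psi>) H') (fsub s \<chi>)"
      by (rule orE.IH(3)) (use orE.prems in auto)
  qed
next
  case (impI \<Gamma> \<phi> H \<psi>)
  have "deriv T \<Delta> (insert (fsub s \<phi>) H') (fsub s \<psi>)"
    by (rule impI.IH) (use impI.prems in auto)
  then show ?case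
    using is_fm_fsub [OF impI.hyps(2) impI.prems(1)] by (simp add: deriv.impI)
next
  case (impE \<Gamma> H \<phi> \<psi>)
  then show ?case by (metis deriv.impE fsub.simps(7))
next
  case (allI \<tau> \<Gamma> H \<phi>)
  have "fsub (up s) ` fshift ` H \<subseteq> fshift ` H'"
    using allI.prems by (auto simp: fsub_up_fshift)
  then show ?case
    using allI by (simp add: deriv.allI sub_typed_up)
next
  case (allE \<Gamma> H \<tau> \<phi> t)
  have "deriv T \<Delta> H' (fsub (single (tsub s t)) (fsub (up s) \<phi>))"
    using allE by (metis deriv.allE fsub.simps(8) has_type_tsub)
  then show ?case by (simp add: fsub_up_single)
next
  case (exI \<Gamma> H t \<phi> \<tau>)
  have "is_fm T \<Delta> (FEx \<tau> (fsub (up s) \<phi>))"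
    using is_fm_fsub [OF exI.hyps(3) exI.prems(1)] by simp
  moreover have "deriv T \<Delta> H' (fsub (single (tsub s t)) (fsub (up s) \<phi>))"
    using exI by (simp flip: fsub_up_single)
  ultimately show ?case
    using has_type_tsub [OF exI.hyps(2) exI.prems(1)] by (simp add: deriv.exI)
next
  case (exE \<Gamma> H \<tau> \<phi> \<psi>)
  have "deriv T (\<tau> # \<Delta>) (insert (fsub (up s) \<phi>) (fshift ` H')) (fsub (up s) (fshift \<psi>))"
    by (rule exE.IH(2)) (use exE.prems in \<open>auto simp: sub_typed_up fsub_up_fshift\<close>)
  moreover have "deriv T \<Delta> H' (FEx \<tau> (fsub (up s) \<phi>))"
    using exE by simp
  ultimately show ?case
    using is_fm_fsub [OF exE.hyps(3) exE.prems(1)] deriv.exE by (metis fsub_up_fshift)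
next
  case (eqI \<Gamma> t \<tau> H)
  then show ?case by (metis deriv.eqI fsub.simps(2) has_type_tsub)
next
  case (eqE \<Gamma> H t u \<tau> \<phi>)
  have "deriv T \<Delta> H' (fsub (single (tsub s u)) (fsub (up s) \<phi>))"
  proof (rule deriv.eqE)
    show "deriv T \<Delta> H' (FEq (tsub s t) (tsub s u))"
      using eqE by simp
    show "is_fm T (\<tau> # \<Delta>) (fsub (up s) \<phi>)"
      using eqE by (auto intro: is_fm_fsub sub_typed_up)
    show "deriv T \<Delta> H' (fsub (single (tsub s t)) (fsub (up s) \<phi>))"
      using eqE by (simp flip: fsub_up_single)
  qed (use eqE in \<open>auto intro: has_type_tsub\<close>)
  then show ?case by (simp add: fsub_up_single)
qed

lemma deriv_weaken: "deriv T \<Gamma> H \<phi> \<Longrightarrow> H \<subseteq> H' \<Longrightarrow> deriv T \<Gamma> H' \<phi>"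
  using deriv_fsub [of \<Gamma> H \<phi> \<Gamma> Var H'] by (simp add: sub_typed_Var)

lemma deriv_fshift: "deriv T \<Gamma> H \<phi> \<Longrightarrow> deriv T (\<tau> # \<Gamma>) (fshift ` H) (fshift \<phi>)"
  unfolding fshift_def by (rule deriv_fsub [OF _ sub_typed_Suc]) auto

lemma deriv_cut: "deriv T \<Gamma> H \<phi> \<Longrightarrow> deriv T \<Gamma> {\<phi>} \<psi> \<Longrightarrow> is_fm T \<Gamma> \<phi> \<Longrightarrow> deriv T \<Gamma> H \<psi>"
  by (meson deriv.impE deriv.impI deriv_weaken empty_subsetI insert_mono)

section \<open>Instances of theorems and reasoning with equality\<close>

text \<open>The axioms on witnessing types and the joining of bounds are given as open theorems in
  explicit contexts; their variables serve as parameters to be replaced by terms.\<close>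

lemma proves_instance:
  "proves T \<Delta> \<phi> \<Longrightarrow> has_types T \<Gamma> ts \<Delta> \<Longrightarrow> deriv T \<Gamma> H (fsub (\<lambda>i \<tau>. ts ! i) \<phi>)"
  unfolding proves_def by (rule deriv_fsub [OF _ sub_typed_nth]) auto

text \<open>Leibniz' rule with both instances of the motive passed as equations to be checked by
  rewriting, which avoids unification against \<open>fsub (single t) \<phi>\<close>.\<close>

lemma deriv_subst:
  assumes "deriv T \<Gamma> H (FEq t u)" "has_type T \<Gamma> t \<tau>" "has_type T \<Gamma> u \<tau>" "is_fm T (\<tau> # \<Gamma>) \<phi>"
    and "deriv T \<Gamma> H \<alpha>" "fsub (single t) \<phi> = \<alpha>" "fsub (single u) \<phi> = \<beta>"
  shows "deriv T \<Gamma> H \<beta>"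
  using deriv.eqE [OF assms(1-4)] assms(5-7) by simp

lemma eq_sym:
  assumes "deriv T \<Gamma> H (FEq t u)" "has_type T \<Gamma> t \<tau>" "has_type T \<Gamma> u \<tau>"
  shows "deriv T \<Gamma> H (FEq u t)"
  by (rule deriv_subst [OF assms, where \<phi> = "FEq (Var 0 \<tau>) (shift 1 t)" and \<alpha> = "FEq t t"])
    (use assms in \<open>auto intro: deriv.eqI intro!: is_fm_eq [where \<tau> = \<tau>] has_type_shift_Suc simp del: is_fm.simps\<close>)

lemma eq_trans:
  assumes "deriv T \<Gamma> H (FEq t u)" "deriv T \<Gamma> H (FEq u v)"
    and "has_type T \<Gamma> t \<tau>" "has_type T \<Gamma> u \<tau>" "has_type T \<Gamma> v \<tau>"
  shows "deriv T \<Gamma> H (FEq t v)"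
  by (rule deriv_subst [OF assms(2,4,5), where \<phi> = "FEq (shift 1 t) (Var 0 \<tau>)" and \<alpha> = "FEq t u"])
    (use assms in \<open>auto intro: deriv.eqI intro!: is_fm_eq [where \<tau> = \<tau>] has_type_shift_Suc simp del: is_fm.simps\<close>)

lemma eq_App:
  assumes "deriv T \<Gamma> H (FEq f g)" "deriv T \<Gamma> H (FEq t u)"
    and "has_type T \<Gamma> f (\<rho> \<rightarrow>\<^sub>t \<tau>)" "has_type T \<Gamma> g (\<rho> \<rightarrow>\<^sub>t \<tau>)" "has_type T \<Gamma> t \<rho>" "has_type T \<Gamma> u \<rho>"
  shows "deriv T \<Gamma> H (FEq (f \<cdot> t) (g \<cdot> u))"
proof -
  have "deriv T \<Gamma> H (FEq (f \<cdot> t) (g \<cdot> t))"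
  proof (rule deriv_subst [OF assms(1,3,4),
        where \<phi> = "FEq (shift 1 (f \<cdot> t)) (Var 0 (\<rho> \<rightarrow>\<^sub>t \<tau>) \<cdot> shift 1 t)" and \<alpha> = "FEq (f \<cdot> t) (f \<cdot> t)"])
    show "is_fm T ((\<rho> \<rightarrow>\<^sub>t \<tau>) # \<Gamma>) (FEq (shift 1 (f \<cdot> t)) (Var 0 (\<rho> \<rightarrow>\<^sub>t \<tau>) \<cdot> shift 1 t))"
      using assms by (auto simp del: is_fm.simps intro!: is_fm_eq [where \<tau> = \<tau>]
          has_type.intros(3) [where \<rho> = \<rho>] has_type_shift_Suc)
    show "deriv T \<Gamma> H (FEq (f \<cdot> t) (f \<cdot> t))"
      using assms by (blast intro: deriv.eqI has_type.intros)
  qed auto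
  moreover have "deriv T \<Gamma> H (FEq (g \<cdot> t) (g \<cdot> u))"
  proof (rule deriv_subst [OF assms(2,5,6),
        where \<phi> = "FEq (shift 1 (g \<cdot> t)) (shift 1 g \<cdot> Var 0 \<rho>)" and \<alpha> = "FEq (g \<cdot> t) (g \<cdot> t)"])
    show "is_fm T (\<rho> # \<Gamma>) (FEq (shift 1 (g \<cdot> t)) (shift 1 g \<cdot> Var 0 \<rho>))"
      using assms by (auto simp del: is_fm.simps intro!: is_fm_eq [where \<tau> = \<tau>]
          has_type.intros(3) [where \<rho> = \<rho>] has_type_shift_Suc)
    show "deriv T \<Gamma> H (FEq (g \<cdot> t) (g \<cdot> t))"
      using assms by (blast intro: deriv.eqI has_type.intros)
  qed auto
  ultimately show ?thesis
    by (rule eq_trans [where \<tau> = \<tau>]) (use assms in \<open>auto intro: has_type.intros\<close>)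
qed

lemma eq_apps:
  "deriv T \<Gamma> H (FEq f g) \<Longrightarrow> has_type T \<Gamma> f (\<tau>s \<Rrightarrow>\<^sub>t \<tau>) \<Longrightarrow> has_type T \<Gamma> g (\<tau>s \<Rrightarrow>\<^sub>t \<tau>) \<Longrightarrow>
    has_types T \<Gamma> ts \<tau>s \<Longrightarrow> deriv T \<Gamma> H (FEq (apps f ts) (apps g ts))"
proof (induction \<tau>s arbitrary: f g ts)
  case (Cons \<rho> \<tau>s)
  then obtain u us where us: "ts = u # us" "has_type T \<Gamma> u \<rho>" "has_types T \<Gamma> us \<tau>s"
    by (auto simp: list_all2_Cons2)
  have "deriv T \<Gamma> H (FEq (apps (f \<cdot> u) us) (apps (g \<cdot> u) us))"
  proof (rule Cons.IH)
    show "deriv T \<Gamma> H (FEq (f \<cdot> u) (g \<cdot> u))"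
      using Cons.prems us by (auto intro: eq_App deriv.eqI)
  qed (use Cons.prems us in \<open>auto intro: has_type.intros(3)\<close>)
  then show ?case by (simp add: us apps_def)
qed (simp add: apps_def)

text \<open>Leibniz' rule with membership as motive; it carries an element of a union over to an
  abstraction's value that is provably equal to this union.\<close>

lemma mem_subset_eq:
  assumes "deriv T \<Gamma> H (FEq A B)" "has_type T \<Gamma> A (FinSet \<rho>)" "has_type T \<Gamma> B (FinSet \<rho>)"
    and "deriv T \<Gamma> H (FMem x A)" "has_type T \<Gamma> x \<rho>" "\<rho> \<in> wtypes T"
  shows "deriv T \<Gamma> H (FMem x B)"
  by (rule deriv_subst [OF assms(1-3), where \<phi> = "FMem (shift 1 x) (Var 0 (FinSet \<rho>))" and \<alpha> = "FMem x A"])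
    (use assms in \<open>auto intro!: bexI [of _ \<rho>] intro: has_type_shift_Suc\<close>)

section \<open>Combinators, unions and extensionality as derived rules\<close>

lemma K_eq:
  assumes "\<rho> \<in> wtypes T" "\<sigma> \<in> wtypes T" "has_type T \<Gamma> t \<rho>" "has_type T \<Gamma> u \<sigma>"
  shows "deriv T \<Gamma> H (FEq (KK \<rho> \<sigma> \<cdot> t \<cdot> u) t)"
proof -
  have "proves T [\<rho>, \<sigma>] (FEq (KK \<rho> \<sigma> \<cdot> Var 0 \<rho> \<cdot> Var 1 \<sigma>) (Var 0 \<rho>))"
    using assms witnessing by (auto simp: witnessing_axioms_def)
  from proves_instance [OF this, of \<Gamma> "[t, u]" H] assms show ?thesis
    by simp
qed

lemma S_eq:
  assumes "\<rho> \<in> wtypes T" "\<sigma> \<in> wtypes T" "\<tau> \<in> wtypes T"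
    and "has_type T \<Gamma> f (\<rho> \<rightarrow>\<^sub>t \<sigma> \<rightarrow>\<^sub>t \<tau>)" "has_type T \<Gamma> g (\<rho> \<rightarrow>\<^sub>t \<sigma>)" "has_type T \<Gamma> x \<rho>"
  shows "deriv T \<Gamma> H (FEq (SS \<rho> \<sigma> \<tau> \<cdot> f \<cdot> g \<cdot> x) (f \<cdot> x \<cdot> (g \<cdot> x)))"
proof -
  let ?f = "Var 0 (\<rho> \<rightarrow>\<^sub>t \<sigma> \<rightarrow>\<^sub>t \<tau>)" and ?g = "Var 1 (\<rho> \<rightarrow>\<^sub>t \<sigma>)" and ?x = "Var 2 \<rho>"
  have "proves T [\<rho> \<rightarrow>\<^sub>t \<sigma> \<rightarrow>\<^sub>t \<tau>, \<rho> \<rightarrow>\<^sub>t \<sigma>, \<rho>] (FEq (SS \<rho> \<sigma> \<tau> \<cdot> ?f \<cdot> ?g \<cdot> ?x) (?f \<cdot> ?x \<cdot> (?g \<cdot> ?x)))"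
    using assms witnessing by (auto simp: witnessing_axioms_def Let_def)
  from proves_instance [OF this, of \<Gamma> "[f, g, x]" H] assms show ?thesis
    by simp
qed

lemma mem_Cup:
  assumes "\<rho> \<in> wtypes T" "has_type T \<Gamma> x \<rho>" "has_type T \<Gamma> A (FinSet \<rho>)" "has_type T \<Gamma> B (FinSet \<rho>)"
  shows "deriv T \<Gamma> H (FIff (FMem x (Cup \<rho> \<cdot> A \<cdot> B)) (FOr (FMem x A) (FMem x B)))"
proof -
  let ?x = "Var 0 \<rho>" and ?A = "Var 1 (FinSet \<rho>)" and ?B = "Var 2 (FinSet \<rho>)"
  have "proves T [\<rho>, FinSet \<rho>, FinSet \<rho>]
      (FIff (FMem ?x (Cup \<rho> \<cdot> ?A \<cdot> ?B)) (FOr (FMem ?x ?A) (FMem ?x ?B)))"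
    using assms witnessing by (auto simp: witnessing_axioms_def Let_def)
  from proves_instance [OF this, of \<Gamma> "[x, A, B]" H] assms show ?thesis
    by simp
qed

lemma fun_ext:
  assumes "\<rho> \<in> wtypes T" "\<tau> \<in> wtypes T" "has_type T \<Gamma> f (\<rho> \<rightarrow>\<^sub>t \<tau>)" "has_type T \<Gamma> g (\<rho> \<rightarrow>\<^sub>t \<tau>)"
    and "deriv T (\<rho> # \<Gamma>) (fshift ` H) (FEq (shift 1 f \<cdot> Var 0 \<rho>) (shift 1 g \<cdot> Var 0 \<rho>))"
  shows "deriv T \<Gamma> H (FEq f g)"
proof -
  let ?f = "Var 0 (\<rho> \<rightarrow>\<^sub>t \<tau>)" and ?g = "Var 1 (\<rho> \<rightarrow>\<^sub>t \<tau>)"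
  have "proves T [\<rho> \<rightarrow>\<^sub>t \<tau>, \<rho> \<rightarrow>\<^sub>t \<tau>]
      (FImp (FAll \<rho> (FEq (shift 1 ?f \<cdot> Var 0 \<rho>) (shift 1 ?g \<cdot> Var 0 \<rho>))) (FEq ?f ?g))"
    using assms witnessing by (auto simp: witnessing_axioms_def Let_def)
  from proves_instance [OF this, of \<Gamma> "[f, g]" H] assms
  have "deriv T \<Gamma> H
      (FImp (FAll \<rho> (FEq (shift 1 f \<cdot> Var 0 \<rho>) (shift 1 g \<cdot> Var 0 \<rho>))) (FEq f g))"
    by (simp add: numeral_2_eq_2)
  moreover have "deriv T \<Gamma> H (FAll \<rho> (FEq (shift 1 f \<cdot> Var 0 \<rho>) (shift 1 g \<cdot> Var 0 \<rho>)))"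
    using assms wtypes_ttypes by (auto intro: deriv.allI)
  ultimately show ?thesis by (rule deriv.impE)
qed

lemma set_ext:
  assumes "\<rho> \<in> wtypes T" "has_type T \<Gamma> A (FinSet \<rho>)" "has_type T \<Gamma> B (FinSet \<rho>)"
    and "deriv T (\<rho> # \<Gamma>) (fshift ` H) (FIff (FMem (Var 0 \<rho>) (shift 1 A)) (FMem (Var 0 \<rho>) (shift 1 B)))"
  shows "deriv T \<Gamma> H (FEq A B)"
proof -
  let ?A = "Var 0 (FinSet \<rho>)" and ?B = "Var 1 (FinSet \<rho>)"
  have "proves T [FinSet \<rho>, FinSet \<rho>]
      (FImp (FAll \<rho> (FIff (FMem (Var 0 \<rho>) (shift 1 ?A)) (FMem (Var 0 \<rho>) (shift 1 ?B)))) (FEq ?A ?B))"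
    using assms witnessing by (auto simp: witnessing_axioms_def Let_def)
  from proves_instance [OF this, of \<Gamma> "[A, B]" H] assms
  have "deriv T \<Gamma> H
      (FImp (FAll \<rho> (FIff (FMem (Var 0 \<rho>) (shift 1 A)) (FMem (Var 0 \<rho>) (shift 1 B)))) (FEq A B))"
    by (simp add: numeral_2_eq_2)
  moreover have "deriv T \<Gamma> H
      (FAll \<rho> (FIff (FMem (Var 0 \<rho>) (shift 1 A)) (FMem (Var 0 \<rho>) (shift 1 B))))"
    using assms wtypes_ttypes by (auto intro: deriv.allI)
  ultimately show ?thesis by (rule deriv.impE)
qed

lemma has_type_Cup:
  "\<rho> \<in> wtypes T \<Longrightarrow> has_type T \<Gamma> A (FinSet \<rho>) \<Longrightarrow> has_type T \<Gamma> B (FinSet \<rho>) \<Longrightarrow>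
    has_type T \<Gamma> (Cup \<rho> \<cdot> A \<cdot> B) (FinSet \<rho>)"
  by (auto intro: has_type.intros)

text \<open>The union is known only through its membership law, so set extensionality reduces the
  claim to exchanging the two sides of a disjunction.\<close>

lemma Cup_commute:
  assumes "\<rho> \<in> wtypes T" "has_type T \<Gamma> A (FinSet \<rho>)" "has_type T \<Gamma> B (FinSet \<rho>)"
  shows "deriv T \<Gamma> H (FEq (Cup \<rho> \<cdot> A \<cdot> B) (Cup \<rho> \<cdot> B \<cdot> A))"
proof (rule set_ext [OF assms(1)])
  define x where "x = (Var 0 \<rho> :: ('g, 'k) tm)"
  let ?\<Gamma> = "\<rho> # \<Gamma>"
  have x: "has_type T ?\<Gamma> x \<rho>"
    by (simp add: x_def has_type.intros)
  \<comment> \<open>The two directions of the equivalence differ only by swapping the sets, so one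
    is proved for arbitrary \<open>X\<close> and \<open>Y\<close>.\<close>
  have half: "deriv T ?\<Gamma> H' (FImp (FMem x (Cup \<rho> \<cdot> X \<cdot> Y)) (FMem x (Cup \<rho> \<cdot> Y \<cdot> X)))"
    if X: "has_type T ?\<Gamma> X (FinSet \<rho>)" and Y: "has_type T ?\<Gamma> Y (FinSet \<rho>)" for X Y H'
  proof (rule deriv.impI)
    let ?m = "FMem x (Cup \<rho> \<cdot> X \<cdot> Y)"
    show fm: "is_fm T ?\<Gamma> ?m"
      by (rule is_fm_mem [OF assms(1) x has_type_Cup [OF assms(1) X Y]])
    have fmX: "is_fm T ?\<Gamma> (FMem x X)" "is_fm T ?\<Gamma> (FMem x Y)"
      by (rule is_fm_mem [OF assms(1) x X], rule is_fm_mem [OF assms(1) x Y])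
    have 1: "deriv T ?\<Gamma> (insert ?m H') (FOr (FMem x X) (FMem x Y))"
      by (rule deriv.impE [OF deriv.andE1 [OF mem_Cup [OF assms(1) x X Y]] deriv.hyp [OF insertI1 fm]])
    have or: "deriv T ?\<Gamma> (insert ?m H') (FOr (FMem x Y) (FMem x X))"
      by (rule deriv.orE [OF 1 deriv.orI2 [OF deriv.hyp [OF insertI1]] deriv.orI1 [OF deriv.hyp [OF insertI1]]])
        (rule fmX)+
    show "deriv T ?\<Gamma> (insert ?m H') (FMem x (Cup \<rho> \<cdot> Y \<cdot> X))"
      by (rule deriv.impE [OF deriv.andE2 [OF mem_Cup [OF assms(1) x Y X]] or])
  qed
  show "deriv T ?\<Gamma> (fshift ` H) (FIff (FMem (Var 0 \<rho>) (shift 1 (Cup \<rho> \<cdot> A \<cdot> B)))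
      (FMem (Var 0 \<rho>) (shift 1 (Cup \<rho> \<cdot> B \<cdot> A))))"
    unfolding x_def [symmetric] shift_simps
    using half [of "shift 1 A" "shift 1 B"] half [of "shift 1 B" "shift 1 A"] assms
    by (auto simp: has_type_shift_Suc intro: deriv.andI)
qed (use assms in \<open>auto intro: has_type_Cup\<close>)

end

section \<open>Abstraction by combinators\<close>

text \<open>Truncated subtraction also sends index 0 to 0, so indices are lowered faithfully only
  where variable 0 is absent.\<close>

abbreviation (input) tpred :: "('g, 'k) tm \<Rightarrow> ('g, 'k) tm" where
  "tpred \<equiv> tsub (\<lambda>i. Var (i - Suc 0))"

declare lam.simps [simp del]

lemma lam_const: "\<not> occurs0 t \<Longrightarrow> lam \<rho> t = KK (type_of t) \<rho> \<cdot> tpred t"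
  by (cases t) (auto simp: lam.simps)

lemma lam_Var0: "lam \<rho> (Var 0 \<tau>) = SS \<rho> (\<rho> \<rightarrow>\<^sub>t \<rho>) \<rho> \<cdot> KK \<rho> (\<rho> \<rightarrow>\<^sub>t \<rho>) \<cdot> KK \<rho> \<rho>"
  by (simp add: lam.simps)

lemma lam_App:
  "occurs0 (t \<cdot> u) \<Longrightarrow> lam \<rho> (t \<cdot> u) = SS \<rho> (type_of u) (type_of (t \<cdot> u)) \<cdot> lam \<rho> t \<cdot> lam \<rho> u"
  by (simp add: lam.simps)

lemma occurs0_shift_Suc [simp]: "\<not> occurs0 (shift (Suc n) t)"
  by (induction t) auto

text \<open>Variable 0 is fixed by \<open>up s\<close>, and every other variable becomes a shifted
  term. So \<open>lam\<close> takes the same branch before and after the substitution.\<close>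

lemma occurs0_up [simp]: "occurs0 (tsub (up s) t) \<longleftrightarrow> occurs0 t"
proof (induction t)
  case (Var i \<tau>)
  then show ?case by (cases i) auto
qed auto

lemma tsub_tpred: "\<not> occurs0 t \<Longrightarrow> tsub s (tpred t) = tpred (tsub (up s) t)"
proof (induction t)
  case (Var i \<tau>)
  then show ?case by (cases i) (auto simp: tsub_shift eta_contract_eq)
qed auto

lemma tsub_single_eq_tpred: "\<not> occurs0 t \<Longrightarrow> tsub (single u) t = tpred t"
proof (induction t)
  case (Var i \<tau>)
  then show ?case by (cases i) auto
qed auto

text \<open>The branches of \<open>lam\<close> agree by \<open>occurs0_up\<close>, and the
  annotations agree because a well-typed substitution preserves types. A variable other than 0 may
  turn into a compound term, but one free of variable 0, which \<open>lam\<close> leaves whole just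
  as it left the variable.\<close>

lemma tsub_lam:
  assumes "has_type T (\<rho> # \<Gamma>) t \<tau>" and s: "sub_typed T \<Gamma> \<Delta> s"
  shows "tsub s (lam \<rho> t) = lam \<rho> (tsub (up s) t)"
proof -
  have ty: "type_of (tsub (up s) u) = type_of u" if "has_type T (\<rho> # \<Gamma>) u \<sigma>" for u \<sigma>
    using has_type_tsub [OF that sub_typed_up [OF s]] that by (simp add: type_of_has_type)
  have const: "tsub s (lam \<rho> u) = lam \<rho> (tsub (up s) u)"
    if "has_type T (\<rho> # \<Gamma>) u \<sigma>" "\<not> occurs0 u" for u \<sigma>
    using that by (simp add: lam_const ty [OF that(1)] tsub_tpred)
  from assms(1) show ?thesis
  proof (induction rule: has_type.induct)
    case (1 i \<tau>)
    show ?case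
    proof (cases i)
      case 0
      then show ?thesis by (simp add: lam_Var0)
    next
      case (Suc j)
      then show ?thesis by (intro const [OF has_type.intros(1) [OF 1]]) simp
    qed
  next
    case (3 t \<sigma> \<tau> u)
    have tu: "has_type T (\<rho> # \<Gamma>) (t \<cdot> u) \<tau>"
      using 3 by (auto intro: has_type.intros(3))
    show ?case
    proof (cases "occurs0 (t \<cdot> u)")
      case True
      then have "occurs0 (tsub (up s) t \<cdot> tsub (up s) u)"
        by simp
      then show ?thesis
        using True 3 ty [OF tu] ty [of u \<sigma>] by (simp add: lam_App del: type_of.simps)
    next
      case False
      then show ?thesis using const [OF tu] by blast
    qed
  qed (simp_all add: lam_const)
qed

lemma lams_simps [simp]: "lams [] t = t" "lams (\<tau> # \<tau>s) t = lam \<tau> (lams \<tau>s t)"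
  by (simp_all add: lams_def)

text \<open>
  \<open>abstractable T \<Delta> \<Gamma> t \<tau>\<close>: in the context \<open>\<Delta> @ \<Gamma>\<close>, every subterm of \<open>t\<close> in which a variable of
  \<open>\<Delta>\<close> occurs has a witnessing type, so that \<open>T\<close> has the combinators needed to abstract \<open>\<Delta>\<close> from \<open>t\<close>.
\<close>

inductive abstractable ::
  "('g, 'k, 'p) target \<Rightarrow> 'g ty list \<Rightarrow> 'g ty list \<Rightarrow> ('g, 'k) tm \<Rightarrow> 'g ty \<Rightarrow> bool" for T \<Delta> \<Gamma> where
  const: "has_type T \<Gamma> t \<tau> \<Longrightarrow> \<tau> \<in> wtypes T \<Longrightarrow> abstractable T \<Delta> \<Gamma> (shift (length \<Delta>) t) \<tau>"
| var: "i < length \<Delta> \<Longrightarrow> \<Delta> ! i = \<tau> \<Longrightarrow> \<tau> \<in> wtypes T \<Longrightarrow> abstractable T \<Delta> \<Gamma> (Var i \<tau>) \<tau>"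
| app: "abstractable T \<Delta> \<Gamma> t (\<rho> \<rightarrow>\<^sub>t \<tau>) \<Longrightarrow> abstractable T \<Delta> \<Gamma> u \<rho> \<Longrightarrow> abstractable T \<Delta> \<Gamma> (t \<cdot> u) \<tau>"

lemma abstractable_has_type: "abstractable T \<Delta> \<Gamma> t \<tau> \<Longrightarrow> has_type T (\<Delta> @ \<Gamma>) t \<tau>"
proof (induction rule: abstractable.induct)
  case (app t \<rho> \<tau> u)
  then show ?case by (auto intro: has_type.intros(3))
qed (auto intro: has_type_shift has_type.intros(1) simp: nth_append)

lemma abstractable_wtypes: "abstractable T \<Delta> \<Gamma> t \<tau> \<Longrightarrow> \<tau> \<in> wtypes T"
  by (induction rule: abstractable.induct) (auto simp: wtypes_Fun)

text \<open>Closedness removes the shift from the rule \<open>const\<close>; this covers the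
  combinators and the terms of a joining.\<close>

lemma abstractable_closed:
  "has_type T \<Gamma> t \<tau> \<Longrightarrow> \<tau> \<in> wtypes T \<Longrightarrow> (\<And>s. tsub s t = t) \<Longrightarrow> abstractable T \<Delta> \<Gamma> t \<tau>"
  using abstractable.const [of T \<Gamma> t \<tau> \<Delta>] by (simp add: shift_def)

lemma abstractable_Nil: "abstractable T [] \<Gamma> t \<tau> \<longleftrightarrow> has_type T \<Gamma> t \<tau> \<and> \<tau> \<in> wtypes T"
  using abstractable.const [of T \<Gamma> t \<tau> "[]"] abstractable_has_type [of T "[]" \<Gamma> t \<tau>]
  by (auto dest: abstractable_wtypes)

text \<open>On the variables to be abstracted, \<open>s\<close> must itself give abstractable terms.
  On the others it acts as \<open>s'\<close> followed by a shift past the new segment, so a constant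
  remains a constant, whatever non-witnessing types occur inside it.\<close>

lemma abstractable_tsub:
  assumes "abstractable T \<Delta> \<Gamma> t \<tau>" "sub_typed T \<Gamma> \<Gamma>' s'"
    and "\<And>i. i < length \<Delta> \<Longrightarrow> \<Delta> ! i \<in> wtypes T \<Longrightarrow> abstractable T \<Delta>' \<Gamma>' (s i (\<Delta> ! i)) (\<Delta> ! i)"
    and s: "\<And>i. i < length \<Gamma> \<Longrightarrow> s (i + length \<Delta>) (\<Gamma> ! i) = shift (length \<Delta>') (s' i (\<Gamma> ! i))"
  shows "abstractable T \<Delta>' \<Gamma>' (tsub s t) \<tau>"
  using assms(1)
proof (induction rule: abstractable.induct)
  case (const t \<tau>)
  have "tsub s (shift (length \<Delta>) t) = shift (length \<Delta>') (tsub s' t)"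
    unfolding tsub_shift shift_tsub by (rule tsub_cong [OF const(1)]) (rule s)
  then show ?case
    using abstractable.const [OF has_type_tsub [OF const(1) assms(2)] const(2)] by metis
next
  case (var i \<tau>)
  then show ?case using assms(3) by auto
next
  case (app t \<rho> \<tau> u)
  then show ?case by (auto intro: abstractable.app)
qed

lemma abstractable_shift:
  assumes "abstractable T \<Delta> \<Gamma> t \<tau>" and "n = length \<Delta>'"
  shows "abstractable T (\<Delta>' @ \<Delta>) \<Gamma> (shift n t) \<tau>"
  unfolding shift_def
  by (rule abstractable_tsub [OF assms(1) sub_typed_Var])
    (auto simp: assms(2) nth_append intro: abstractable.var)

lemma abstractable_tpred:
  "abstractable T (\<rho> # \<Delta>) \<Gamma> t \<tau> \<Longrightarrow> \<not> occurs0 t \<Longrightarrow> abstractable T \<Delta> \<Gamma> (tpred t) \<tau>"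
proof (induction rule: abstractable.induct)
  case (const t \<tau>)
  have "tpred (shift (length (\<rho> # \<Delta>)) t) = shift (length \<Delta>) t"
    by (simp add: shift_def tsub_tsub)
  then show ?case
    using abstractable.const [OF const(1,2)] by metis
next
  case (var i \<tau>)
  then show ?case by (cases i) (auto intro: abstractable.var)
next
  case (app t \<sigma> \<tau> u)
  then show ?case by (auto intro: abstractable.app)
qed

lemma abstractable_lam_const:
  assumes "abstractable T (\<rho> # \<Delta>) \<Gamma> t \<tau>" "\<not> occurs0 t" "\<rho> \<in> wtypes T"
  shows "abstractable T \<Delta> \<Gamma> (lam \<rho> t) (\<rho> \<rightarrow>\<^sub>t \<tau>)"
proof -
  have \<tau>: "type_of t = \<tau>" "\<tau> \<in> wtypes T"
    using assms abstractable_has_type abstractable_wtypes type_of_has_type by blast+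
  have "abstractable T \<Delta> \<Gamma> (KK \<tau> \<rho>) (\<tau> \<rightarrow>\<^sub>t \<rho> \<rightarrow>\<^sub>t \<tau>)"
    using \<tau> assms(3) by (auto intro!: abstractable_closed has_type.intros wtypes.intros)
  then show ?thesis
    using abstractable_tpred [OF assms(1,2)] \<tau> by (auto simp: lam_const [OF assms(2)] intro: abstractable.app)
qed

text \<open>The variables of \<open>\<Delta>\<close> can still be abstracted from the result, which
  is what allows \<open>lams\<close> to iterate \<open>lam\<close>.\<close>

lemma abstractable_lam:
  assumes "abstractable T (\<rho> # \<Delta>) \<Gamma> t \<tau>" and \<rho>: "\<rho> \<in> wtypes T"
  shows "abstractable T \<Delta> \<Gamma> (lam \<rho> t) (\<rho> \<rightarrow>\<^sub>t \<tau>)"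
  using assms(1)
proof (induction rule: abstractable.induct)
  case (const t \<tau>)
  then show ?case
    using abstractable.const [of T \<Gamma> t \<tau> "\<rho> # \<Delta>"] by (intro abstractable_lam_const \<rho>) auto
next
  case (var i \<tau>)
  show ?case
  proof (cases i)
    case 0
    have "abstractable T \<Delta> \<Gamma> (SS \<rho> (\<rho> \<rightarrow>\<^sub>t \<rho>) \<rho>)
        ((\<rho> \<rightarrow>\<^sub>t (\<rho> \<rightarrow>\<^sub>t \<rho>) \<rightarrow>\<^sub>t \<rho>) \<rightarrow>\<^sub>t (\<rho> \<rightarrow>\<^sub>t \<rho> \<rightarrow>\<^sub>t \<rho>) \<rightarrow>\<^sub>t \<rho> \<rightarrow>\<^sub>t \<rho>)"
      "abstractable T \<Delta> \<Gamma> (KK \<rho> (\<rho> \<rightarrow>\<^sub>t \<rho>)) (\<rho> \<rightarrow>\<^sub>t (\<rho> \<rightarrow>\<^sub>t \<rho>) \<rightarrow>\<^sub>t \<rho>)"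
      "abstractable T \<Delta> \<Gamma> (KK \<rho> \<rho>) (\<rho> \<rightarrow>\<^sub>t \<rho> \<rightarrow>\<^sub>t \<rho>)"
      using \<rho> by (auto intro!: abstractable_closed has_type.intros wtypes.intros)
    then show ?thesis
      using 0 var by (auto simp: lam_Var0 intro: abstractable.app)
  next
    case (Suc j)
    then show ?thesis
      using var abstractable.var [of i "\<rho> # \<Delta>" \<tau> T \<Gamma>] by (intro abstractable_lam_const \<rho>) auto
  qed
next
  case (app t \<sigma> \<tau> u)
  note tu = abstractable.app [OF app.hyps]
  show ?case
  proof (cases "occurs0 (t \<cdot> u)")
    case True
    have ty: "type_of u = \<sigma>" "type_of (t \<cdot> u) = \<tau>"
      using abstractable_has_type [OF tu] abstractable_has_type [OF app.hyps(2)] type_of_has_type by blast+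
    have w: "\<sigma> \<in> wtypes T" "\<tau> \<in> wtypes T"
      using abstractable_wtypes [OF tu] abstractable_wtypes [OF app.hyps(2)] by auto
    have "abstractable T \<Delta> \<Gamma> (SS \<rho> \<sigma> \<tau>) ((\<rho> \<rightarrow>\<^sub>t \<sigma> \<rightarrow>\<^sub>t \<tau>) \<rightarrow>\<^sub>t (\<rho> \<rightarrow>\<^sub>t \<sigma>) \<rightarrow>\<^sub>t \<rho> \<rightarrow>\<^sub>t \<tau>)"
      using \<rho> w by (auto intro!: abstractable_closed has_type.intros wtypes.intros)
    then show ?thesis
      using app.IH unfolding lam_App [OF True] ty by (blast intro: abstractable.app)
  next
    case False
    then show ?thesis using abstractable_lam_const [OF tu _ \<rho>] by blast
  qed
qed

lemma abstractable_lams: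
  "abstractable T (rev \<tau>s @ \<Delta>) \<Gamma> t \<tau> \<Longrightarrow> set \<tau>s \<subseteq> wtypes T \<Longrightarrow>
    abstractable T \<Delta> \<Gamma> (lams \<tau>s t) (\<tau>s \<Rrightarrow>\<^sub>t \<tau>)"
  by (induction \<tau>s arbitrary: \<Delta>) (auto intro: abstractable_lam)

lemma abstractable_apps:
  "abstractable T \<Delta> \<Gamma> f (\<tau>s \<Rrightarrow>\<^sub>t \<tau>) \<Longrightarrow> list_all2 (abstractable T \<Delta> \<Gamma>) ts \<tau>s \<Longrightarrow>
    abstractable T \<Delta> \<Gamma> (apps f ts) \<tau>"
proof (induction \<tau>s arbitrary: f ts)
  case (Cons \<rho> \<tau>s)
  then obtain u us where us: "ts = u # us" "abstractable T \<Delta> \<Gamma> u \<rho>" "list_all2 (abstractable T \<Delta> \<Gamma>) us \<tau>s"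
    by (auto simp: list_all2_Cons2)
  have "abstractable T \<Delta> \<Gamma> (f \<cdot> u) (\<tau>s \<Rrightarrow>\<^sub>t \<tau>)"
    using Cons.prems us by (auto intro: abstractable.app)
  from Cons.IH [OF this us(3)] show ?case
    by (simp add: us(1) apps_def)
qed (simp add: apps_def)

lemma abstractable_bvars:
  "set \<tau>s \<subseteq> wtypes T \<Longrightarrow> list_all2 (abstractable T (rev \<tau>s @ \<Delta>) \<Gamma>) (bvars \<tau>s) \<tau>s"
  by (auto simp: bvars_eq list_all2_conv_all_nth nth_append rev_nth intro!: abstractable.var)

text \<open>\<open>\<Delta>\<close> varies because the outermost bound variable joins it when the
  induction goes below the first abstraction; \<open>abstractable_lams\<close> supplies the typing
  that \<open>tsub_lam\<close> requires at each layer.\<close>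

lemma tsub_lams:
  "abstractable T (rev \<tau>s @ \<Delta>) \<Gamma> t \<tau> \<Longrightarrow> set \<tau>s \<subseteq> wtypes T \<Longrightarrow> sub_typed T (\<Delta> @ \<Gamma>) \<Gamma>' s \<Longrightarrow>
    tsub s (lams \<tau>s t) = lams \<tau>s (tsub (upn (length \<tau>s) s) t)"
proof (induction \<tau>s arbitrary: \<Delta> \<Gamma>' s)
  case (Cons \<rho> \<tau>s)
  have t: "abstractable T (rev \<tau>s @ \<rho> # \<Delta>) \<Gamma> t \<tau>" and \<tau>s: "set \<tau>s \<subseteq> wtypes T"
    using Cons.prems by auto
  have "tsub s (lam \<rho> (lams \<tau>s t)) = lam \<rho> (tsub (up s) (lams \<tau>s t))"
    using abstractable_has_type [OF abstractable_lams [OF t \<tau>s]] Cons.prems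
    by (auto intro: tsub_lam)
  also have "tsub (up s) (lams \<tau>s t) = lams \<tau>s (tsub (upn (length \<tau>s) (up s)) t)"
    using Cons.prems by (intro Cons.IH [OF t \<tau>s]) (auto dest: sub_typed_up)
  finally show ?case by (simp add: upn_up)
qed simp

section \<open>Simultaneous substitution and beta conversion for tuples\<close>

definition msub :: "('g, 'k) tm list \<Rightarrow> ('g, 'k) sub" where
  "msub us = (\<lambda>i \<tau>. if i < length us then rev us ! i else Var (i - length us) \<tau>)"

lemma tsub_msub_shift [simp]: "length us = n \<Longrightarrow> tsub (msub us) (shift n t) = t"
  by (auto simp: tsub_shift msub_def eta_contract_eq)

lemma map_msub_shifts [simp]: "length us = n \<Longrightarrow> map (tsub (msub us)) (shifts n ts) = ts"
  by (simp add: o_def)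

lemma map_msub_bvars [simp]: "length us = length \<tau>s \<Longrightarrow> map (tsub (msub us)) (bvars \<tau>s) = us"
  by (rule nth_equalityI) (auto simp: bvars_eq msub_def rev_nth)

text \<open>Beta conversion eliminates the outermost variable first, and this variable lies outside
  \<open>length us\<close> further binders. The shift that \<open>u\<close> acquires there is undone
  by \<open>msub us\<close>.\<close>

lemma tsub_msub_Cons: "tsub (msub (u # us)) t = tsub (msub us) (tsub (upn (length us) (single u)) t)"
proof -
  have "msub (u # us) i \<tau> = tsub (msub us) (upn (length us) (single u) i \<tau>)" for i \<tau>
  proof (cases "i < length us")
    case True
    then show ?thesis by (simp add: upn_apply) (simp add: msub_def nth_append)
  next
    case False
    then show ?thesis
      by (cases "i - length us") (auto simp: upn_apply, auto simp: msub_def nth_append)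
  qed
  then have "msub (u # us) = (\<lambda>i \<tau>. tsub (msub us) (upn (length us) (single u) i \<tau>))"
    by (intro ext)
  then show ?thesis by (simp only: tsub_tsub)
qed

lemma sub_typed_msub: "has_types T \<Gamma> us \<tau>s \<Longrightarrow> sub_typed T (rev \<tau>s @ \<Gamma>) \<Gamma> (msub us)"
  by (auto simp: sub_typed_def msub_def list_all2_conv_all_nth nth_append rev_nth intro!: has_type.intros)

context target_calculus
begin

lemma lam_beta_const:
  assumes "abstractable T (\<rho> # \<Delta>) \<Gamma> t \<tau>" "\<not> occurs0 t" "has_type T (\<Delta> @ \<Gamma>) u \<rho>" "\<rho> \<in> wtypes T"
  shows "deriv T (\<Delta> @ \<Gamma>) H (FEq (lam \<rho> t \<cdot> u) (tsub (single u) t))"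
  using assms abstractable_has_type [OF assms(1)] abstractable_wtypes [OF assms(1)]
    abstractable_has_type [OF abstractable_tpred [OF assms(1,2)]]
  by (simp add: lam_const type_of_has_type tsub_single_eq_tpred K_eq)

text \<open>Induction on \<open>abstractable\<close> instead of typing: the laws of
  \<open>KK\<close> and \<open>SS\<close> are available at witnessing types only, and
  \<open>abstractable_wtypes\<close> guarantees these for every subterm that the induction
  meets.\<close>

lemma lam_beta:
  assumes "abstractable T (\<rho> # \<Delta>) \<Gamma> t \<tau>" and u: "has_type T (\<Delta> @ \<Gamma>) u \<rho>" and \<rho>: "\<rho> \<in> wtypes T"
  shows "deriv T (\<Delta> @ \<Gamma>) H (FEq (lam \<rho> t \<cdot> u) (tsub (single u) t))"
  using assms(1)
proof (induction rule: abstractable.induct)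
  case (const t \<tau>)
  then show ?case
    using abstractable.const [of T \<Gamma> t \<tau> "\<rho> # \<Delta>"] by (intro lam_beta_const \<rho> u) auto
next
  case (var i \<tau>)
  show ?case
  proof (cases i)
    case 0
    let ?K = "KK \<rho> (\<rho> \<rightarrow>\<^sub>t \<rho>)" and ?k = "KK \<rho> \<rho>"
    have ty: "has_type T (\<Delta> @ \<Gamma>) ?K (\<rho> \<rightarrow>\<^sub>t (\<rho> \<rightarrow>\<^sub>t \<rho>) \<rightarrow>\<^sub>t \<rho>)" "has_type T (\<Delta> @ \<Gamma>) ?k (\<rho> \<rightarrow>\<^sub>t \<rho> \<rightarrow>\<^sub>t \<rho>)"
      "has_type T (\<Delta> @ \<Gamma>) (SS \<rho> (\<rho> \<rightarrow>\<^sub>t \<rho>) \<rho>)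
        ((\<rho> \<rightarrow>\<^sub>t (\<rho> \<rightarrow>\<^sub>t \<rho>) \<rightarrow>\<^sub>t \<rho>) \<rightarrow>\<^sub>t (\<rho> \<rightarrow>\<^sub>t \<rho> \<rightarrow>\<^sub>t \<rho>) \<rightarrow>\<^sub>t \<rho> \<rightarrow>\<^sub>t \<rho>)"
      using \<rho> by (auto intro!: has_type.intros wtypes.intros)
    have "deriv T (\<Delta> @ \<Gamma>) H (FEq (SS \<rho> (\<rho> \<rightarrow>\<^sub>t \<rho>) \<rho> \<cdot> ?K \<cdot> ?k \<cdot> u) (?K \<cdot> u \<cdot> (?k \<cdot> u)))"
      using \<rho> u ty by (auto intro: S_eq wtypes.intros)
    moreover have "deriv T (\<Delta> @ \<Gamma>) H (FEq (?K \<cdot> u \<cdot> (?k \<cdot> u)) u)"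
      using \<rho> u ty by (auto intro!: K_eq wtypes.intros intro: has_type.intros(3))
    ultimately have "deriv T (\<Delta> @ \<Gamma>) H (FEq (SS \<rho> (\<rho> \<rightarrow>\<^sub>t \<rho>) \<rho> \<cdot> ?K \<cdot> ?k \<cdot> u) u)"
      by (rule eq_trans [where \<tau> = \<rho>]) (use ty u in \<open>blast intro: has_type.intros(3)\<close>)+
    then show ?thesis by (simp add: 0 lam_Var0)
  next
    case (Suc j)
    then show ?thesis
      using var abstractable.var [of i "\<rho> # \<Delta>" \<tau> T \<Gamma>] by (intro lam_beta_const \<rho> u) auto
  qed
next
  case (app t \<sigma> \<tau> v)
  note tv = abstractable.app [OF app.hyps]
  show ?case
  proof (cases "occurs0 (t \<cdot> v)")
    case True
    let ?S = "SS \<rho> \<sigma> \<tau> \<cdot> lam \<rho> t \<cdot> lam \<rho> v \<cdot> u"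
    have ty: "type_of v = \<sigma>" "type_of (t \<cdot> v) = \<tau>"
      using abstractable_has_type [OF tv] abstractable_has_type [OF app.hyps(2)] type_of_has_type by blast+
    have w: "\<sigma> \<in> wtypes T" "\<tau> \<in> wtypes T"
      using abstractable_wtypes [OF tv] abstractable_wtypes [OF app.hyps(2)] by auto
    have l: "has_type T (\<Delta> @ \<Gamma>) (lam \<rho> t) (\<rho> \<rightarrow>\<^sub>t \<sigma> \<rightarrow>\<^sub>t \<tau>)" "has_type T (\<Delta> @ \<Gamma>) (lam \<rho> v) (\<rho> \<rightarrow>\<^sub>t \<sigma>)"
      using abstractable_has_type [OF abstractable_lam [OF app.hyps(1) \<rho>]]
        abstractable_has_type [OF abstractable_lam [OF app.hyps(2) \<rho>]] by auto
    have lu: "has_type T (\<Delta> @ \<Gamma>) (lam \<rho> t \<cdot> u) (\<sigma> \<rightarrow>\<^sub>t \<tau>)" "has_type T (\<Delta> @ \<Gamma>) (lam \<rho> v \<cdot> u) \<sigma>"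
      using l u by (blast intro: has_type.intros(3))+
    have s: "has_type T (\<Delta> @ \<Gamma>) (tsub (single u) t) (\<sigma> \<rightarrow>\<^sub>t \<tau>)" "has_type T (\<Delta> @ \<Gamma>) (tsub (single u) v) \<sigma>"
      using abstractable_has_type [OF app.hyps(1)] abstractable_has_type [OF app.hyps(2)]
        sub_typed_single [OF u] by (auto intro: has_type_tsub)
    have "has_type T (\<Delta> @ \<Gamma>) (SS \<rho> \<sigma> \<tau>) ((\<rho> \<rightarrow>\<^sub>t \<sigma> \<rightarrow>\<^sub>t \<tau>) \<rightarrow>\<^sub>t (\<rho> \<rightarrow>\<^sub>t \<sigma>) \<rightarrow>\<^sub>t \<rho> \<rightarrow>\<^sub>t \<tau>)"
      using \<rho> w by (auto intro: has_type.intros)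
    then have tS: "has_type T (\<Delta> @ \<Gamma>) ?S \<tau>"
      using l u by (blast intro: has_type.intros(3))
    have "deriv T (\<Delta> @ \<Gamma>) H (FEq ?S (lam \<rho> t \<cdot> u \<cdot> (lam \<rho> v \<cdot> u)))"
      by (rule S_eq [OF \<rho> w l u])
    moreover have "deriv T (\<Delta> @ \<Gamma>) H
        (FEq (lam \<rho> t \<cdot> u \<cdot> (lam \<rho> v \<cdot> u)) (tsub (single u) t \<cdot> tsub (single u) v))"
      by (rule eq_App [OF app.IH lu(1) s(1) lu(2) s(2)])
    ultimately have "deriv T (\<Delta> @ \<Gamma>) H (FEq ?S (tsub (single u) t \<cdot> tsub (single u) v))"
      by (rule eq_trans [OF _ _ tS has_type.intros(3) [OF lu] has_type.intros(3) [OF s]])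
    then show ?thesis
      by (simp add: lam_App [OF True] ty del: type_of.simps)
  next
    case False
    then show ?thesis using lam_beta_const [OF tv _ u \<rho>] by blast
  qed
qed

text \<open>One application of \<open>lam_beta\<close> treats the outermost abstraction,
  \<open>tsub_lams\<close> pushes the resulting substitution inside the others, and the induction
  hypothesis is used for the new body \<open>t'\<close>.\<close>

lemma lams_beta:
  "abstractable T (rev \<tau>s) \<Gamma> t \<tau> \<Longrightarrow> set \<tau>s \<subseteq> wtypes T \<Longrightarrow> has_types T \<Gamma> us \<tau>s \<Longrightarrow>
    deriv T \<Gamma> H (FEq (apps (lams \<tau>s t) us) (tsub (msub us) t))"
proof (induction \<tau>s arbitrary: t us)
  case Nil
  then show ?case
    using abstractable_has_type [OF Nil(1)] by (auto simp: apps_def msub_def eta_contract_eq intro: deriv.eqI)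
next
  case (Cons \<rho> \<tau>s)
  then obtain u us' where us: "us = u # us'" "has_type T \<Gamma> u \<rho>" "has_types T \<Gamma> us' \<tau>s"
    by (auto simp: list_all2_Cons2)
  have len: "length us' = length \<tau>s"
    using us(3) by (rule list_all2_lengthD)
  have t: "abstractable T (rev \<tau>s @ [\<rho>]) \<Gamma> t \<tau>" and \<tau>s: "set \<tau>s \<subseteq> wtypes T" and \<rho>: "\<rho> \<in> wtypes T"
    using Cons.prems by auto
  define t' where "t' = tsub (upn (length \<tau>s) (single u)) t"
  have l: "abstractable T [\<rho>] \<Gamma> (lams \<tau>s t) (\<tau>s \<Rrightarrow>\<^sub>t \<tau>)"
    by (rule abstractable_lams [OF t \<tau>s])
  have "tsub (single u) (lams \<tau>s t) = lams \<tau>s t'"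
    unfolding t'_def by (rule tsub_lams [OF t \<tau>s]) (use us in \<open>auto intro: sub_typed_single\<close>)
  then have 1: "deriv T \<Gamma> H (FEq (lam \<rho> (lams \<tau>s t) \<cdot> u) (lams \<tau>s t'))"
    using lam_beta [of \<rho> "[]" \<Gamma> _ _ u, OF l _ \<rho>] us(2) by simp
  have t': "abstractable T (rev \<tau>s) \<Gamma> t' \<tau>"
    unfolding t'_def
  proof (rule abstractable_tsub [OF t sub_typed_Var])
    fix i
    assume i: "i < length (rev \<tau>s @ [\<rho>])" "(rev \<tau>s @ [\<rho>]) ! i \<in> wtypes T"
    show "abstractable T (rev \<tau>s) \<Gamma> (upn (length \<tau>s) (single u) i ((rev \<tau>s @ [\<rho>]) ! i)) ((rev \<tau>s @ [\<rho>]) ! i)"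
    proof (cases "i < length \<tau>s")
      case True
      then show ?thesis using i by (auto simp: upn_apply nth_append intro: abstractable.var)
    next
      case False
      \<comment> \<open>\<open>\<rho>\<close> is the outermost bound type and hence the last in the
        segment. Its variable is replaced by \<open>u\<close> shifted past the remaining ones, which
        counts as a constant.\<close>
      then have "i = length \<tau>s"
        using i by simp
      then show ?thesis
        using abstractable.const [OF us(2) \<rho>, of "rev \<tau>s"] by (simp add: upn_apply nth_append)
    qed
  qed (simp add: upn_apply)
  have lu: "has_type T \<Gamma> (lam \<rho> (lams \<tau>s t) \<cdot> u) (\<tau>s \<Rrightarrow>\<^sub>t \<tau>)"
    using abstractable_has_type [OF abstractable_lam [OF l \<rho>]] us(2) by (auto intro: has_type.intros(3))
  have l': "has_type T \<Gamma> (lams \<tau>s t') (\<tau>s \<Rrightarrow>\<^sub>t \<tau>)"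
    using abstractable_has_type [OF abstractable_lams [of T \<tau>s "[]"]] t' \<tau>s by auto
  have m: "has_type T \<Gamma> (tsub (msub us') t') \<tau>"
    by (rule has_type_tsub [OF abstractable_has_type [OF t'] sub_typed_msub [OF us(3)]])
  have "deriv T \<Gamma> H (FEq (apps (lam \<rho> (lams \<tau>s t) \<cdot> u) us') (apps (lams \<tau>s t') us'))"
    by (rule eq_apps [OF 1 lu l' us(3)])
  from eq_trans [OF this Cons.IH [OF t' \<tau>s us(3)] has_type_apps [OF lu us(3)] has_type_apps [OF l' us(3)] m]
  show ?case
    by (simp add: us(1) apps_def tsub_msub_Cons len t'_def)
qed

section \<open>Abstraction preserves provable equality\<close>

text \<open>Equality under an abstraction is not a rule of the calculus. Both abstractions are
  applied to a fresh variable, beta conversion gives back the bodies, and \<open>fun_ext\<close>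
  concludes.\<close>

lemma lam_xi:
  assumes "deriv T (\<rho> # \<Delta> @ \<Gamma>) {} (FEq t t')" and \<rho>: "\<rho> \<in> wtypes T"
    and t: "abstractable T (\<rho> # \<Delta>) \<Gamma> t \<tau>" "abstractable T (\<rho> # \<Delta>) \<Gamma> t' \<tau>"
  shows "deriv T (\<Delta> @ \<Gamma>) {} (FEq (lam \<rho> t) (lam \<rho> t'))"
proof -
  let ?x = "Var 0 \<rho> :: ('g, 'k) tm" and ?sh = "\<lambda>i. Var (Suc i) :: 'g ty \<Rightarrow> ('g, 'k) tm"
  have beta: "deriv T (\<rho> # \<Delta> @ \<Gamma>) {} (FEq (shift 1 (lam \<rho> s) \<cdot> ?x) s)"
    and typed: "has_type T (\<rho> # \<Delta> @ \<Gamma>) (shift 1 (lam \<rho> s) \<cdot> ?x) \<tau>"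
    if s: "abstractable T (\<rho> # \<Delta>) \<Gamma> s \<tau>" for s
  proof -
    have 1: "shift (Suc 0) (lam \<rho> s) = lam \<rho> (tsub (up ?sh) s)"
      using tsub_lam [OF _ sub_typed_Suc, of T \<rho> "\<Delta> @ \<Gamma>" s \<tau>] abstractable_has_type [OF s]
      by (simp add: shift_def)
    have 2: "abstractable T (\<rho> # \<rho> # \<Delta>) \<Gamma> (tsub (up ?sh) s) \<tau>"
    proof (rule abstractable_tsub [OF s sub_typed_Var])
      fix i
      assume "i < length (\<rho> # \<Delta>)" "(\<rho> # \<Delta>) ! i \<in> wtypes T"
      then show "abstractable T (\<rho> # \<rho> # \<Delta>) \<Gamma> (up ?sh i ((\<rho> # \<Delta>) ! i)) ((\<rho> # \<Delta>) ! i)"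
        by (cases i) (auto intro: abstractable.var)
    qed simp
    \<comment> \<open>Index 0 receives the annotation \<open>\<rho>\<close> whatever annotation it
      carried, so this identity is confined to terms typed in the context.\<close>
    have "tsub (single ?x) (tsub (up ?sh) s) = tsub Var s"
      unfolding tsub_tsub
    proof (rule tsub_cong [OF abstractable_has_type [OF s]])
      fix i
      show "tsub (single ?x) (up ?sh i (((\<rho> # \<Delta>) @ \<Gamma>) ! i)) = Var i (((\<rho> # \<Delta>) @ \<Gamma>) ! i)"
        by (cases i) auto
    qed
    then show "deriv T (\<rho> # \<Delta> @ \<Gamma>) {} (FEq (shift 1 (lam \<rho> s) \<cdot> ?x) s)"
      using lam_beta [OF 2 _ \<rho>, of ?x "{}"] by (simp add: 1)
    show "has_type T (\<rho> # \<Delta> @ \<Gamma>) (shift 1 (lam \<rho> s) \<cdot> ?x) \<tau>"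
      using abstractable_has_type [OF abstractable_lam [OF 2 \<rho>]] by (auto simp: 1 intro: has_type.intros(3))
  qed
  have ty: "has_type T (\<rho> # \<Delta> @ \<Gamma>) t \<tau>" "has_type T (\<rho> # \<Delta> @ \<Gamma>) t' \<tau>"
    using t [THEN abstractable_has_type] by auto
  show ?thesis
  proof (rule fun_ext)
    have "deriv T (\<rho> # \<Delta> @ \<Gamma>) {} (FEq (shift 1 (lam \<rho> t) \<cdot> ?x) t')"
      by (rule eq_trans [OF beta [OF t(1)] assms(1) typed [OF t(1)] ty])
    then show "deriv T (\<rho> # \<Delta> @ \<Gamma>) (fshift ` {}) (FEq (shift 1 (lam \<rho> t) \<cdot> ?x) (shift 1 (lam \<rho> t') \<cdot> ?x))"
      unfolding image_empty
      by (rule eq_trans [OF _ eq_sym [OF beta [OF t(2)] typed [OF t(2)] ty(2)] typed [OF t(1)] ty(2) typed [OF t(2)]])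
    show "has_type T (\<Delta> @ \<Gamma>) (lam \<rho> t) (\<rho> \<rightarrow>\<^sub>t \<tau>)" "has_type T (\<Delta> @ \<Gamma>) (lam \<rho> t') (\<rho> \<rightarrow>\<^sub>t \<tau>)"
      using t \<rho> by (auto intro: abstractable_has_type abstractable_lam)
    show "\<tau> \<in> wtypes T"
      using t(1) by (rule abstractable_wtypes)
  qed (rule \<rho>)
qed

lemma lams_xi:
  "deriv T (rev \<tau>s @ \<Delta> @ \<Gamma>) {} (FEq t t') \<Longrightarrow> set \<tau>s \<subseteq> wtypes T \<Longrightarrow>
    abstractable T (rev \<tau>s @ \<Delta>) \<Gamma> t \<tau> \<Longrightarrow> abstractable T (rev \<tau>s @ \<Delta>) \<Gamma> t' \<tau> \<Longrightarrow>
    deriv T (\<Delta> @ \<Gamma>) {} (FEq (lams \<tau>s t) (lams \<tau>s t'))"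
proof (induction \<tau>s arbitrary: \<Delta>)
  case (Cons \<rho> \<tau>s)
  have "deriv T ((\<rho> # \<Delta>) @ \<Gamma>) {} (FEq (lams \<tau>s t) (lams \<tau>s t'))"
    by (rule Cons.IH) (use Cons.prems in auto)
  then show ?case
    using Cons.prems abstractable_lams [of T \<tau>s "\<rho> # \<Delta>" \<Gamma> _ \<tau>] by (auto intro!: lam_xi)
qed simp

end

section \<open>The interpretation and the joining under substitution\<close>

lemma splits_append [simp]: "length ys = length xs \<Longrightarrow> splits xs (ys @ zs) = (ys, zs)"
  by (simp add: splits_def)

lemma tsub_up_up [simp]: "tsub (up s) (up r i \<tau>) = up (\<lambda>i \<tau>. tsub s (r i \<tau>)) i \<tau>"
  by (simp add: up_comp)

lemma sub_typed_upn:
  "sub_typed T \<Gamma> \<Delta> s \<Longrightarrow> k = length \<Delta>' \<Longrightarrow> sub_typed T (\<Delta>' @ \<Gamma>) (\<Delta>' @ \<Delta>) (upn k s)"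
  by (induction \<Delta>' arbitrary: k) (auto intro: sub_typed_up)

lemma abstractable_tapp:
  assumes "list_all2 (abstractable T \<Delta> \<Gamma>) fs (map (\<lambda>\<tau>. \<tau>s \<Rrightarrow>\<^sub>t F \<tau>) \<rho>s)"
    and "list_all2 (abstractable T \<Delta> \<Gamma>) ts \<tau>s"
  shows "list_all2 (abstractable T \<Delta> \<Gamma>) (fs \<bullet> ts) (map F \<rho>s)"
  using assms(1) by (auto simp: tapp_def list_all2_conv_all_nth intro!: abstractable_apps [OF _ assms(2)])

lemma abstractable_shifts:
  "list_all2 (abstractable T \<Delta> \<Gamma>) ts \<tau>s \<Longrightarrow> n = length \<Delta>' \<Longrightarrow>
    list_all2 (abstractable T (\<Delta>' @ \<Delta>) \<Gamma>) (shifts n ts) \<tau>s"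
  by (auto simp: list_all2_conv_all_nth intro: abstractable_shift)

lemma abstractable_Nil_list:
  "set \<tau>s \<subseteq> wtypes T \<Longrightarrow> list_all2 (abstractable T [] \<Gamma>) ts \<tau>s \<longleftrightarrow> has_types T \<Gamma> ts \<tau>s"
  by (auto simp: list_all2_conv_all_nth abstractable_Nil)

section \<open>Pointwise unions of tuples of bounds\<close>

lemma length_pointwise_un [simp]:
  "length (pointwise_un \<tau>s \<rho>s gs hs) = min (length \<rho>s) (min (length gs) (length hs))"
  by (simp add: pointwise_un_def Let_def)

lemma pointwise_un_nth:
  "j < length \<rho>s \<Longrightarrow> length gs = length \<rho>s \<Longrightarrow> length hs = length \<rho>s \<Longrightarrow>
    pointwise_un \<tau>s \<rho>s gs hs ! j = lams \<tau>s (Cup (\<rho>s ! j) \<cdot>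
      apps (shift (length \<tau>s) (gs ! j)) (bvars \<tau>s) \<cdot> apps (shift (length \<tau>s) (hs ! j)) (bvars \<tau>s))"
  by (simp add: pointwise_un_def Let_def)

lemma abstractable_un:
  assumes "abstractable T \<Delta> \<Gamma> g (\<tau>s \<Rrightarrow>\<^sub>t FinSet \<rho>)" "abstractable T \<Delta> \<Gamma> h (\<tau>s \<Rrightarrow>\<^sub>t FinSet \<rho>)"
    and n: "n = length \<tau>s"
  shows "abstractable T (rev \<tau>s @ \<Delta>) \<Gamma>
    (Cup \<rho> \<cdot> apps (shift n g) (bvars \<tau>s) \<cdot> apps (shift n h) (bvars \<tau>s)) (FinSet \<rho>)"
proof -
  have w: "set \<tau>s \<subseteq> wtypes T" "\<rho> \<in> wtypes T"
    using abstractable_wtypes [OF assms(1)] by (auto simp: wtypes_funs wtypes_FinSet)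
  have "abstractable T (rev \<tau>s @ \<Delta>) \<Gamma> (apps (shift n x) (bvars \<tau>s)) (FinSet \<rho>)"
    if "abstractable T \<Delta> \<Gamma> x (\<tau>s \<Rrightarrow>\<^sub>t FinSet \<rho>)" for x
    using abstractable_shift [OF that, of n "rev \<tau>s"] abstractable_bvars [OF w(1)]
    by (auto simp: n intro: abstractable_apps)
  moreover have "abstractable T (rev \<tau>s @ \<Delta>) \<Gamma> (Cup \<rho>) (FinSet \<rho> \<rightarrow>\<^sub>t FinSet \<rho> \<rightarrow>\<^sub>t FinSet \<rho>)"
    using w by (auto intro!: abstractable_closed has_type.intros wtypes.intros)
  ultimately show ?thesis
    using assms by (blast intro: abstractable.app)
qed

lemma abstractable_pointwise_un:
  assumes "list_all2 (abstractable T \<Delta> \<Gamma>) gs (map (\<lambda>\<rho>. \<tau>s \<Rrightarrow>\<^sub>t FinSet \<rho>) \<rho>s)"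
    and "list_all2 (abstractable T \<Delta> \<Gamma>) hs (map (\<lambda>\<rho>. \<tau>s \<Rrightarrow>\<^sub>t FinSet \<rho>) \<rho>s)"
    and "set \<tau>s \<subseteq> wtypes T"
  shows "list_all2 (abstractable T \<Delta> \<Gamma>) (pointwise_un \<tau>s \<rho>s gs hs) (map (\<lambda>\<rho>. \<tau>s \<Rrightarrow>\<^sub>t FinSet \<rho>) \<rho>s)"
  using assms
  by (auto simp: list_all2_conv_all_nth pointwise_un_nth intro!: abstractable_lams abstractable_un)

lemma map_tsub_pointwise_un:
  assumes g: "has_types T \<Gamma> gs (map (\<lambda>\<rho>. \<tau>s \<Rrightarrow>\<^sub>t FinSet \<rho>) \<rho>s)"
    and h: "has_types T \<Gamma> hs (map (\<lambda>\<rho>. \<tau>s \<Rrightarrow>\<^sub>t FinSet \<rho>) \<rho>s)"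
    and w: "set \<tau>s \<subseteq> wtypes T" "set \<rho>s \<subseteq> wtypes T" and s: "sub_typed T \<Gamma> \<Delta> s"
  shows "map (tsub s) (pointwise_un \<tau>s \<rho>s gs hs) = pointwise_un \<tau>s \<rho>s (map (tsub s) gs) (map (tsub s) hs)"
proof (rule nth_equalityI)
  have len: "length gs = length \<rho>s" "length hs = length \<rho>s"
    using g h by (auto dest: list_all2_lengthD)
  fix j
  assume "j < length (map (tsub s) (pointwise_un \<tau>s \<rho>s gs hs))"
  then have j: "j < length \<rho>s"
    by simp
  have t: "abstractable T (rev \<tau>s @ []) \<Gamma> (Cup (\<rho>s ! j) \<cdot> apps (shift (length \<tau>s) (gs ! j)) (bvars \<tau>s) \<cdot>
      apps (shift (length \<tau>s) (hs ! j)) (bvars \<tau>s)) (FinSet (\<rho>s ! j))"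
    using g h j w
    by (intro abstractable_un) (auto simp: list_all2_conv_all_nth abstractable_Nil wtypes_funs wtypes_FinSet)
  from tsub_lams [OF t w(1), of \<Delta> s] s
  show "map (tsub s) (pointwise_un \<tau>s \<rho>s gs hs) ! j =
      pointwise_un \<tau>s \<rho>s (map (tsub s) gs) (map (tsub s) hs) ! j"
    using j len by (simp add: pointwise_un_nth)
qed simp

section \<open>Types of witnesses and well-formedness of the interpretation\<close>

locale joined_interpretation =
  fixes L :: "('g, 'k, 'r) source"
    and T :: "('g, 'k, 'p) target"
    and I :: "('g, 'k, 'p, 'r) base_interp"
    and J :: "('g, 'k, 'r) joining"
  assumes target: "target_theory L T"
    and base_int: "base_interpretation L T I"
    and joining: "joining_of_bounds L T I J"
begin

lemma
  stypes_subset: "stypes L \<subseteq> ttypes T" and wtypes_subset: "wtypes T \<subseteq> ttypes T" and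
  sconsts_subset: "sconsts L \<subseteq> tconsts T" and closed_axioms: "\<forall>\<phi>\<in>axs T. is_fm T [] \<phi>" and
  witnessing_target: "witnessing_axioms T"
  using target by (simp_all add: target_theory_def)

sublocale target_calculus T
  using closed_axioms wtypes_subset witnessing_target by unfold_locales blast+

lemma stypes_ttypes: "\<sigma> \<in> stypes L \<Longrightarrow> \<sigma> \<in> ttypes T"
  using stypes_subset by blast

lemma rsyms_rsymsI: "R \<in> rsyms L \<Longrightarrow> R \<in> rsymsI L"
  and Bnd_rsymsI: "\<sigma> \<in> stypes L \<Longrightarrow> Bnd \<sigma> \<in> rsymsI L"
  by (auto simp: rsymsI_def)

lemma bpos_wtypes: "R \<in> rsymsI L \<Longrightarrow> set (bpos I R) \<subseteq> wtypes T"
  and bneg_wtypes: "R \<in> rsymsI L \<Longrightarrow> set (bneg I R) \<subseteq> wtypes T"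
  and is_fm_base: "R \<in> rsymsI L \<Longrightarrow> is_fm T (arity L R @ bpos I R @ bneg I R) (base I R)"
  using base_int unfolding base_interpretation_def by blast+

text \<open>Both halves go through one induction because the positive types of an implication
  contain negative types of its parts, and conversely.\<close>

lemma pos_neg_wtypes:
  "is_sfm L \<Gamma> A \<Longrightarrow> set (pos I A) \<subseteq> wtypes T \<and> set (neg I A) \<subseteq> wtypes T"
proof (induction A arbitrary: \<Gamma>)
  case (SRel R ts)
  then show ?case using bpos_wtypes bneg_wtypes rsyms_rsymsI by simp
next
  case (SImp A B)
  then have "set (pos I A) \<subseteq> wtypes T \<and> set (neg I A) \<subseteq> wtypes T"
    "set (pos I B) \<subseteq> wtypes T \<and> set (neg I B) \<subseteq> wtypes T"
    using SImp.IH(1) [of \<Gamma>] SImp.IH(2) [of \<Gamma>] by auto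
  then show ?case by (auto simp: wtypes_funs wtypes_FinSet)
next
  case (SAll \<sigma> A)
  then have "set (pos I A) \<subseteq> wtypes T \<and> set (neg I A) \<subseteq> wtypes T"
    "set (bpos I (Bnd \<sigma>)) \<subseteq> wtypes T" "set (bneg I (Bnd \<sigma>)) \<subseteq> wtypes T"
    using SAll.IH [of "\<sigma> # \<Gamma>"] bpos_wtypes bneg_wtypes Bnd_rsymsI by auto
  then show ?case by (auto simp: wtypes_funs wtypes_FinSet)
next
  case (SEx \<sigma> A)
  then have "set (pos I A) \<subseteq> wtypes T \<and> set (neg I A) \<subseteq> wtypes T"
    "set (bpos I (Bnd \<sigma>)) \<subseteq> wtypes T" "set (bneg I (Bnd \<sigma>)) \<subseteq> wtypes T"
    using SEx.IH [of "\<sigma> # \<Gamma>"] bpos_wtypes bneg_wtypes Bnd_rsymsI by auto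
  then show ?case by (auto simp: wtypes_FinSet)
next
  case (SAnd A B)
  then show ?case using SAnd.IH(1) [of \<Gamma>] SAnd.IH(2) [of \<Gamma>] by auto
qed simp

lemmas pos_wtypes = pos_neg_wtypes [THEN conjunct1]
  and neg_wtypes = pos_neg_wtypes [THEN conjunct2]

lemma shas_type_has_type: "shas_type L \<Gamma> t \<tau> \<Longrightarrow> has_type T \<Gamma> t \<tau>"
proof (induction rule: shas_type.induct)
  case (2 k \<sigma>)
  then show ?case using sconsts_subset by (blast intro: has_type.intros(2))
next
  case (3 t \<sigma> \<tau> u)
  then show ?case by (blast intro: has_type.intros(3))
qed (simp add: has_type.intros(1))

lemma has_types_stsub:
  "list_all2 (shas_type L \<Gamma>0) ts \<tau>s \<Longrightarrow> sub_typed T \<Gamma>0 \<Gamma> r \<Longrightarrow> has_types T \<Gamma> (map (tsub r) ts) \<tau>s"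
  by (simp add: list_all2_conv_all_nth) (metis has_type_tsub shas_type_has_type)

text \<open>\<open>base_at\<close> looks its arguments up by index, and lookup commutes with
  \<open>map\<close> only inside the list. The lengths together with the typing of
  \<open>base I R\<close> confine attention to such indices.\<close>

lemma fsub_base_at:
  assumes "R \<in> rsymsI L" "length ts = length (arity L R)" "length cs = length (bpos I R)"
    and "length ds = length (bneg I R)"
  shows "fsub s (base_at I R ts cs ds) = base_at I R (map (tsub s) ts) (map (tsub s) cs) (map (tsub s) ds)"
  unfolding base_at_def fsub_fsub map_append [symmetric]
  by (rule fsub_cong [OF is_fm_base [OF assms(1)]]) (rule nth_map [symmetric], simp add: assms)

lemma is_fm_base_at:
  assumes "R \<in> rsymsI L" "has_types T \<Gamma> ts (arity L R)" "has_types T \<Gamma> cs (bpos I R)"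
    and "has_types T \<Gamma> ds (bneg I R)"
  shows "is_fm T \<Gamma> (base_at I R ts cs ds)"
  unfolding base_at_def
  by (rule is_fm_fsub [OF is_fm_base [OF assms(1)] sub_typed_nth]) (intro list_all2_appendI assms)

lemma split_length:
  assumes "length ps = length xs + length ys"
  obtains a c where "ps = a @ c" "length a = length xs" "length c = length ys"
  using assms by (metis append_take_drop_id length_append add_left_cancel length_take min_absorb2 le_add1)

text \<open>The parameter \<open>r\<close> absorbs the substitution, so the free variables of
  \<open>A\<close> and the witnesses are renumbered alike. The lengths matter because
  \<open>splits\<close> cuts tuples by length.\<close>

lemma fsub_interp:
  "is_sfm L \<Gamma> A \<Longrightarrow> length ps = length (pos I A) \<Longrightarrow> length qs = length (neg I A) \<Longrightarrow>
    fsub s (interp I r A ps qs) =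
      interp I (\<lambda>i \<tau>. tsub s (r i \<tau>)) A (map (tsub s) ps) (map (tsub s) qs)"
proof (induction A arbitrary: \<Gamma> r s ps qs)
  case (SRel R ts)
  then have "R \<in> rsymsI L" "length ts = length (arity L R)"
    by (auto dest: list_all2_lengthD rsyms_rsymsI)
  with SRel.prems show ?case by (simp add: fsub_base_at o_def tsub_tsub)
next
  case (SAnd A B)
  obtain a c where ps: "ps = a @ c" "length a = length (pos I A)" "length c = length (pos I B)"
    using SAnd.prems(2) by (auto elim: split_length)
  obtain b d where qs: "qs = b @ d" "length b = length (neg I A)" "length d = length (neg I B)"
    using SAnd.prems(3) by (auto elim: split_length)
  show ?case
    using SAnd.IH(1) [of \<Gamma>] SAnd.IH(2) [of \<Gamma>] SAnd.prems ps qs by simp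
next
  case (SImp A B)
  obtain f g where ps: "ps = f @ g" "length f = length (pos I B)" "length g = length (neg I A)"
    using SImp.prems(2) by (auto elim: split_length)
  obtain a d where qs: "qs = a @ d" "length a = length (pos I A)" "length d = length (neg I B)"
    using SImp.prems(3) by (auto elim: split_length)
  show ?case
    using SImp.IH(1) [of \<Gamma>] SImp.IH(2) [of \<Gamma>] SImp.prems ps qs by (simp add: Let_def fsub_ball o_def)
next
  case (SAll \<sigma> A)
  obtain f g where ps: "ps = f @ g" "length f = length (pos I A)" "length g = length (bneg I (Bnd \<sigma>))"
    using SAll.prems(2) by (auto elim: split_length)
  obtain u b where qs: "qs = u @ b" "length u = length (bpos I (Bnd \<sigma>))" "length b = length (neg I A)"
    using SAll.prems(3) by (auto elim: split_length)
  show ?case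
    using SAll.IH [of "\<sigma> # \<Gamma>"] SAll.prems ps qs
    \<comment> \<open>\<open>upn_apply\<close> at the number of bounded variables shows that
      \<open>Var k \<sigma>\<close>, the quantified variable itself, is left fixed.\<close>
    by (simp add: Let_def fsub_ball fsub_base_at Bnd_rsymsI o_def upn_apply [of _ _ "length _"])
next
  case (SEx \<sigma> A)
  obtain u a where ps: "ps = u @ a" "length u = length (bpos I (Bnd \<sigma>))" "length a = length (pos I A)"
    using SEx.prems(2) by (auto elim: split_length)
  obtain V B where qs: "qs = V @ B" "length V = length (bneg I (Bnd \<sigma>))" "length B = length (neg I A)"
    using SEx.prems(3) by (auto elim: split_length)
  show ?case
    using SEx.IH [of "\<sigma> # \<Gamma>"] SEx.prems ps qs
    by (simp add: Let_def fsub_ball fsub_base_at Bnd_rsymsI o_def upn_apply [of _ _ "length _"])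
qed simp

text \<open>This is the guard in both quantifier clauses; the quantified variable has index
  \<open>k\<close> because \<open>k\<close> bounded variables are bound inside it.\<close>

lemma is_fm_bound:
  assumes "\<sigma> \<in> stypes L" "has_types T \<Gamma> u (bpos I (Bnd \<sigma>))" and "k = length (bneg I (Bnd \<sigma>))"
  shows "is_fm T (rev (bneg I (Bnd \<sigma>)) @ \<sigma> # \<Gamma>)
    (base_at I (Bnd \<sigma>) [Var k \<sigma>] (shifts (k + 1) u) (bvars (bneg I (Bnd \<sigma>))))"
proof (rule is_fm_base_at)
  show "has_types T (rev (bneg I (Bnd \<sigma>)) @ \<sigma> # \<Gamma>) [Var k \<sigma>] (arity L (Bnd \<sigma>))"
    using assms(3) by (auto simp: nth_append intro: has_type.intros)
  show "has_types T (rev (bneg I (Bnd \<sigma>)) @ \<sigma> # \<Gamma>) (shifts (k + 1) u) (bpos I (Bnd \<sigma>))"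
    using has_types_shifts [OF assms(2), of "k + 1" "rev (bneg I (Bnd \<sigma>)) @ [\<sigma>]"] assms(3) by simp
qed (use assms in \<open>auto intro: has_types_bvars Bnd_rsymsI\<close>)

text \<open>The rules \<open>hyp\<close>, \<open>impI\<close> and \<open>exI\<close> demand
  well-formed formulas, and so does the motive of Leibniz' rule in
  \<open>interp_cong\<close>.\<close>

lemma is_fm_interp:
  "is_sfm L \<Gamma>0 A \<Longrightarrow> sub_typed T \<Gamma>0 \<Gamma> r \<Longrightarrow> has_types T \<Gamma> ps (pos I A) \<Longrightarrow>
    has_types T \<Gamma> qs (neg I A) \<Longrightarrow> is_fm T \<Gamma> (interp I r A ps qs)"
proof (induction A arbitrary: \<Gamma>0 \<Gamma> r ps qs)
  case (SRel R ts)
  then show ?case by (auto intro: is_fm_base_at rsyms_rsymsI has_types_stsub)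
next
  case (SAnd A B)
  then show ?case
    using SAnd.IH(1) [of \<Gamma>0] SAnd.IH(2) [of \<Gamma>0] by (auto simp: list_all2_append2)
next
  case (SImp A B)
  obtain f g where ps: "ps = f @ g" "length f = length (pos I B)"
    "has_types T \<Gamma> f (map (\<lambda>\<tau>. pos I A \<Rrightarrow>\<^sub>t \<tau>) (pos I B))"
    "has_types T \<Gamma> g (map (\<lambda>\<rho>. (pos I A @ neg I B) \<Rrightarrow>\<^sub>t FinSet \<rho>) (neg I A))"
    using SImp.prems(3) by (auto simp: list_all2_append2)
  obtain a d where qs: "qs = a @ d" "length a = length (pos I A)"
    "has_types T \<Gamma> a (pos I A)" "has_types T \<Gamma> d (neg I B)"
    using SImp.prems(4) by (auto simp: list_all2_append2)
  let ?k = "length (neg I A)"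
  have "is_fm T (rev (neg I A) @ \<Gamma>)
      (interp I (\<lambda>i \<tau>. shift ?k (r i \<tau>)) A (shifts ?k a) (bvars (neg I A)))"
    using SImp.prems qs
    by (intro SImp.IH(1) [of \<Gamma>0] sub_typed_comp_shift has_types_shifts has_types_bvars) auto
  moreover have "has_types T \<Gamma> (g \<bullet> (a @ d)) (map FinSet (neg I A))"
    by (intro has_types_tapp [OF ps(4)] list_all2_appendI qs)
  moreover have "is_fm T \<Gamma> (interp I r B (f \<bullet> a) d)"
    using SImp.prems qs has_types_tapp [OF ps(3), of a] by (intro SImp.IH(2) [of \<Gamma>0]) auto
  ultimately show ?case
    using SImp.prems(1) neg_wtypes [of \<Gamma>0 A] wtypes_ttypes ps qs by (simp add: Let_def is_fm_ball)
next
  case (SAll \<sigma> A)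
  let ?vs = "bneg I (Bnd \<sigma>)" and ?us = "bpos I (Bnd \<sigma>)"
  obtain f g where ps: "ps = f @ g" "length f = length (pos I A)"
    "has_types T \<Gamma> f (map (\<lambda>\<tau>. ?us \<Rrightarrow>\<^sub>t \<tau>) (pos I A))"
    "has_types T \<Gamma> g (map (\<lambda>\<rho>. (?us @ neg I A) \<Rrightarrow>\<^sub>t FinSet \<rho>) ?vs)"
    using SAll.prems(3) by (auto simp: list_all2_append2)
  obtain u b where qs: "qs = u @ b" "length u = length ?us"
    "has_types T \<Gamma> u ?us" "has_types T \<Gamma> b (neg I A)"
    using SAll.prems(4) by (auto simp: list_all2_append2)
  have "has_types T \<Gamma> (g \<bullet> (u @ b)) (map FinSet ?vs)"
    by (intro has_types_tapp [OF ps(4)] list_all2_appendI qs)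
  then have "has_types T (\<sigma> # \<Gamma>) (shifts (Suc 0) (g \<bullet> (u @ b))) (map FinSet ?vs)"
    by (rule has_types_shifts_Suc)
  moreover have "is_fm T (\<sigma> # \<Gamma>) (interp I (up r) A (shifts (Suc 0) (f \<bullet> u)) (shifts (Suc 0) b))"
    using SAll.prems qs has_types_tapp [OF ps(3), of u]
    by (intro SAll.IH [of "\<sigma> # \<Gamma>0"] sub_typed_up has_types_shifts_Suc) auto
  ultimately show ?case
    using SAll.prems(1) bneg_wtypes [OF Bnd_rsymsI] stypes_ttypes wtypes_ttypes ps qs
      is_fm_bound [OF _ qs(3) refl]
    by (simp add: Let_def is_fm_ball)
next
  case (SEx \<sigma> A)
  let ?vs = "bneg I (Bnd \<sigma>)" and ?us = "bpos I (Bnd \<sigma>)" and ?m = "length (neg I A)"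
  obtain u a where ps: "ps = u @ a" "length u = length ?us"
    "has_types T \<Gamma> u ?us" "has_types T \<Gamma> a (pos I A)"
    using SEx.prems(3) by (auto simp: list_all2_append2)
  obtain V B where qs: "qs = V @ B" "length V = length ?vs"
    "has_types T \<Gamma> V (map FinSet ?vs)" "has_types T \<Gamma> B (map FinSet (neg I A))"
    using SEx.prems(4) by (auto simp: list_all2_append2)
  have "is_fm T (rev (neg I A) @ \<sigma> # \<Gamma>)
      (interp I (\<lambda>i \<tau>. shift ?m (up r i \<tau>)) A (shifts (Suc ?m) a) (bvars (neg I A)))"
    using SEx.prems has_types_shifts [OF ps(4), of "Suc ?m" "rev (neg I A) @ [\<sigma>]"]
    by (intro SEx.IH [of "\<sigma> # \<Gamma>0"] sub_typed_comp_shift sub_typed_up has_types_bvars) auto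
  then show ?case
    using SEx.prems(1) bneg_wtypes [OF Bnd_rsymsI] neg_wtypes [of "\<sigma> # \<Gamma>0" A] stypes_ttypes wtypes_ttypes
      ps qs is_fm_bound [OF _ ps(3) refl] has_types_shifts_Suc [OF qs(3)] has_types_shifts_Suc [OF qs(4)]
    by (simp add: Let_def is_fm_ball)
qed simp

section \<open>Typing of joins and their behaviour under substitution\<close>

lemma has_types_J:
  "R \<in> rsymsI L \<Longrightarrow> has_types T [] (J R) (map (\<lambda>\<tau>. (bpos I R @ bpos I R) \<Rrightarrow>\<^sub>t \<tau>) (bpos I R))"
  using joining by (simp add: joining_of_bounds_def)

lemma map_tsub_J [simp]: "R \<in> rsymsI L \<Longrightarrow> map (tsub s) (J R) = J R"
  using has_types_J [of R] tsub_cong [of T "[]" _ _ s Var]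
  by (intro map_idI) (fastforce simp: list_all2_conv_all_nth in_set_conv_nth)

lemma abstractable_J:
  assumes R: "R \<in> rsymsI L"
    and "list_all2 (abstractable T \<Delta> \<Gamma>) a (bpos I R)" "list_all2 (abstractable T \<Delta> \<Gamma>) b (bpos I R)"
  shows "list_all2 (abstractable T \<Delta> \<Gamma>) (J R \<bullet> (a @ b)) (bpos I R)"
proof -
  have "list_all2 (abstractable T \<Delta> \<Gamma>) (J R) (map (\<lambda>\<tau>. (bpos I R @ bpos I R) \<Rrightarrow>\<^sub>t \<tau>) (bpos I R))"
  proof (rule list_all2_all_nthI)
    show len: "length (J R) = length (map (\<lambda>\<tau>. (bpos I R @ bpos I R) \<Rrightarrow>\<^sub>t \<tau>) (bpos I R))"
      using has_types_J [OF R] by (rule list_all2_lengthD)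
    fix i
    assume i: "i < length (J R)"
    then have ty: "has_type T [] (J R ! i) ((bpos I R @ bpos I R) \<Rrightarrow>\<^sub>t (bpos I R ! i))"
      using has_types_J [OF R] by (auto simp: list_all2_conv_all_nth)
    have closed: "tsub s (J R ! i) = J R ! i" for s
      using tsub_cong [OF ty, of s Var] by simp
    have "has_type T \<Gamma> (J R ! i) ((bpos I R @ bpos I R) \<Rrightarrow>\<^sub>t (bpos I R ! i))"
      using has_type_tsub [OF ty, of \<Gamma> Var] by (simp add: sub_typed_def)
    moreover have "((bpos I R @ bpos I R) \<Rrightarrow>\<^sub>t (bpos I R ! i)) \<in> wtypes T"
      using bpos_wtypes [OF R] i len by (auto simp: wtypes_funs)
    ultimately show "abstractable T \<Delta> \<Gamma> (J R ! i) (map (\<lambda>\<tau>. (bpos I R @ bpos I R) \<Rrightarrow>\<^sub>t \<tau>) (bpos I R) ! i)"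
      using i len closed by (auto intro: abstractable_closed)
  qed
  from abstractable_tapp [OF this list_all2_appendI [OF assms(2,3)]] show ?thesis
    by simp
qed

text \<open>Mere typing would not pass the induction: joins of parts stand below
  \<open>lams\<close>, so they must be abstractable over a segment \<open>\<Delta>\<close> that
  grows on the way down. The empty segment gives typing.\<close>

lemma abstractable_join:
  "is_sfm L \<Gamma>0 A \<Longrightarrow> list_all2 (abstractable T \<Delta> \<Gamma>) a (pos I A) \<Longrightarrow>
    list_all2 (abstractable T \<Delta> \<Gamma>) b (pos I A) \<Longrightarrow> list_all2 (abstractable T \<Delta> \<Gamma>) (join I J A a b) (pos I A)"
proof (induction A arbitrary: \<Gamma>0 \<Delta> a b)
  case (SRel R ts)
  then show ?case by (simp add: abstractable_J rsyms_rsymsI)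
next
  case (SAnd A B)
  obtain c d where a: "a = c @ d" "length c = length (pos I A)"
    "list_all2 (abstractable T \<Delta> \<Gamma>) c (pos I A)" "list_all2 (abstractable T \<Delta> \<Gamma>) d (pos I B)"
    using SAnd.prems(2) by (auto simp: list_all2_append2)
  obtain c' d' where b: "b = c' @ d'" "length c' = length (pos I A)"
    "list_all2 (abstractable T \<Delta> \<Gamma>) c' (pos I A)" "list_all2 (abstractable T \<Delta> \<Gamma>) d' (pos I B)"
    using SAnd.prems(3) by (auto simp: list_all2_append2)
  show ?case
    using SAnd.IH(1) [of \<Gamma>0, OF _ a(3) b(3)] SAnd.IH(2) [of \<Gamma>0, OF _ a(4) b(4)] SAnd.prems(1) a b
    by (simp add: list_all2_appendI)
next
  case (SImp A B)
  have w: "set (pos I A) \<subseteq> wtypes T" "set (neg I B) \<subseteq> wtypes T"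
    using SImp.prems pos_wtypes [of \<Gamma>0 A] neg_wtypes [of \<Gamma>0 B] by auto
  let ?F = "map (\<lambda>\<tau>. pos I A \<Rrightarrow>\<^sub>t \<tau>) (pos I B)"
    and ?G = "map (\<lambda>\<rho>. (pos I A @ neg I B) \<Rrightarrow>\<^sub>t FinSet \<rho>) (neg I A)"
  let ?app = "\<lambda>f. shifts (length (pos I A)) f \<bullet> bvars (pos I A)"
  obtain f g where a: "a = f @ g" "length f = length (pos I B)"
    "list_all2 (abstractable T \<Delta> \<Gamma>) f ?F" "list_all2 (abstractable T \<Delta> \<Gamma>) g ?G"
    using SImp.prems(2) by (auto simp: list_all2_append2)
  obtain f' g' where b: "b = f' @ g'" "length f' = length (pos I B)"
    "list_all2 (abstractable T \<Delta> \<Gamma>) f' ?F" "list_all2 (abstractable T \<Delta> \<Gamma>) g' ?G"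
    using SImp.prems(3) by (auto simp: list_all2_append2)
  have "list_all2 (abstractable T (rev (pos I A) @ \<Delta>) \<Gamma>) (?app x) (pos I B)"
    if "list_all2 (abstractable T \<Delta> \<Gamma>) x ?F" for x
    using abstractable_tapp [OF abstractable_shifts [OF that] abstractable_bvars [OF w(1)]] by simp
  then have "list_all2 (abstractable T (rev (pos I A) @ \<Delta>) \<Gamma>) (join I J B (?app f) (?app f')) (pos I B)"
    using SImp.prems a b by (intro SImp.IH(2) [of \<Gamma>0]) auto
  then have "list_all2 (abstractable T \<Delta> \<Gamma>) (map (lams (pos I A)) (join I J B (?app f) (?app f'))) ?F"
    by (auto simp: list_all2_conv_all_nth intro!: abstractable_lams w)
  moreover have "list_all2 (abstractable T \<Delta> \<Gamma>) (pointwise_un (pos I A @ neg I B) (neg I A) g g') ?G"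
    using a b w by (intro abstractable_pointwise_un) auto
  ultimately show ?case
    using a b by (simp add: Let_def list_all2_appendI)
next
  case (SAll \<sigma> A)
  let ?us = "bpos I (Bnd \<sigma>)"
  have w: "set ?us \<subseteq> wtypes T" "set (neg I A) \<subseteq> wtypes T"
    using SAll.prems bpos_wtypes [OF Bnd_rsymsI] neg_wtypes [of "\<sigma> # \<Gamma>0" A] by auto
  let ?F = "map (\<lambda>\<tau>. ?us \<Rrightarrow>\<^sub>t \<tau>) (pos I A)"
    and ?G = "map (\<lambda>\<rho>. (?us @ neg I A) \<Rrightarrow>\<^sub>t FinSet \<rho>) (bneg I (Bnd \<sigma>))"
  let ?app = "\<lambda>f. shifts (length ?us) f \<bullet> bvars ?us"
  obtain f g where a: "a = f @ g" "length f = length (pos I A)"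
    "list_all2 (abstractable T \<Delta> \<Gamma>) f ?F" "list_all2 (abstractable T \<Delta> \<Gamma>) g ?G"
    using SAll.prems(2) by (auto simp: list_all2_append2)
  obtain f' g' where b: "b = f' @ g'" "length f' = length (pos I A)"
    "list_all2 (abstractable T \<Delta> \<Gamma>) f' ?F" "list_all2 (abstractable T \<Delta> \<Gamma>) g' ?G"
    using SAll.prems(3) by (auto simp: list_all2_append2)
  have "list_all2 (abstractable T (rev ?us @ \<Delta>) \<Gamma>) (?app x) (pos I A)"
    if "list_all2 (abstractable T \<Delta> \<Gamma>) x ?F" for x
    using abstractable_tapp [OF abstractable_shifts [OF that] abstractable_bvars [OF w(1)]] by simp
  then have "list_all2 (abstractable T (rev ?us @ \<Delta>) \<Gamma>) (join I J A (?app f) (?app f')) (pos I A)"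
    using SAll.prems a b by (intro SAll.IH [of "\<sigma> # \<Gamma>0"]) auto
  then have "list_all2 (abstractable T \<Delta> \<Gamma>) (map (lams ?us) (join I J A (?app f) (?app f'))) ?F"
    by (auto simp: list_all2_conv_all_nth intro!: abstractable_lams w)
  moreover have "list_all2 (abstractable T \<Delta> \<Gamma>) (pointwise_un (?us @ neg I A) (bneg I (Bnd \<sigma>)) g g') ?G"
    using a b w by (intro abstractable_pointwise_un) auto
  ultimately show ?case
    using a b by (simp add: Let_def list_all2_appendI)
next
  case (SEx \<sigma> A)
  let ?us = "bpos I (Bnd \<sigma>)"
  obtain c d where a: "a = c @ d" "length c = length ?us"
    "list_all2 (abstractable T \<Delta> \<Gamma>) c ?us" "list_all2 (abstractable T \<Delta> \<Gamma>) d (pos I A)"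
    using SEx.prems(2) by (auto simp: list_all2_append2)
  obtain c' d' where b: "b = c' @ d'" "length c' = length ?us"
    "list_all2 (abstractable T \<Delta> \<Gamma>) c' ?us" "list_all2 (abstractable T \<Delta> \<Gamma>) d' (pos I A)"
    using SEx.prems(3) by (auto simp: list_all2_append2)
  show ?case
    using SEx.IH [of "\<sigma> # \<Gamma>0", OF _ a(4) b(4)] abstractable_J [OF _ a(3) b(3)] SEx.prems(1) a b
    by (simp add: list_all2_appendI Bnd_rsymsI)
qed simp

lemma has_types_join:
  "is_sfm L \<Gamma>0 A \<Longrightarrow> has_types T \<Gamma> a (pos I A) \<Longrightarrow> has_types T \<Gamma> b (pos I A) \<Longrightarrow>
    has_types T \<Gamma> (join I J A a b) (pos I A)"
  using abstractable_join [of \<Gamma>0 A "[]" \<Gamma> a b] by (simp add: abstractable_Nil_list pos_wtypes)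

lemma abstractable_join_body:
  assumes "is_sfm L \<Gamma>0 A" "set \<tau>s \<subseteq> wtypes T"
    and "has_types T \<Gamma> f (map (\<lambda>\<tau>. \<tau>s \<Rrightarrow>\<^sub>t \<tau>) (pos I A))" "has_types T \<Gamma> f' (map (\<lambda>\<tau>. \<tau>s \<Rrightarrow>\<^sub>t \<tau>) (pos I A))"
    and "n = length \<tau>s"
  shows "list_all2 (abstractable T (rev \<tau>s) \<Gamma>)
    (join I J A (shifts n f \<bullet> bvars \<tau>s) (shifts n f' \<bullet> bvars \<tau>s)) (pos I A)"
proof -
  have "list_all2 (abstractable T (rev \<tau>s) \<Gamma>) (shifts n x \<bullet> bvars \<tau>s) (pos I A)"
    if "has_types T \<Gamma> x (map (\<lambda>\<tau>. \<tau>s \<Rrightarrow>\<^sub>t \<tau>) (pos I A))" for x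
  proof -
    have "list_all2 (abstractable T [] \<Gamma>) x (map (\<lambda>\<tau>. \<tau>s \<Rrightarrow>\<^sub>t \<tau>) (pos I A))"
      using that pos_wtypes [OF assms(1)] assms(2)
      by (subst abstractable_Nil_list) (auto simp: wtypes_funs)
    from abstractable_tapp [OF abstractable_shifts [OF this] abstractable_bvars [OF assms(2)]]
    show ?thesis using assms(5) by simp
  qed
  then show ?thesis
    using assms by (blast intro: abstractable_join)
qed

text \<open>The step common to implication and universal quantification. The premise
  \<open>IH\<close> ranges over all contexts since it is used below the abstractions, for the lifted
  substitution. Once \<open>map_tsub_join\<close> is proved, it can serve as \<open>IH\<close>
  itself.\<close>

lemma map_tsub_lams_join:
  assumes sfm: "is_sfm L \<Gamma>0 A" and w: "set \<tau>s \<subseteq> wtypes T"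
    and f: "has_types T \<Gamma> f (map (\<lambda>\<tau>. \<tau>s \<Rrightarrow>\<^sub>t \<tau>) (pos I A))" "has_types T \<Gamma> f' (map (\<lambda>\<tau>. \<tau>s \<Rrightarrow>\<^sub>t \<tau>) (pos I A))"
    and n: "n = length \<tau>s" and s: "sub_typed T \<Gamma> \<Delta> s"
    and IH: "\<And>\<Gamma> \<Delta> s a b. has_types T \<Gamma> a (pos I A) \<Longrightarrow> has_types T \<Gamma> b (pos I A) \<Longrightarrow> sub_typed T \<Gamma> \<Delta> s \<Longrightarrow>
      map (tsub s) (join I J A a b) = join I J A (map (tsub s) a) (map (tsub s) b)"
  shows "map (tsub s) (map (lams \<tau>s) (join I J A (shifts n f \<bullet> bvars \<tau>s) (shifts n f' \<bullet> bvars \<tau>s))) =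
    map (lams \<tau>s) (join I J A (shifts n (map (tsub s) f) \<bullet> bvars \<tau>s) (shifts n (map (tsub s) f') \<bullet> bvars \<tau>s))"
proof -
  let ?app = "\<lambda>f. shifts n f \<bullet> bvars \<tau>s"
  have body: "list_all2 (abstractable T (rev \<tau>s) \<Gamma>) (join I J A (?app f) (?app f')) (pos I A)"
    by (rule abstractable_join_body [OF sfm w f n])
  have "map (tsub s) (map (lams \<tau>s) (join I J A (?app f) (?app f'))) =
      map (lams \<tau>s) (map (tsub (upn n s)) (join I J A (?app f) (?app f')))"
  proof -
    have "tsub s (lams \<tau>s t) = lams \<tau>s (tsub (upn n s) t)"
      if "t \<in> set (join I J A (?app f) (?app f'))" for t
    proof -
      obtain \<tau> where "abstractable T (rev \<tau>s) \<Gamma> t \<tau>"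
        using body \<open>t \<in> _\<close> by (auto simp: list_all2_conv_all_nth in_set_conv_nth)
      then show ?thesis
        using tsub_lams [of T \<tau>s "[]" \<Gamma> t \<tau> \<Delta> s] w s by (simp add: n)
    qed
    then show ?thesis by simp
  qed
  also have "map (tsub (upn n s)) (join I J A (?app f) (?app f')) =
      join I J A (map (tsub (upn n s)) (?app f)) (map (tsub (upn n s)) (?app f'))"
  proof (rule IH)
    show "has_types T (rev \<tau>s @ \<Gamma>) (?app f) (pos I A)" "has_types T (rev \<tau>s @ \<Gamma>) (?app f') (pos I A)"
      using has_types_tapp [OF has_types_shifts [OF f(1), of n "rev \<tau>s"] has_types_bvars]
        has_types_tapp [OF has_types_shifts [OF f(2), of n "rev \<tau>s"] has_types_bvars]
      by (simp_all add: n)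
    show "sub_typed T (rev \<tau>s @ \<Gamma>) (rev \<tau>s @ \<Delta>) (upn n s)"
      by (rule sub_typed_upn [OF s]) (simp add: n)
  qed
  finally show ?thesis
    by (simp add: n o_def)
qed

text \<open>With \<open>msub xs\<close> this computes values of abstracted joins; with shifts it
  moves joins below the quantifiers of the interpretation.\<close>

lemma map_tsub_join:
  "is_sfm L \<Gamma>0 A \<Longrightarrow> has_types T \<Gamma> a (pos I A) \<Longrightarrow> has_types T \<Gamma> b (pos I A) \<Longrightarrow> sub_typed T \<Gamma> \<Delta> s \<Longrightarrow>
    map (tsub s) (join I J A a b) = join I J A (map (tsub s) a) (map (tsub s) b)"
proof (induction A arbitrary: \<Gamma>0 \<Gamma> \<Delta> s a b)
  case (SRel R ts)
  then show ?case by (simp add: rsyms_rsymsI)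
next
  case (SAnd A B)
  obtain c d where a: "a = c @ d" "length c = length (pos I A)" "has_types T \<Gamma> c (pos I A)"
    "has_types T \<Gamma> d (pos I B)"
    using SAnd.prems by (auto simp: list_all2_append2)
  obtain c' d' where b: "b = c' @ d'" "length c' = length (pos I A)" "has_types T \<Gamma> c' (pos I A)"
    "has_types T \<Gamma> d' (pos I B)"
    using SAnd.prems by (auto simp: list_all2_append2)
  show ?case
    using SAnd.IH(1) [of \<Gamma>0, OF _ a(3) b(3)] SAnd.IH(2) [of \<Gamma>0, OF _ a(4) b(4)] SAnd.prems a b by simp
next
  case (SImp A B)
  have w: "set (pos I A) \<subseteq> wtypes T" "set (neg I B) \<subseteq> wtypes T" "set (neg I A) \<subseteq> wtypes T"
    using SImp.prems pos_wtypes [of \<Gamma>0 A] neg_wtypes [of \<Gamma>0 B] neg_wtypes [of \<Gamma>0 A] by auto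
  let ?F = "map (\<lambda>\<tau>. pos I A \<Rrightarrow>\<^sub>t \<tau>) (pos I B)"
    and ?G = "map (\<lambda>\<rho>. (pos I A @ neg I B) \<Rrightarrow>\<^sub>t FinSet \<rho>) (neg I A)"
  obtain f g where a: "a = f @ g" "length f = length (pos I B)" "has_types T \<Gamma> f ?F" "has_types T \<Gamma> g ?G"
    using SImp.prems(2) by (auto simp: list_all2_append2)
  obtain f' g' where b: "b = f' @ g'" "length f' = length (pos I B)" "has_types T \<Gamma> f' ?F"
    "has_types T \<Gamma> g' ?G"
    using SImp.prems(3) by (auto simp: list_all2_append2)
  have B: "is_sfm L \<Gamma>0 B"
    using SImp.prems by simp
  have "set (pos I A @ neg I B) \<subseteq> wtypes T"
    using w by simp
  from map_tsub_lams_join [OF B w(1) a(3) b(3) refl SImp.prems(4) SImp.IH(2) [OF B]]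
    map_tsub_pointwise_un [OF a(4) b(4) this w(3) SImp.prems(4)]
  show ?case
    using a b by (simp add: Let_def del: map_map)
next
  case (SAll \<sigma> A)
  let ?us = "bpos I (Bnd \<sigma>)"
  have w: "set ?us \<subseteq> wtypes T" "set (neg I A) \<subseteq> wtypes T" "set (bneg I (Bnd \<sigma>)) \<subseteq> wtypes T"
    using SAll.prems bpos_wtypes [OF Bnd_rsymsI] bneg_wtypes [OF Bnd_rsymsI] neg_wtypes [of "\<sigma> # \<Gamma>0" A] by auto
  let ?F = "map (\<lambda>\<tau>. ?us \<Rrightarrow>\<^sub>t \<tau>) (pos I A)"
    and ?G = "map (\<lambda>\<rho>. (?us @ neg I A) \<Rrightarrow>\<^sub>t FinSet \<rho>) (bneg I (Bnd \<sigma>))"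
  obtain f g where a: "a = f @ g" "length f = length (pos I A)" "has_types T \<Gamma> f ?F" "has_types T \<Gamma> g ?G"
    using SAll.prems(2) by (auto simp: list_all2_append2)
  obtain f' g' where b: "b = f' @ g'" "length f' = length (pos I A)" "has_types T \<Gamma> f' ?F"
    "has_types T \<Gamma> g' ?G"
    using SAll.prems(3) by (auto simp: list_all2_append2)
  have A: "is_sfm L (\<sigma> # \<Gamma>0) A"
    using SAll.prems by simp
  have "set (?us @ neg I A) \<subseteq> wtypes T"
    using w by simp
  from map_tsub_lams_join [OF A w(1) a(3) b(3) refl SAll.prems(4) SAll.IH [OF A]]
    map_tsub_pointwise_un [OF a(4) b(4) this w(3) SAll.prems(4)]
  show ?case
    using a b by (simp add: Let_def del: map_map)
next
  case (SEx \<sigma> A)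
  let ?us = "bpos I (Bnd \<sigma>)"
  obtain c d where a: "a = c @ d" "length c = length ?us" "has_types T \<Gamma> d (pos I A)"
    using SEx.prems by (auto simp: list_all2_append2)
  obtain c' d' where b: "b = c' @ d'" "length c' = length ?us" "has_types T \<Gamma> d' (pos I A)"
    using SEx.prems by (auto simp: list_all2_append2)
  show ?case
    using SEx.IH [of "\<sigma> # \<Gamma>0", OF _ a(3) b(3)] SEx.prems a b by (simp add: Bnd_rsymsI)
qed simp

end

section \<open>Bounded quantifiers\<close>

definition fsubset :: "'g ty \<Rightarrow> ('g, 'k) tm \<Rightarrow> ('g, 'k) tm \<Rightarrow> ('g, 'k, 'p) fm" where
  "fsubset \<rho> B C = FAll \<rho> (FImp (FMem (Var 0 \<rho>) (shift 1 B)) (FMem (Var 0 \<rho>) (shift 1 C)))"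

lemma fshift_fsubset: "fshift (fsubset \<rho> B C) = fsubset \<rho> (shift 1 B) (shift 1 C)"
  by (simp add: fshift_def fsubset_def) (simp add: shift_def tsub_tsub)

text \<open>Shifting below a binder and then instantiating by the new variable cancel.
  Well-formedness enters because \<open>single (Var 0 \<tau>)\<close> overwrites the annotation at
  index 0.\<close>

lemma fsub_single_fshift_body:
  assumes "is_fm T (\<tau> # \<Gamma>) \<phi>"
  shows "fsub (single (Var 0 \<tau>)) (fsub (up (\<lambda>i. Var (Suc i))) \<phi>) = \<phi>"
proof -
  have "fsub (single (Var 0 \<tau>)) (fsub (up (\<lambda>i. Var (Suc i))) \<phi>) = fsub Var \<phi>"
    unfolding fsub_fsub
  proof (rule fsub_cong [OF assms])
    fix i
    show "tsub (single (Var 0 \<tau>)) (up (\<lambda>i. Var (Suc i)) i ((\<tau> # \<Gamma>) ! i)) = Var i ((\<tau> # \<Gamma>) ! i)"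
      by (cases i) auto
  qed
  then show ?thesis by simp
qed

context target_calculus
begin

text \<open>The converse of \<open>allI\<close>: the shifted quantifier is instantiated by the
  variable just introduced.\<close>

lemma deriv_all_body:
  assumes "deriv T \<Gamma> H (FAll \<tau> \<phi>)" "is_fm T (\<tau> # \<Gamma>) \<phi>"
  shows "deriv T (\<tau> # \<Gamma>) (fshift ` H) \<phi>"
proof -
  have "deriv T (\<tau> # \<Gamma>) (fshift ` H) (FAll \<tau> (fsub (up (\<lambda>i. Var (Suc i))) \<phi>))"
    using deriv_fshift [OF assms(1), of \<tau>] by (simp add: fshift_def)
  from deriv.allE [OF this has_type_Var0] show ?thesis
    by (simp add: fsub_single_fshift_body [OF assms(2)])
qed

text \<open>The variable that \<open>exE\<close> introduces is itself the witness offered to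
  \<open>exI\<close>.\<close>

lemma deriv_ex_mono:
  assumes "deriv T (\<tau> # \<Gamma>) {\<phi>} \<psi>" "is_fm T (\<tau> # \<Gamma>) \<phi>" "is_fm T (\<tau> # \<Gamma>) \<psi>" "\<tau> \<in> ttypes T"
  shows "deriv T \<Gamma> {FEx \<tau> \<phi>} (FEx \<tau> \<psi>)"
proof (rule deriv.exE)
  show "deriv T \<Gamma> {FEx \<tau> \<phi>} (FEx \<tau> \<phi>)"
    using assms by (auto intro: deriv.hyp)
  have "deriv T (\<tau> # \<Gamma>) (insert \<phi> (fshift ` {FEx \<tau> \<phi>}))
      (fsub (single (Var 0 \<tau>)) (fsub (up (\<lambda>i. Var (Suc i))) \<psi>))"
    unfolding fsub_single_fshift_body [OF assms(3)] by (rule deriv_weaken [OF assms(1)]) simp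
  then have "deriv T (\<tau> # \<Gamma>) (insert \<phi> (fshift ` {FEx \<tau> \<phi>})) (FEx \<tau> (fsub (up (\<lambda>i. Var (Suc i))) \<psi>))"
    using is_fm_fshift [of T \<Gamma> "FEx \<tau> \<psi>" \<tau>] assms(3,4)
    by (intro deriv.exI [OF _ has_type_Var0]) (auto simp: fshift_def)
  then show "deriv T (\<tau> # \<Gamma>) (insert \<phi> (fshift ` {FEx \<tau> \<phi>})) (fshift (FEx \<tau> \<psi>))"
    by (simp add: fshift_def)
  show "is_fm T \<Gamma> (FEx \<tau> \<psi>)"
    using assms by simp
qed

lemma fsubset_refl:
  assumes "\<rho> \<in> wtypes T" "has_type T \<Gamma> B (FinSet \<rho>)"
  shows "deriv T \<Gamma> H (fsubset \<rho> B B)"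
proof -
  have "is_fm T (\<rho> # \<Gamma>) (FMem (Var 0 \<rho>) (shift 1 B))"
    using assms has_type_shift_Suc [OF assms(2)] by (intro is_fm_mem) auto
  then show ?thesis
    unfolding fsubset_def using assms wtypes_ttypes by (blast intro: deriv.allI deriv.impI deriv.hyp)
qed

text \<open>\<open>D\<close> is only provably equal to the union because in the application it is
  the value of a combinatory abstraction. The equation is derived without hypotheses, so it can be
  shifted below the quantifier of \<open>fsubset\<close> and weakened there.\<close>

lemma fsubset_Cup:
  assumes \<rho>: "\<rho> \<in> wtypes T" and B: "has_type T \<Gamma> B (FinSet \<rho>)" and C: "has_type T \<Gamma> C (FinSet \<rho>)"
    and D: "has_type T \<Gamma> D (FinSet \<rho>)" and eq: "deriv T \<Gamma> {} (FEq D (Cup \<rho> \<cdot> B \<cdot> C))"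
  shows "deriv T \<Gamma> H (fsubset \<rho> B D)"
proof -
  let ?x = "Var 0 \<rho> :: ('g, 'k) tm" and ?B = "shift 1 B" and ?C = "shift 1 C" and ?D = "shift 1 D"
  let ?H = "insert (FMem ?x ?B) (fshift ` H)"
  have ty: "has_type T (\<rho> # \<Gamma>) ?B (FinSet \<rho>)" "has_type T (\<rho> # \<Gamma>) ?C (FinSet \<rho>)"
    "has_type T (\<rho> # \<Gamma>) ?D (FinSet \<rho>)"
    using B C D by (auto intro: has_type_shift_Suc)
  have fm: "is_fm T (\<rho> # \<Gamma>) (FMem ?x ?B)" "is_fm T (\<rho> # \<Gamma>) (FMem ?x ?C)"
    using \<rho> ty by (auto intro!: is_fm_mem simp del: is_fm.simps)
  have "deriv T (\<rho> # \<Gamma>) ?H (FOr (FMem ?x ?B) (FMem ?x ?C))"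
    by (rule deriv.orI1 [OF deriv.hyp [OF insertI1 fm(1)] fm(2)])
  from deriv.impE [OF deriv.andE2 [OF mem_Cup [OF \<rho> has_type_Var0 ty(1,2)]] this]
  have 1: "deriv T (\<rho> # \<Gamma>) ?H (FMem ?x (Cup \<rho> \<cdot> ?B \<cdot> ?C))" .
  have "deriv T (\<rho> # \<Gamma>) ?H (FEq ?D (Cup \<rho> \<cdot> ?B \<cdot> ?C))"
    using deriv_weaken [OF deriv_fshift [OF eq]] by simp
  from eq_sym [OF this ty(3) has_type_Cup [OF \<rho> ty(1,2)]]
  have 2: "deriv T (\<rho> # \<Gamma>) ?H (FEq (Cup \<rho> \<cdot> ?B \<cdot> ?C) ?D)" .
  have "deriv T (\<rho> # \<Gamma>) ?H (FMem ?x ?D)"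
    by (rule mem_subset_eq [OF 2 has_type_Cup [OF \<rho> ty(1,2)] ty(3) 1 has_type_Var0 \<rho>])
  then show ?thesis
    unfolding fsubset_def using fm(1) \<rho> wtypes_ttypes by (blast intro: deriv.allI deriv.impI)
qed

text \<open>Bounded quantification is antitone in the bounds and monotone in the body. Implication
  and universal quantification use it with a fixed body and growing bounds, existential
  quantification with fixed bounds and a weakened body.\<close>

lemma ball_mono:
  "deriv T \<Gamma> H (ball \<rho>s Cs \<phi>) \<Longrightarrow> is_fm T (rev \<rho>s @ \<Gamma>) \<phi> \<Longrightarrow> deriv T (rev \<rho>s @ \<Gamma>) {\<phi>} \<psi> \<Longrightarrow>
    set \<rho>s \<subseteq> wtypes T \<Longrightarrow> has_types T \<Gamma> Bs (map FinSet \<rho>s) \<Longrightarrow> has_types T \<Gamma> Cs (map FinSet \<rho>s) \<Longrightarrow>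
    (\<And>j. j < length \<rho>s \<Longrightarrow> deriv T \<Gamma> H (fsubset (\<rho>s ! j) (Bs ! j) (Cs ! j))) \<Longrightarrow>
    deriv T \<Gamma> H (ball \<rho>s Bs \<psi>)"
proof (induction \<rho>s arbitrary: \<Gamma> H Bs Cs)
  case Nil
  then show ?case by (auto intro: deriv_cut)
next
  case (Cons \<rho> \<rho>s)
  obtain B Bs' where B: "Bs = B # Bs'" "has_type T \<Gamma> B (FinSet \<rho>)" "has_types T \<Gamma> Bs' (map FinSet \<rho>s)"
    using Cons.prems(5) by (auto simp: list_all2_Cons2)
  obtain C Cs' where C: "Cs = C # Cs'" "has_type T \<Gamma> C (FinSet \<rho>)" "has_types T \<Gamma> Cs' (map FinSet \<rho>s)"
    using Cons.prems(6) by (auto simp: list_all2_Cons2)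
  have \<rho>: "\<rho> \<in> wtypes T" "set \<rho>s \<subseteq> wtypes T"
    using Cons.prems(4) by auto
  let ?B = "FMem (Var 0 \<rho>) (shift 1 B)" and ?C = "FMem (Var 0 \<rho>) (shift 1 C)"
  let ?H = "insert ?B (fshift ` H)"
  have fm: "is_fm T (\<rho> # \<Gamma>) ?B" "is_fm T (\<rho> # \<Gamma>) ?C"
    using \<rho> has_type_shift_Suc [OF B(2)] has_type_shift_Suc [OF C(2)]
    by (auto intro!: is_fm_mem simp del: is_fm.simps)
  have fmC: "is_fm T (\<rho> # \<Gamma>) (ball \<rho>s (shifts 1 Cs') \<phi>)"
    using wtypes_ttypes \<rho>(2) has_types_shifts_Suc [OF C(3)] Cons.prems(2) by (auto intro: is_fm_ball)
  have "deriv T \<Gamma> H (FAll \<rho> (FImp ?C (ball \<rho>s (shifts 1 Cs') \<phi>)))"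
    using Cons.prems(1) by (simp add: C(1))
  from deriv_weaken [OF deriv_all_body [OF this]] fm fmC
  have impC: "deriv T (\<rho> # \<Gamma>) ?H (FImp ?C (ball \<rho>s (shifts 1 Cs') \<phi>))"
    by (simp add: subset_insertI)
  have "deriv T \<Gamma> H (FAll \<rho> (FImp ?B ?C))"
    using Cons.prems(7) [of 0] by (simp add: B(1) C(1) fsubset_def)
  from deriv_weaken [OF deriv_all_body [OF this]] fm
  have "deriv T (\<rho> # \<Gamma>) ?H (FImp ?B ?C)"
    by (simp add: subset_insertI)
  from deriv.impE [OF this deriv.hyp [OF insertI1 fm(1)]]
  have "deriv T (\<rho> # \<Gamma>) ?H ?C" .
  from deriv.impE [OF impC this]
  have ballC: "deriv T (\<rho> # \<Gamma>) ?H (ball \<rho>s (shifts 1 Cs') \<phi>)" .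
  have "deriv T (\<rho> # \<Gamma>) ?H (ball \<rho>s (shifts 1 Bs') \<psi>)"
  proof (rule Cons.IH [OF ballC _ _ \<rho>(2)])
    fix j
    assume j: "j < length \<rho>s"
    then have "deriv T \<Gamma> H (fsubset (\<rho>s ! j) (Bs' ! j) (Cs' ! j))"
      using Cons.prems(7) [of "Suc j"] by (simp add: B(1) C(1))
    from deriv_weaken [OF deriv_fshift [OF this, of \<rho>]]
    show "deriv T (\<rho> # \<Gamma>) ?H (fsubset (\<rho>s ! j) (shifts 1 Bs' ! j) (shifts 1 Cs' ! j))"
      using j list_all2_lengthD [OF B(3)] list_all2_lengthD [OF C(3)]
      by (simp add: fshift_fsubset subset_insertI)
  qed (use Cons.prems B C has_types_shifts_Suc in auto)
  then have "deriv T \<Gamma> H (FAll \<rho> (FImp ?B (ball \<rho>s (shifts 1 Bs') \<psi>)))"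
    using fm(1) \<rho> wtypes_ttypes by (blast intro: deriv.allI deriv.impI)
  then show ?case
    by (simp add: B(1))
qed

section \<open>Values, inclusions and commutativity of pointwise unions\<close>

lemma pointwise_un_beta:
  assumes g: "has_types T \<Gamma> gs (map (\<lambda>\<rho>. \<tau>s \<Rrightarrow>\<^sub>t FinSet \<rho>) \<rho>s)"
    and h: "has_types T \<Gamma> hs (map (\<lambda>\<rho>. \<tau>s \<Rrightarrow>\<^sub>t FinSet \<rho>) \<rho>s)"
    and w: "set \<tau>s \<subseteq> wtypes T" "set \<rho>s \<subseteq> wtypes T" and x: "has_types T \<Gamma> xs \<tau>s" and j: "j < length \<rho>s"
  shows "deriv T \<Gamma> H (FEq ((pointwise_un \<tau>s \<rho>s gs hs \<bullet> xs) ! j)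
    (Cup (\<rho>s ! j) \<cdot> apps (gs ! j) xs \<cdot> apps (hs ! j) xs))"
proof -
  have len: "length gs = length \<rho>s" "length hs = length \<rho>s" "length xs = length \<tau>s"
    using g h x by (auto dest: list_all2_lengthD)
  let ?t = "Cup (\<rho>s ! j) \<cdot> apps (shift (length \<tau>s) (gs ! j)) (bvars \<tau>s) \<cdot>
      apps (shift (length \<tau>s) (hs ! j)) (bvars \<tau>s)"
  have t: "abstractable T (rev \<tau>s @ []) \<Gamma> ?t (FinSet (\<rho>s ! j))"
    using g h j w
    by (intro abstractable_un) (auto simp: list_all2_conv_all_nth abstractable_Nil wtypes_funs wtypes_FinSet)
  from lams_beta [OF _ w(1) x, of ?t "FinSet (\<rho>s ! j)" H] t
  show ?thesis
    using j len by (simp add: tapp_def pointwise_un_nth)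
qed

lemma fsubset_pointwise_un:
  assumes g: "has_types T \<Gamma> gs (map (\<lambda>\<rho>. \<tau>s \<Rrightarrow>\<^sub>t FinSet \<rho>) \<rho>s)"
    and h: "has_types T \<Gamma> hs (map (\<lambda>\<rho>. \<tau>s \<Rrightarrow>\<^sub>t FinSet \<rho>) \<rho>s)"
    and w: "set \<tau>s \<subseteq> wtypes T" "set \<rho>s \<subseteq> wtypes T" and x: "has_types T \<Gamma> xs \<tau>s" and j: "j < length \<rho>s"
  shows "deriv T \<Gamma> H (fsubset (\<rho>s ! j) ((gs \<bullet> xs) ! j) ((pointwise_un \<tau>s \<rho>s gs hs \<bullet> xs) ! j))"
proof -
  let ?u = "pointwise_un \<tau>s \<rho>s gs hs"
  have "list_all2 (abstractable T [] \<Gamma>) ?u (map (\<lambda>\<rho>. \<tau>s \<Rrightarrow>\<^sub>t FinSet \<rho>) \<rho>s)"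
    using g h w by (intro abstractable_pointwise_un) (subst abstractable_Nil_list; auto simp: wtypes_funs wtypes_FinSet)+
  then have u: "has_types T \<Gamma> ?u (map (\<lambda>\<rho>. \<tau>s \<Rrightarrow>\<^sub>t FinSet \<rho>) \<rho>s)"
    using w by (subst (asm) abstractable_Nil_list) (auto simp: wtypes_funs wtypes_FinSet)
  have nth: "has_type T \<Gamma> ((ys \<bullet> xs) ! j) (FinSet (\<rho>s ! j))"
    if "has_types T \<Gamma> ys (map (\<lambda>\<rho>. \<tau>s \<Rrightarrow>\<^sub>t FinSet \<rho>) \<rho>s)" for ys
    using has_types_tapp [OF that x] j by (auto simp: list_all2_conv_all_nth)
  have "(gs \<bullet> xs) ! j = apps (gs ! j) xs" "(hs \<bullet> xs) ! j = apps (hs ! j) xs"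
    using j list_all2_lengthD [OF g] list_all2_lengthD [OF h] by (auto simp: tapp_def)
  moreover have "\<rho>s ! j \<in> wtypes T"
    using w(2) nth_mem [OF j] by blast
  ultimately show ?thesis
    using fsubset_Cup [OF _ nth [OF g] nth [OF h] nth [OF u], of H] pointwise_un_beta [OF g h w x j, of "{}"]
    by simp
qed

text \<open>Commutativity of the union holds for the bodies, with the abstracted variables free;
  \<open>lams_xi\<close> carries it to the abstractions.\<close>

lemma pointwise_un_commute:
  assumes g: "has_types T \<Gamma> gs (map (\<lambda>\<rho>. \<tau>s \<Rrightarrow>\<^sub>t FinSet \<rho>) \<rho>s)"
    and h: "has_types T \<Gamma> hs (map (\<lambda>\<rho>. \<tau>s \<Rrightarrow>\<^sub>t FinSet \<rho>) \<rho>s)"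
    and w: "set \<tau>s \<subseteq> wtypes T" "set \<rho>s \<subseteq> wtypes T"
  shows "proves_eq T \<Gamma> (pointwise_un \<tau>s \<rho>s gs hs) (pointwise_un \<tau>s \<rho>s hs gs)"
  unfolding proves_eq_def proves_def
proof (rule list_all2_all_nthI)
  have len: "length gs = length \<rho>s" "length hs = length \<rho>s"
    using g h by (auto dest: list_all2_lengthD)
  show "length (pointwise_un \<tau>s \<rho>s gs hs) = length (pointwise_un \<tau>s \<rho>s hs gs)"
    by (simp add: len)
  fix j
  assume "j < length (pointwise_un \<tau>s \<rho>s gs hs)"
  then have j: "j < length \<rho>s"
    by simp
  let ?n = "length \<tau>s"
  have un: "abstractable T (rev \<tau>s @ []) \<Gamma>
      (Cup (\<rho>s ! j) \<cdot> apps (shift ?n x) (bvars \<tau>s) \<cdot> apps (shift ?n y) (bvars \<tau>s)) (FinSet (\<rho>s ! j))"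
    and ty: "has_type T (rev \<tau>s @ \<Gamma>) (apps (shift ?n x) (bvars \<tau>s)) (FinSet (\<rho>s ! j))"
    if "has_type T \<Gamma> x (\<tau>s \<Rrightarrow>\<^sub>t FinSet (\<rho>s ! j))" "has_type T \<Gamma> y (\<tau>s \<Rrightarrow>\<^sub>t FinSet (\<rho>s ! j))" for x y
  proof -
    show "abstractable T (rev \<tau>s @ []) \<Gamma>
        (Cup (\<rho>s ! j) \<cdot> apps (shift ?n x) (bvars \<tau>s) \<cdot> apps (shift ?n y) (bvars \<tau>s)) (FinSet (\<rho>s ! j))"
      using that j w by (intro abstractable_un) (auto simp: abstractable_Nil wtypes_funs wtypes_FinSet)
    show "has_type T (rev \<tau>s @ \<Gamma>) (apps (shift ?n x) (bvars \<tau>s)) (FinSet (\<rho>s ! j))"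
      using that by (intro has_type_apps [OF has_type_shift has_types_bvars]) auto
  qed
  have gh: "has_type T \<Gamma> (gs ! j) (\<tau>s \<Rrightarrow>\<^sub>t FinSet (\<rho>s ! j))" "has_type T \<Gamma> (hs ! j) (\<tau>s \<Rrightarrow>\<^sub>t FinSet (\<rho>s ! j))"
    using g h j by (auto simp: list_all2_conv_all_nth)
  have "\<rho>s ! j \<in> wtypes T"
    using w(2) nth_mem [OF j] by blast
  then show "deriv T \<Gamma> {} (FEq (pointwise_un \<tau>s \<rho>s gs hs ! j) (pointwise_un \<tau>s \<rho>s hs gs ! j))"
    using lams_xi [of \<tau>s "[]" \<Gamma>, OF _ w(1) un [OF gh] un [OF gh(2,1)]]
      Cup_commute [OF _ ty [OF gh] ty [OF gh(2,1)], of "{}"] j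
    by (simp add: pointwise_un_nth len)
qed

end

section \<open>Monotonicity of the interpretation\<close>

lemma map_tsub_seg:
  assumes "length xs = k" "length ys = length \<tau>s"
  shows "map (tsub (\<lambda>i \<tau>. (xs @ ys @ zs) ! i)) (seg k \<tau>s) = ys"
  using assms by (auto simp: seg_def nth_append intro: nth_equalityI)

lemma length_seg [simp]: "length (seg k \<tau>s) = length \<tau>s"
  by (simp add: seg_def)

context joined_interpretation
begin

section \<open>Exchanging provably equal positive witnesses\<close>

text \<open>Leibniz' rule replaces one component at a time; \<open>ps\<close> collects the
  components already dealt with and grows from the left.\<close>

lemma interp_cong:
  assumes sfm: "is_sfm L \<Gamma>0 A" and r: "sub_typed T \<Gamma>0 \<Gamma> r" and qs: "has_types T \<Gamma> qs (neg I A)"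
  shows "list_all2 (\<lambda>t u. deriv T \<Gamma> H (FEq t u)) ts us \<Longrightarrow>
    has_types T \<Gamma> (ps @ ts) (pos I A) \<Longrightarrow> has_types T \<Gamma> (ps @ us) (pos I A) \<Longrightarrow>
    deriv T \<Gamma> H (interp I r A (ps @ ts) qs) \<Longrightarrow> deriv T \<Gamma> H (interp I r A (ps @ us) qs)"
proof (induction ts us arbitrary: ps rule: list_all2_induct)
  case (Cons t ts u us)
  define k where "k = length ps"
  define \<tau> where "\<tau> = pos I A ! k"
  obtain \<tau>s \<tau>s' where pos: "pos I A = \<tau>s @ \<tau> # \<tau>s'" and ps: "has_types T \<Gamma> ps \<tau>s"
    and t: "has_type T \<Gamma> t \<tau>" and ts: "has_types T \<Gamma> ts \<tau>s'"
    using Cons.prems(1) list_all2_lengthD unfolding \<tau>_def k_def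
    by (fastforce simp: list_all2_append1 list_all2_Cons1 nth_append)
  have u: "has_type T \<Gamma> u \<tau>"
    using Cons.prems(2) list_all2_lengthD [OF ps] by (simp add: pos list_all2_append)
  have len: "length ps + Suc (length ts) = length (pos I A)" "length qs = length (neg I A)"
    using Cons.prems(1) qs by (auto dest!: list_all2_lengthD)
  \<comment> \<open>The motive has a fresh variable at the position being replaced and everything
    else shifted; \<open>fsub_interp\<close> evaluates its instances.\<close>
  let ?ps = "shifts 1 ps @ Var 0 \<tau> # shifts 1 ts"
  let ?\<phi> = "interp I (\<lambda>i \<tau>. shift 1 (r i \<tau>)) A ?ps (shifts 1 qs)"
  have single: "fsub (single v) ?\<phi> = interp I r A (ps @ v # ts) qs" for v
    using len by (subst fsub_interp [OF sfm]) (auto simp: o_def)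
  have "has_types T (\<tau> # \<Gamma>) ?ps (pos I A)"
    using has_types_shifts_Suc [OF ps] has_types_shifts_Suc [OF ts] by (simp add: pos list_all2_appendI)
  then have "is_fm T (\<tau> # \<Gamma>) ?\<phi>"
    using sub_typed_comp_shift [OF r, of 1 "[\<tau>]"] has_types_shifts_Suc [OF qs]
    by (intro is_fm_interp [OF sfm]) auto
  from deriv_subst [OF Cons.hyps(1) t u this Cons.prems(3) single single]
  have "deriv T \<Gamma> H (interp I r A ((ps @ [u]) @ ts) qs)"
    by simp
  moreover have "has_types T \<Gamma> ((ps @ [u]) @ ts) (pos I A)"
    using ps u ts by (simp add: pos list_all2_appendI)
  ultimately show ?case
    using Cons.IH [of "ps @ [u]"] Cons.prems(2) by simp
qed simp

text \<open>Beta conversion turns the value of the abstraction into a substituted join, which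
  \<open>map_tsub_join\<close> identifies with the join of the values. The equations point towards
  the abstraction, as \<open>interp_cong\<close> will use them.\<close>

lemma join_lams_beta:
  assumes sfm: "is_sfm L \<Gamma>0 A" and w: "set \<tau>s \<subseteq> wtypes T"
    and f: "has_types T \<Gamma> f (map (\<lambda>\<tau>. \<tau>s \<Rrightarrow>\<^sub>t \<tau>) (pos I A))" "has_types T \<Gamma> f' (map (\<lambda>\<tau>. \<tau>s \<Rrightarrow>\<^sub>t \<tau>) (pos I A))"
    and x: "has_types T \<Gamma> xs \<tau>s" and n: "n = length \<tau>s"
  shows "list_all2 (\<lambda>t u. deriv T \<Gamma> H (FEq t u)) (join I J A (f \<bullet> xs) (f' \<bullet> xs))
    (map (lams \<tau>s) (join I J A (shifts n f \<bullet> bvars \<tau>s) (shifts n f' \<bullet> bvars \<tau>s)) \<bullet> xs)"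
proof -
  let ?app = "\<lambda>f. shifts n f \<bullet> bvars \<tau>s"
  let ?j = "join I J A (?app f) (?app f')"
  have len: "length xs = length \<tau>s"
    using x by (rule list_all2_lengthD)
  have body: "list_all2 (abstractable T (rev \<tau>s) \<Gamma>) ?j (pos I A)"
    by (rule abstractable_join_body [OF sfm w f n])
  have "map (tsub (msub xs)) ?j = join I J A (map (tsub (msub xs)) (?app f)) (map (tsub (msub xs)) (?app f'))"
  proof (rule map_tsub_join [OF sfm _ _ sub_typed_msub [OF x]])
    show "has_types T (rev \<tau>s @ \<Gamma>) (?app f) (pos I A)" "has_types T (rev \<tau>s @ \<Gamma>) (?app f') (pos I A)"
      using has_types_tapp [OF has_types_shifts [OF f(1), of n "rev \<tau>s"] has_types_bvars]
        has_types_tapp [OF has_types_shifts [OF f(2), of n "rev \<tau>s"] has_types_bvars]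
      by (simp_all add: n)
  qed
  then have eq: "map (tsub (msub xs)) ?j = join I J A (f \<bullet> xs) (f' \<bullet> xs)"
    by (simp add: len n del: map_map)
  show ?thesis
    unfolding eq [symmetric]
  proof (rule list_all2_all_nthI)
    fix i
    assume "i < length (map (tsub (msub xs)) ?j)"
    then have i: "i < length ?j" by simp
    then have t: "abstractable T (rev \<tau>s) \<Gamma> (?j ! i) (pos I A ! i)"
      using body by (auto simp: list_all2_conv_all_nth)
    have l: "has_type T \<Gamma> (apps (lams \<tau>s (?j ! i)) xs) (pos I A ! i)"
      using abstractable_has_type [OF abstractable_lams [of T \<tau>s "[]" \<Gamma> "?j ! i" "pos I A ! i"]] t w x
      by (auto intro: has_type_apps)
    have m: "has_type T \<Gamma> (tsub (msub xs) (?j ! i)) (pos I A ! i)"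
      by (rule has_type_tsub [OF abstractable_has_type [OF t] sub_typed_msub [OF x]])
    show "deriv T \<Gamma> H (FEq (map (tsub (msub xs)) ?j ! i) ((map (lams \<tau>s) ?j \<bullet> xs) ! i))"
      using eq_sym [OF lams_beta [OF t w x] l m] i by (simp add: tapp_def)
  qed simp
qed

text \<open>The last move for implication and universal quantification: the interpretation is
  transported along the equations of \<open>join_lams_beta\<close>.\<close>

lemma interp_join_lams:
  assumes sfm: "is_sfm L \<Gamma>0 A" and w: "set \<tau>s \<subseteq> wtypes T"
    and f: "has_types T \<Gamma> f (map (\<lambda>\<tau>. \<tau>s \<Rrightarrow>\<^sub>t \<tau>) (pos I A))" "has_types T \<Gamma> f' (map (\<lambda>\<tau>. \<tau>s \<Rrightarrow>\<^sub>t \<tau>) (pos I A))"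
    and x: "has_types T \<Gamma> xs \<tau>s" and n: "n = length \<tau>s"
    and r: "sub_typed T \<Gamma>0 \<Gamma> r" and c: "has_types T \<Gamma> c (neg I A)"
    and d: "deriv T \<Gamma> H (interp I r A (join I J A (f \<bullet> xs) (f' \<bullet> xs)) c)"
  shows "deriv T \<Gamma> H (interp I r A
    (map (lams \<tau>s) (join I J A (shifts n f \<bullet> bvars \<tau>s) (shifts n f' \<bullet> bvars \<tau>s)) \<bullet> xs) c)"
proof -
  have fx: "has_types T \<Gamma> (f \<bullet> xs) (pos I A)" "has_types T \<Gamma> (f' \<bullet> xs) (pos I A)"
    using has_types_tapp [OF f(1) x] has_types_tapp [OF f(2) x] by simp_all
  let ?j = "join I J A (shifts n f \<bullet> bvars \<tau>s) (shifts n f' \<bullet> bvars \<tau>s)"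
  have "has_type T \<Gamma> (lams \<tau>s t) (\<tau>s \<Rrightarrow>\<^sub>t \<tau>)" if "abstractable T (rev \<tau>s) \<Gamma> t \<tau>" for t \<tau>
    using abstractable_has_type [OF abstractable_lams [of T \<tau>s "[]" \<Gamma> t \<tau>]] that w by simp
  then have "has_types T \<Gamma> (map (lams \<tau>s) ?j) (map (\<lambda>\<tau>. \<tau>s \<Rrightarrow>\<^sub>t \<tau>) (pos I A))"
    using abstractable_join_body [OF sfm w f n] by (simp add: list_all2_conv_all_nth)
  from has_types_tapp [OF this x]
  have "has_types T \<Gamma> (map (lams \<tau>s) ?j \<bullet> xs) (pos I A)"
    by simp
  with interp_cong [OF sfm r c join_lams_beta [OF sfm w f x n], of "[]" H] has_types_join [OF sfm fx] d
  show ?thesis by simp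
qed

section \<open>Atomic formulas\<close>

text \<open>\<open>joining_of_bounds\<close> speaks of variables in a fixed context. Its segments
  are instantiated by the given tuples, while the closed terms \<open>J R\<close> stay as they
  are.\<close>

lemma base_at_join:
  assumes R: "R \<in> rsymsI L" and x: "has_types T \<Gamma> x (arity L R)" and a: "has_types T \<Gamma> a (bpos I R)"
    and b: "has_types T \<Gamma> b (bpos I R)" and c: "has_types T \<Gamma> c (bneg I R)"
  shows "deriv T \<Gamma> {base_at I R x a c} (base_at I R x (J R \<bullet> (a @ b)) c)"
proof -
  let ?n = "length (arity L R)" and ?m = "length (bpos I R)"
  let ?x = "seg 0 (arity L R)" and ?a = "seg ?n (bpos I R)" and ?b = "seg (?n + ?m) (bpos I R)"
    and ?c = "seg (?n + ?m + ?m) (bneg I R)"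
  let ?s = "\<lambda>i (\<tau>::'g ty). (x @ a @ b @ c) ! i"
  have len: "length x = ?n" "length a = ?m" "length b = ?m" "length c = length (bneg I R)"
    using x a b c by (auto dest: list_all2_lengthD)
  have s: "map (tsub ?s) ?x = x" "map (tsub ?s) ?a = a" "map (tsub ?s) ?b = b" "map (tsub ?s) ?c = c"
    using map_tsub_seg [of "[]" 0 x "arity L R" "a @ b @ c"] map_tsub_seg [of x ?n a "bpos I R" "b @ c"]
      map_tsub_seg [of "x @ a" "?n + ?m" b "bpos I R" c]
      map_tsub_seg [of "x @ a @ b" "?n + ?m + ?m" c "bneg I R" "[]"] len
    by simp_all
  have "proves T (arity L R @ bpos I R @ bpos I R @ bneg I R)
      (FImp (base_at I R ?x ?a ?c) (base_at I R ?x (J R \<bullet> (?a @ ?b)) ?c))"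
    using joining R by (simp add: joining_of_bounds_def Let_def)
  from proves_instance [OF this list_all2_appendI [OF x list_all2_appendI [OF a list_all2_appendI [OF b c]]]]
  have "deriv T \<Gamma> {base_at I R x a c} (FImp (base_at I R x a c) (base_at I R x (J R \<bullet> (a @ b)) c))"
    using R len list_all2_lengthD [OF has_types_J [OF R]] by (simp add: fsub_base_at s del: append_assoc)
  then show ?thesis
    by (rule deriv.impE) (simp add: deriv.hyp is_fm_base_at [OF R x a c])
qed

lemma J_commute:
  assumes R: "R \<in> rsymsI L" and a: "has_types T \<Gamma> a (bpos I R)" and b: "has_types T \<Gamma> b (bpos I R)"
  shows "proves_eq T \<Gamma> (J R \<bullet> (a @ b)) (J R \<bullet> (b @ a))"
proof -
  let ?m = "length (bpos I R)"
  let ?a = "seg 0 (bpos I R)" and ?b = "seg ?m (bpos I R)" and ?s = "\<lambda>i (\<tau>::'g ty). (a @ b) ! i"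
  have s: "map (tsub ?s) ?a = a" "map (tsub ?s) ?b = b"
    using map_tsub_seg [of "[]" 0 a "bpos I R" b] map_tsub_seg [of a ?m b "bpos I R" "[]"]
      list_all2_lengthD [OF a] list_all2_lengthD [OF b] by simp_all
  have "proves_eq T (bpos I R @ bpos I R) (J R \<bullet> (?a @ ?b)) (J R \<bullet> (?b @ ?a))"
    using joining R by (simp add: joining_of_bounds_def Let_def)
  then have "proves_eq T \<Gamma> (map (tsub ?s) (J R \<bullet> (?a @ ?b))) (map (tsub ?s) (J R \<bullet> (?b @ ?a)))"
    unfolding proves_eq_def proves_def [of T \<Gamma>] list_all2_map1 list_all2_map2
    by (rule list_all2_mono) (use proves_instance [OF _ list_all2_appendI [OF a b], where H = "{}"] in force)
  then show ?thesis
    by (simp add: R s)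
qed

section \<open>Commutativity of joins\<close>

text \<open>The premise \<open>IH\<close> is used in the context enlarged by the abstracted
  variables, and \<open>lams_xi\<close> then binds them.\<close>

lemma lams_join_commute:
  assumes sfm: "is_sfm L \<Gamma>0 A" and w: "set \<tau>s \<subseteq> wtypes T"
    and f: "has_types T \<Gamma> f (map (\<lambda>\<tau>. \<tau>s \<Rrightarrow>\<^sub>t \<tau>) (pos I A))" "has_types T \<Gamma> f' (map (\<lambda>\<tau>. \<tau>s \<Rrightarrow>\<^sub>t \<tau>) (pos I A))"
    and n: "n = length \<tau>s"
    and IH: "\<And>\<Gamma> a b. has_types T \<Gamma> a (pos I A) \<Longrightarrow> has_types T \<Gamma> b (pos I A) \<Longrightarrow>
      proves_eq T \<Gamma> (join I J A a b) (join I J A b a)"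
  shows "proves_eq T \<Gamma> (map (lams \<tau>s) (join I J A (shifts n f \<bullet> bvars \<tau>s) (shifts n f' \<bullet> bvars \<tau>s)))
    (map (lams \<tau>s) (join I J A (shifts n f' \<bullet> bvars \<tau>s) (shifts n f \<bullet> bvars \<tau>s)))"
proof -
  let ?app = "\<lambda>f. shifts n f \<bullet> bvars \<tau>s"
  have "has_types T (rev \<tau>s @ \<Gamma>) (?app f) (pos I A)" "has_types T (rev \<tau>s @ \<Gamma>) (?app f') (pos I A)"
    using has_types_tapp [OF has_types_shifts [OF f(1), of n "rev \<tau>s"] has_types_bvars]
      has_types_tapp [OF has_types_shifts [OF f(2), of n "rev \<tau>s"] has_types_bvars]
    by (simp_all add: n)
  from IH [OF this] abstractable_join_body [OF sfm w f n] abstractable_join_body [OF sfm w f(2,1) n]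
  show ?thesis
    unfolding proves_eq_def proves_def list_all2_conv_all_nth
    by (auto intro!: lams_xi [of \<tau>s "[]" \<Gamma>, simplified, OF _ w])
qed

lemma proves_eq_append:
  "proves_eq T \<Gamma> ts us \<Longrightarrow> proves_eq T \<Gamma> ts' us' \<Longrightarrow> proves_eq T \<Gamma> (ts @ ts') (us @ us')"
  unfolding proves_eq_def by (rule list_all2_appendI)

lemma join_commute:
  "is_sfm L \<Gamma>0 A \<Longrightarrow> has_types T \<Gamma> a (pos I A) \<Longrightarrow> has_types T \<Gamma> b (pos I A) \<Longrightarrow>
    proves_eq T \<Gamma> (join I J A a b) (join I J A b a)"
proof (induction A arbitrary: \<Gamma>0 \<Gamma> a b)
  case (SRel R ts)
  then show ?case by (simp add: J_commute rsyms_rsymsI)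
next
  case SBot
  then show ?case by (simp add: proves_eq_def)
next
  case (SAnd A B)
  obtain c d where a: "a = c @ d" "length c = length (pos I A)" "has_types T \<Gamma> c (pos I A)"
    "has_types T \<Gamma> d (pos I B)"
    using SAnd.prems by (auto simp: list_all2_append2)
  obtain c' d' where b: "b = c' @ d'" "length c' = length (pos I A)" "has_types T \<Gamma> c' (pos I A)"
    "has_types T \<Gamma> d' (pos I B)"
    using SAnd.prems by (auto simp: list_all2_append2)
  show ?case
    using SAnd.IH(1) [of \<Gamma>0, OF _ a(3) b(3)] SAnd.IH(2) [of \<Gamma>0, OF _ a(4) b(4)] SAnd.prems a b
    by (simp add: proves_eq_append)
next
  case (SImp A B)
  have B: "is_sfm L \<Gamma>0 B" and w: "set (pos I A) \<subseteq> wtypes T" "set (pos I A @ neg I B) \<subseteq> wtypes T"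
    "set (neg I A) \<subseteq> wtypes T"
    using SImp.prems pos_wtypes [of \<Gamma>0 A] neg_wtypes [of \<Gamma>0 B] neg_wtypes [of \<Gamma>0 A] by auto
  let ?F = "map (\<lambda>\<tau>. pos I A \<Rrightarrow>\<^sub>t \<tau>) (pos I B)"
    and ?G = "map (\<lambda>\<rho>. (pos I A @ neg I B) \<Rrightarrow>\<^sub>t FinSet \<rho>) (neg I A)"
  obtain f g where a: "a = f @ g" "length f = length (pos I B)" "has_types T \<Gamma> f ?F" "has_types T \<Gamma> g ?G"
    using SImp.prems(2) by (auto simp: list_all2_append2)
  obtain f' g' where b: "b = f' @ g'" "length f' = length (pos I B)" "has_types T \<Gamma> f' ?F"
    "has_types T \<Gamma> g' ?G"
    using SImp.prems(3) by (auto simp: list_all2_append2)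
  let ?j = "\<lambda>f f'. map (lams (pos I A)) (join I J B (shifts (length (pos I A)) f \<bullet> bvars (pos I A)) (shifts (length (pos I A)) f' \<bullet> bvars (pos I A)))"
  have "proves_eq T \<Gamma> (?j f f') (?j f' f)"
    by (rule lams_join_commute [OF B w(1) a(3) b(3) refl]) (rule SImp.IH(2) [OF B])
  from proves_eq_append [OF this pointwise_un_commute [OF a(4) b(4) w(2,3)]]
  show ?case
    using a(2) b(2) unfolding a(1) b(1) by (simp add: Let_def)
next
  case (SAll \<sigma> A)
  let ?us = "bpos I (Bnd \<sigma>)"
  have A: "is_sfm L (\<sigma> # \<Gamma>0) A" and w: "set ?us \<subseteq> wtypes T" "set (?us @ neg I A) \<subseteq> wtypes T"
    "set (bneg I (Bnd \<sigma>)) \<subseteq> wtypes T"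
    using SAll.prems bpos_wtypes [OF Bnd_rsymsI] bneg_wtypes [OF Bnd_rsymsI] neg_wtypes [of "\<sigma> # \<Gamma>0" A] by auto
  let ?F = "map (\<lambda>\<tau>. ?us \<Rrightarrow>\<^sub>t \<tau>) (pos I A)"
    and ?G = "map (\<lambda>\<rho>. (?us @ neg I A) \<Rrightarrow>\<^sub>t FinSet \<rho>) (bneg I (Bnd \<sigma>))"
  obtain f g where a: "a = f @ g" "length f = length (pos I A)" "has_types T \<Gamma> f ?F" "has_types T \<Gamma> g ?G"
    using SAll.prems(2) by (auto simp: list_all2_append2)
  obtain f' g' where b: "b = f' @ g'" "length f' = length (pos I A)" "has_types T \<Gamma> f' ?F"
    "has_types T \<Gamma> g' ?G"
    using SAll.prems(3) by (auto simp: list_all2_append2)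
  let ?j = "\<lambda>f f'. map (lams ?us) (join I J A (shifts (length ?us) f \<bullet> bvars ?us) (shifts (length ?us) f' \<bullet> bvars ?us))"
  have "proves_eq T \<Gamma> (?j f f') (?j f' f)"
    by (rule lams_join_commute [OF A w(1) a(3) b(3) refl]) (rule SAll.IH [OF A])
  from proves_eq_append [OF this pointwise_un_commute [OF a(4) b(4) w(2,3)]]
  show ?case
    using a(2) b(2) unfolding a(1) b(1) by (simp add: Let_def)
next
  case (SEx \<sigma> A)
  let ?us = "bpos I (Bnd \<sigma>)"
  obtain c d where a: "a = c @ d" "length c = length ?us" "has_types T \<Gamma> c ?us" "has_types T \<Gamma> d (pos I A)"
    using SEx.prems by (auto simp: list_all2_append2)
  obtain c' d' where b: "b = c' @ d'" "length c' = length ?us" "has_types T \<Gamma> c' ?us"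
    "has_types T \<Gamma> d' (pos I A)"
    using SEx.prems by (auto simp: list_all2_append2)
  show ?case
    using SEx.IH [of "\<sigma> # \<Gamma>0", OF _ a(4) b(4)] J_commute [OF _ a(3) b(3)] SEx.prems a b
    by (simp add: Bnd_rsymsI proves_eq_append)
qed

section \<open>Monotonicity by induction on the formula\<close>

text \<open>The interpretation is the only hypothesis of the entailment, so \<open>deriv_cut\<close>
  can insert an induction hypothesis into a derivation from other hypotheses. \<open>r\<close> and
  \<open>\<Gamma>\<close> vary because the interpretation of a part may stand below
  quantifiers.\<close>

lemma join_mono:
  "is_sfm L \<Gamma>0 A \<Longrightarrow> sub_typed T \<Gamma>0 \<Gamma> r \<Longrightarrow> has_types T \<Gamma> a (pos I A) \<Longrightarrow> has_types T \<Gamma> b (pos I A) \<Longrightarrow>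
    has_types T \<Gamma> c (neg I A) \<Longrightarrow> deriv T \<Gamma> {interp I r A a c} (interp I r A (join I J A a b) c)"
proof (induction A arbitrary: \<Gamma>0 \<Gamma> r a b c)
  case (SRel R ts)
  then show ?case
    using has_types_stsub [of \<Gamma>0 ts "arity L R" \<Gamma> r] by (simp add: base_at_join rsyms_rsymsI)
next
  case SBot
  then show ?case by (simp add: deriv.hyp)
next
  case (SAnd A B)
  obtain a1 a2 where a: "a = a1 @ a2" "length a1 = length (pos I A)" "has_types T \<Gamma> a1 (pos I A)"
    "has_types T \<Gamma> a2 (pos I B)"
    using SAnd.prems(3) by (auto simp: list_all2_append2)
  obtain b1 b2 where b: "b = b1 @ b2" "length b1 = length (pos I A)" "has_types T \<Gamma> b1 (pos I A)"
    "has_types T \<Gamma> b2 (pos I B)"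
    using SAnd.prems(4) by (auto simp: list_all2_append2)
  obtain c1 c2 where c: "c = c1 @ c2" "length c1 = length (neg I A)" "has_types T \<Gamma> c1 (neg I A)"
    "has_types T \<Gamma> c2 (neg I B)"
    using SAnd.prems(5) by (auto simp: list_all2_append2)
  have sfm: "is_sfm L \<Gamma>0 A" "is_sfm L \<Gamma>0 B"
    using SAnd.prems(1) by auto
  let ?A = "interp I r A a1 c1" and ?B = "interp I r B a2 c2"
  have fm: "is_fm T \<Gamma> ?A" "is_fm T \<Gamma> ?B"
    using sfm SAnd.prems(2) a c by (blast intro: is_fm_interp)+
  have hyp: "deriv T \<Gamma> {FAnd ?A ?B} (FAnd ?A ?B)"
    using fm by (simp add: deriv.hyp)
  have "deriv T \<Gamma> {FAnd ?A ?B} (interp I r A (join I J A a1 b1) c1)"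
    by (rule deriv_cut [OF deriv.andE1 [OF hyp] SAnd.IH(1) [OF sfm(1) SAnd.prems(2) a(3) b(3) c(3)] fm(1)])
  moreover have "deriv T \<Gamma> {FAnd ?A ?B} (interp I r B (join I J B a2 b2) c2)"
    by (rule deriv_cut [OF deriv.andE2 [OF hyp] SAnd.IH(2) [OF sfm(2) SAnd.prems(2) a(4) b(4) c(4)] fm(2)])
  moreover have "length (join I J A a1 b1) = length (pos I A)"
    using has_types_join [OF sfm(1) a(3) b(3)] by (rule list_all2_lengthD)
  ultimately show ?case
    using a b c by (simp add: deriv.andI)
next
  case (SImp A B)
  have sfm: "is_sfm L \<Gamma>0 A" "is_sfm L \<Gamma>0 B"
    using SImp.prems(1) by auto
  have w: "set (pos I A) \<subseteq> wtypes T" "set (pos I A @ neg I B) \<subseteq> wtypes T" "set (neg I A) \<subseteq> wtypes T"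
    using pos_wtypes [OF sfm(1)] neg_wtypes [OF sfm(2)] neg_wtypes [OF sfm(1)] by auto
  let ?F = "map (\<lambda>\<tau>. pos I A \<Rrightarrow>\<^sub>t \<tau>) (pos I B)"
    and ?G = "map (\<lambda>\<rho>. (pos I A @ neg I B) \<Rrightarrow>\<^sub>t FinSet \<rho>) (neg I A)"
  obtain f g where a: "a = f @ g" "length f = length (pos I B)" "has_types T \<Gamma> f ?F" "has_types T \<Gamma> g ?G"
    using SImp.prems(3) by (auto simp: list_all2_append2)
  obtain f' g' where b: "b = f' @ g'" "length f' = length (pos I B)" "has_types T \<Gamma> f' ?F"
    "has_types T \<Gamma> g' ?G"
    using SImp.prems(4) by (auto simp: list_all2_append2)
  obtain x d where c: "c = x @ d" "length x = length (pos I A)" "has_types T \<Gamma> x (pos I A)"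
    "has_types T \<Gamma> d (neg I B)"
    using SImp.prems(5) by (auto simp: list_all2_append2)
  define k where "k = length (neg I A)"
  \<comment> \<open>The premise keeps its witness \<open>x\<close> and changes only in its bounds,
    so \<open>P\<close> is the body on both sides.\<close>
  define P where "P = interp I (\<lambda>i \<tau>. shift k (r i \<tau>)) A (shifts k x) (bvars (neg I A))"
  define j where "j = join I J B (shifts (length (pos I A)) f \<bullet> bvars (pos I A))
    (shifts (length (pos I A)) f' \<bullet> bvars (pos I A))"
  define u where "u = pointwise_un (pos I A @ neg I B) (neg I A) g g'"
  have join: "join I J (SImp A B) a b = map (lams (pos I A)) j @ u"
    using a b by (simp add: Let_def j_def u_def)
  have "length j = length (pos I B)"
    using abstractable_join_body [OF sfm(2) w(1) a(3) b(3) refl] unfolding j_def by (rule list_all2_lengthD)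
  then have goal: "interp I r (SImp A B) (join I J (SImp A B) a b) c =
      FImp (ball (neg I A) (u \<bullet> (x @ d)) P) (interp I r B (map (lams (pos I A)) j \<bullet> x) d)"
    using c unfolding join by (simp add: Let_def P_def k_def)
  have hyp: "interp I r (SImp A B) a c =
      FImp (ball (neg I A) (g \<bullet> (x @ d)) P) (interp I r B (f \<bullet> x) d)"
    using a c by (simp add: Let_def P_def k_def)
  have xd: "has_types T \<Gamma> (x @ d) (pos I A @ neg I B)"
    using c by (simp add: list_all2_appendI)
  have ut: "has_types T \<Gamma> u ?G"
    using has_types_join [OF SImp.prems(1,3,4)] \<open>length j = _\<close> unfolding join by (simp add: list_all2_append)
  have gt: "has_types T \<Gamma> (g \<bullet> (x @ d)) (map FinSet (neg I A))"
    "has_types T \<Gamma> (u \<bullet> (x @ d)) (map FinSet (neg I A))"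
    using has_types_tapp [OF a(4) xd] has_types_tapp [OF ut xd] .
  have fx: "has_types T \<Gamma> (f \<bullet> x) (pos I B)" "has_types T \<Gamma> (f' \<bullet> x) (pos I B)"
    using has_types_tapp [OF a(3) c(3)] has_types_tapp [OF b(3) c(3)] by simp_all
  have fmP: "is_fm T (rev (neg I A) @ \<Gamma>) P"
    unfolding P_def k_def using SImp.prems(2) c(3)
    by (intro is_fm_interp [OF sfm(1)] sub_typed_comp_shift has_types_shifts has_types_bvars) auto
  have fmB: "is_fm T \<Gamma> (ball (neg I A) (u \<bullet> (x @ d)) P)" "is_fm T \<Gamma> (ball (neg I A) (g \<bullet> (x @ d)) P)"
    using wtypes_ttypes w(3) gt fmP by (auto intro: is_fm_ball)
  have fmC: "is_fm T \<Gamma> (interp I r B (f \<bullet> x) d)"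
    by (rule is_fm_interp [OF sfm(2) SImp.prems(2) fx(1) c(4)])
  let ?H = "{ball (neg I A) (u \<bullet> (x @ d)) P, interp I r (SImp A B) a c}"
  have ball: "deriv T \<Gamma> ?H (ball (neg I A) (g \<bullet> (x @ d)) P)"
  proof (rule ball_mono [OF _ fmP _ w(3) gt])
    show "deriv T \<Gamma> ?H (ball (neg I A) (u \<bullet> (x @ d)) P)"
      using fmB by (auto intro: deriv.hyp)
    show "deriv T (rev (neg I A) @ \<Gamma>) {P} P"
      using fmP by (auto intro: deriv.hyp)
    show "deriv T \<Gamma> ?H (fsubset (neg I A ! i) ((g \<bullet> (x @ d)) ! i) ((u \<bullet> (x @ d)) ! i))"
      if "i < length (neg I A)" for i
      unfolding u_def by (rule fsubset_pointwise_un [OF a(4) b(4) w(2,3) xd that])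
  qed
  have "deriv T \<Gamma> ?H (FImp (ball (neg I A) (g \<bullet> (x @ d)) P) (interp I r B (f \<bullet> x) d))"
    by (rule deriv.hyp) (simp_all add: hyp fmB fmC del: interp.simps)
  from deriv.impE [OF this ball]
  have "deriv T \<Gamma> ?H (interp I r B (f \<bullet> x) d)" .
  from deriv_cut [OF this SImp.IH(2) [OF sfm(2) SImp.prems(2) fx c(4)] fmC]
  have "deriv T \<Gamma> ?H (interp I r B (join I J B (f \<bullet> x) (f' \<bullet> x)) d)" .
  from interp_join_lams [OF sfm(2) w(1) a(3) b(3) c(3) refl SImp.prems(2) c(4) this]
  have "deriv T \<Gamma> ?H (interp I r B (map (lams (pos I A)) j \<bullet> x) d)"
    by (simp add: j_def)
  then show ?case
    unfolding goal by (rule deriv.impI [OF _ fmB(1)])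
next
  case (SAll \<sigma> A)
  let ?us = "bpos I (Bnd \<sigma>)" and ?vs = "bneg I (Bnd \<sigma>)"
  have sfm: "is_sfm L (\<sigma> # \<Gamma>0) A" and \<sigma>: "\<sigma> \<in> stypes L"
    using SAll.prems(1) by auto
  have w: "set ?us \<subseteq> wtypes T" "set (?us @ neg I A) \<subseteq> wtypes T" "set ?vs \<subseteq> wtypes T"
    using bpos_wtypes [OF Bnd_rsymsI [OF \<sigma>]] bneg_wtypes [OF Bnd_rsymsI [OF \<sigma>]] neg_wtypes [OF sfm] by auto
  let ?F = "map (\<lambda>\<tau>. ?us \<Rrightarrow>\<^sub>t \<tau>) (pos I A)"
    and ?G = "map (\<lambda>\<rho>. (?us @ neg I A) \<Rrightarrow>\<^sub>t FinSet \<rho>) ?vs"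
  obtain f g where a: "a = f @ g" "length f = length (pos I A)" "has_types T \<Gamma> f ?F" "has_types T \<Gamma> g ?G"
    using SAll.prems(3) by (auto simp: list_all2_append2)
  obtain f' g' where b: "b = f' @ g'" "length f' = length (pos I A)" "has_types T \<Gamma> f' ?F"
    "has_types T \<Gamma> g' ?G"
    using SAll.prems(4) by (auto simp: list_all2_append2)
  obtain x d where c: "c = x @ d" "length x = length ?us" "has_types T \<Gamma> x ?us" "has_types T \<Gamma> d (neg I A)"
    using SAll.prems(5) by (auto simp: list_all2_append2)
  define k where "k = length ?vs"
  define P where "P = base_at I (Bnd \<sigma>) [Var k \<sigma>] (shifts (k + 1) x) (bvars ?vs)"
  define j where "j = join I J A (shifts (length ?us) f \<bullet> bvars ?us) (shifts (length ?us) f' \<bullet> bvars ?us)"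
  define u where "u = pointwise_un (?us @ neg I A) ?vs g g'"
  have join: "join I J (SAll \<sigma> A) a b = map (lams ?us) j @ u"
    using a b by (simp add: Let_def j_def u_def)
  have lenj: "length j = length (pos I A)"
    using abstractable_join_body [OF sfm w(1) a(3) b(3) refl] unfolding j_def by (rule list_all2_lengthD)
  let ?hyp = "FImp (ball ?vs (shifts 1 (g \<bullet> (x @ d))) P) (interp I (up r) A (shifts 1 (f \<bullet> x)) (shifts 1 d))"
  have goal: "interp I r (SAll \<sigma> A) (join I J (SAll \<sigma> A) a b) c =
      FAll \<sigma> (FImp (ball ?vs (shifts 1 (u \<bullet> (x @ d))) P)
        (interp I (up r) A (shifts 1 (map (lams ?us) j \<bullet> x)) (shifts 1 d)))"
    using c lenj unfolding join by (simp add: Let_def P_def k_def)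
  have hyp: "interp I r (SAll \<sigma> A) a c = FAll \<sigma> ?hyp"
    using a c by (simp add: Let_def P_def k_def)
  let ?\<Gamma> = "\<sigma> # \<Gamma>"
  have x1: "has_types T ?\<Gamma> (shifts 1 x) ?us" and d1: "has_types T ?\<Gamma> (shifts 1 d) (neg I A)"
    using has_types_shifts_Suc [OF c(3)] has_types_shifts_Suc [OF c(4)] by auto
  have f1: "has_types T ?\<Gamma> (shifts 1 f) ?F" "has_types T ?\<Gamma> (shifts 1 f') ?F"
    using has_types_shifts_Suc [OF a(3)] has_types_shifts_Suc [OF b(3)] by auto
  have xd: "has_types T \<Gamma> (x @ d) (?us @ neg I A)"
    using c by (simp add: list_all2_appendI)
  have ut: "has_types T \<Gamma> u ?G"
    using has_types_join [OF SAll.prems(1,3,4)] lenj unfolding join by (simp add: list_all2_append)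
  have gt: "has_types T ?\<Gamma> (shifts 1 (g \<bullet> (x @ d))) (map FinSet ?vs)"
    "has_types T ?\<Gamma> (shifts 1 (u \<bullet> (x @ d))) (map FinSet ?vs)"
    using has_types_shifts_Suc [OF has_types_tapp [OF a(4) xd]]
      has_types_shifts_Suc [OF has_types_tapp [OF ut xd]] by (simp_all del: shifts_tapp)
  have fx: "has_types T ?\<Gamma> (shifts 1 (f \<bullet> x)) (pos I A)" "has_types T ?\<Gamma> (shifts 1 (f' \<bullet> x)) (pos I A)"
    using has_types_tapp [OF f1(1) x1] has_types_tapp [OF f1(2) x1] by simp_all
  have r1: "sub_typed T (\<sigma> # \<Gamma>0) ?\<Gamma> (up r)"
    by (rule sub_typed_up [OF SAll.prems(2)])
  have fmP: "is_fm T (rev ?vs @ ?\<Gamma>) P"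
    unfolding P_def by (rule is_fm_bound [OF \<sigma> c(3) k_def])
  have fmB: "is_fm T ?\<Gamma> (ball ?vs (shifts 1 (u \<bullet> (x @ d))) P)"
    "is_fm T ?\<Gamma> (ball ?vs (shifts 1 (g \<bullet> (x @ d))) P)"
    using wtypes_ttypes w(3) gt fmP by (auto intro: is_fm_ball simp del: shifts_tapp)
  have fmC: "is_fm T ?\<Gamma> (interp I (up r) A (shifts 1 (f \<bullet> x)) (shifts 1 d))"
    by (rule is_fm_interp [OF sfm r1 fx(1) d1])
  have fmh: "is_fm T ?\<Gamma> ?hyp"
    using fmB fmC by simp
  have \<sigma>t: "\<sigma> \<in> ttypes T"
    by (rule stypes_ttypes [OF \<sigma>])
  let ?K = "{interp I r (SAll \<sigma> A) a c}"
  let ?H = "insert (ball ?vs (shifts 1 (u \<bullet> (x @ d))) P) (fshift ` ?K)"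
  have ball: "deriv T ?\<Gamma> ?H (ball ?vs (shifts 1 (g \<bullet> (x @ d))) P)"
  proof (rule ball_mono [OF _ fmP _ w(3) gt])
    show "deriv T ?\<Gamma> ?H (ball ?vs (shifts 1 (u \<bullet> (x @ d))) P)"
      by (rule deriv.hyp [OF insertI1 fmB(1)])
    show "deriv T (rev ?vs @ ?\<Gamma>) {P} P"
      using fmP by (auto intro: deriv.hyp)
    fix i
    assume i: "i < length ?vs"
    \<comment> \<open>\<open>u\<close> is built over \<open>\<Gamma>\<close>, so the inclusion is
      proved there and afterwards shifted past the quantified variable.\<close>
    have "deriv T \<Gamma> {} (fsubset (?vs ! i) ((g \<bullet> (x @ d)) ! i) ((u \<bullet> (x @ d)) ! i))"
      unfolding u_def by (rule fsubset_pointwise_un [OF a(4) b(4) w(2,3) xd i])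
    from deriv_fshift [OF this, of \<sigma>]
    have "deriv T ?\<Gamma> {} (fsubset (?vs ! i) (shifts 1 (g \<bullet> (x @ d)) ! i) (shifts 1 (u \<bullet> (x @ d)) ! i))"
      using i list_all2_lengthD [OF a(4)] list_all2_lengthD [OF ut] by (simp add: fshift_fsubset del: shifts_tapp)
    then show "deriv T ?\<Gamma> ?H (fsubset (?vs ! i) (shifts 1 (g \<bullet> (x @ d)) ! i) (shifts 1 (u \<bullet> (x @ d)) ! i))"
      by (rule deriv_weaken) simp
  qed
  have "deriv T \<Gamma> {FAll \<sigma> ?hyp} (FAll \<sigma> ?hyp)"
    by (rule deriv.hyp [OF singletonI]) (use fmh \<sigma>t in simp)
  then have "deriv T \<Gamma> ?K (FAll \<sigma> ?hyp)"
    by (simp only: hyp)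
  from deriv_weaken [OF deriv_all_body [OF this fmh] subset_insertI]
  have "deriv T ?\<Gamma> ?H ?hyp" .
  from deriv.impE [OF this ball]
  have "deriv T ?\<Gamma> ?H (interp I (up r) A (shifts 1 (f \<bullet> x)) (shifts 1 d))" .
  from deriv_cut [OF this SAll.IH [OF sfm r1 fx d1] fmC]
  have "deriv T ?\<Gamma> ?H (interp I (up r) A (join I J A (shifts 1 f \<bullet> shifts 1 x) (shifts 1 f' \<bullet> shifts 1 x)) (shifts 1 d))"
    by simp
  from interp_join_lams [OF sfm w(1) f1 x1 refl r1 d1 this]
  have "deriv T ?\<Gamma> ?H (interp I (up r) A (map (lams ?us)
      (join I J A (shifts (length ?us) (shifts 1 f) \<bullet> bvars ?us) (shifts (length ?us) (shifts 1 f') \<bullet> bvars ?us)) \<bullet> shifts 1 x) (shifts 1 d))" .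
  \<comment> \<open>Beta conversion concerned abstractions formed from the shifted \<open>f\<close>
    and \<open>f'\<close>, whereas the goal contains the shifted abstraction. Naturality of joins
    identifies the two.\<close>
  moreover have "shifts 1 (map (lams ?us) j) = map (lams ?us)
      (join I J A (shifts (length ?us) (shifts 1 f) \<bullet> bvars ?us) (shifts (length ?us) (shifts 1 f') \<bullet> bvars ?us))"
    unfolding j_def shift_def [of 1]
    by (rule map_tsub_lams_join [OF sfm w(1) a(3) b(3) refl _ map_tsub_join [OF sfm]])
      (use sub_typed_Suc in auto)
  ultimately have "deriv T ?\<Gamma> ?H (interp I (up r) A (shifts 1 (map (lams ?us) j \<bullet> x)) (shifts 1 d))"
    by (simp del: map_map)
  from deriv.impI [OF this fmB(1)]
  show ?case
    unfolding goal by (rule deriv.allI [OF _ \<sigma>t])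
next
  case (SEx \<sigma> A)
  let ?us = "bpos I (Bnd \<sigma>)" and ?vs = "bneg I (Bnd \<sigma>)"
  have sfm: "is_sfm L (\<sigma> # \<Gamma>0) A" and \<sigma>: "\<sigma> \<in> stypes L"
    using SEx.prems(1) by auto
  have w: "set ?vs \<subseteq> wtypes T" "set (neg I A) \<subseteq> wtypes T"
    using bneg_wtypes [OF Bnd_rsymsI [OF \<sigma>]] neg_wtypes [OF sfm] by auto
  obtain u x where a: "a = u @ x" "length u = length ?us" "has_types T \<Gamma> u ?us" "has_types T \<Gamma> x (pos I A)"
    using SEx.prems(3) by (auto simp: list_all2_append2)
  obtain u' x' where b: "b = u' @ x'" "length u' = length ?us" "has_types T \<Gamma> u' ?us"
    "has_types T \<Gamma> x' (pos I A)"
    using SEx.prems(4) by (auto simp: list_all2_append2)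
  obtain V B where c: "c = V @ B" "length V = length ?vs" "has_types T \<Gamma> V (map FinSet ?vs)"
    "has_types T \<Gamma> B (map FinSet (neg I A))"
    using SEx.prems(5) by (auto simp: list_all2_append2)
  define k where "k = length ?vs"
  define m where "m = length (neg I A)"
  \<comment> \<open>Joining changes only the positive witnesses, so guard, matrix and their
    conjunction are taken as functions of these.\<close>
  define P where "P = (\<lambda>u. base_at I (Bnd \<sigma>) [Var k \<sigma>] (shifts (k + 1) u) (bvars ?vs))"
  define Q where "Q = (\<lambda>x. interp I (\<lambda>i \<tau>. shift m (up r i \<tau>)) A (shifts (m + 1) x) (bvars (neg I A)))"
  define body where "body = (\<lambda>u x. FAnd (ball ?vs (shifts 1 V) (P u)) (ball (neg I A) (shifts 1 B) (Q x)))"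
  let ?u = "J (Bnd \<sigma>) \<bullet> (u @ u')" and ?x = "join I J A x x'"
  have tu: "has_types T \<Gamma> ?u ?us"
    using abstractable_J [OF Bnd_rsymsI [OF \<sigma>], of "[]" \<Gamma> u u'] a(3) b(3) bpos_wtypes [OF Bnd_rsymsI [OF \<sigma>]]
    by (simp add: abstractable_Nil_list)
  have tx: "has_types T \<Gamma> ?x (pos I A)"
    by (rule has_types_join [OF sfm a(4) b(4)])
  have goal: "interp I r (SEx \<sigma> A) (join I J (SEx \<sigma> A) a b) c = FEx \<sigma> (body ?u ?x)"
    using a b c list_all2_lengthD [OF tu] by (simp add: Let_def body_def P_def Q_def k_def m_def)
  have hyp: "interp I r (SEx \<sigma> A) a c = FEx \<sigma> (body u x)"
    using a c by (simp add: Let_def body_def P_def Q_def k_def m_def)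
  let ?\<Gamma> = "\<sigma> # \<Gamma>"
  have r1: "sub_typed T (\<sigma> # \<Gamma>0) (rev (neg I A) @ ?\<Gamma>) (\<lambda>i \<tau>. shift m (up r i \<tau>))"
    by (rule sub_typed_comp_shift [OF sub_typed_up [OF SEx.prems(2)]]) (simp add: m_def)
  have x1: "has_types T (rev (neg I A) @ ?\<Gamma>) (shifts (m + 1) y) (pos I A)" if "has_types T \<Gamma> y (pos I A)" for y
    using has_types_shifts [OF that, of "m + 1" "rev (neg I A) @ [\<sigma>]"] by (simp add: m_def)
  have u1: "has_types T (rev ?vs @ ?\<Gamma>) (shifts (k + 1) y) ?us" if "has_types T \<Gamma> y ?us" for y
    using has_types_shifts [OF that, of "k + 1" "rev ?vs @ [\<sigma>]"] by (simp add: k_def)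
  have VB: "has_types T ?\<Gamma> (shifts 1 V) (map FinSet ?vs)" "has_types T ?\<Gamma> (shifts 1 B) (map FinSet (neg I A))"
    using has_types_shifts_Suc [OF c(3)] has_types_shifts_Suc [OF c(4)] by auto
  have fmP: "is_fm T (rev ?vs @ ?\<Gamma>) (P y)" if "has_types T \<Gamma> y ?us" for y
    unfolding P_def by (rule is_fm_bound [OF \<sigma> that k_def])
  have fmQ: "is_fm T (rev (neg I A) @ ?\<Gamma>) (Q y)" if "has_types T \<Gamma> y (pos I A)" for y
    unfolding Q_def by (rule is_fm_interp [OF sfm r1 x1 [OF that] has_types_bvars])
  have fm: "is_fm T ?\<Gamma> (body y z)" if "has_types T \<Gamma> y ?us" "has_types T \<Gamma> z (pos I A)" for y z
    unfolding body_def using wtypes_ttypes w VB fmP [OF that(1)] fmQ [OF that(2)] by (auto intro: is_fm_ball)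
  have PP: "deriv T (rev ?vs @ ?\<Gamma>) {P u} (P ?u)"
  proof -
    have "has_types T (rev ?vs @ ?\<Gamma>) [Var k \<sigma>] (arity L (Bnd \<sigma>))"
      by (auto simp: k_def nth_append intro: has_type.intros)
    moreover have "shifts (k + 1) ?u = J (Bnd \<sigma>) \<bullet> (shifts (k + 1) u @ shifts (k + 1) u')"
      unfolding shift_def by (simp add: Bnd_rsymsI [OF \<sigma>])
    ultimately show ?thesis
      unfolding P_def using base_at_join [OF Bnd_rsymsI [OF \<sigma>] _ u1 [OF a(3)] u1 [OF b(3)] has_types_bvars]
      by simp
  qed
  have QQ: "deriv T (rev (neg I A) @ ?\<Gamma>) {Q x} (Q ?x)"
  proof -
    \<comment> \<open>The induction hypothesis is needed below the quantifier and \<open>m\<close>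
      bounded variables, where it speaks of the join of shifted witnesses.\<close>
    have "shifts (m + 1) ?x = join I J A (shifts (m + 1) x) (shifts (m + 1) x')"
      using map_tsub_join [OF sfm a(4) b(4) sub_typed_shift [of T \<Gamma> "rev (neg I A) @ [\<sigma>]"]]
      by (simp add: shift_def m_def)
    then show ?thesis
      unfolding Q_def using SEx.IH [OF sfm r1 x1 [OF a(4)] x1 [OF b(4)] has_types_bvars] by simp
  qed
  have hb: "deriv T ?\<Gamma> {body u x} (FAnd (ball ?vs (shifts 1 V) (P u)) (ball (neg I A) (shifts 1 B) (Q x)))"
    using fm [OF a(3,4)] by (intro deriv.hyp) (auto simp: body_def)
  \<comment> \<open>The bounds \<open>V\<close> and \<open>B\<close> are negative witnesses and stay
    fixed, so \<open>ball_mono\<close> receives reflexive inclusions.\<close>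
  have refl: "deriv T ?\<Gamma> H (fsubset (\<rho>s ! i) (ts ! i) (ts ! i))"
    if "has_types T ?\<Gamma> ts (map FinSet \<rho>s)" "set \<rho>s \<subseteq> wtypes T" "i < length \<rho>s" for H ts \<rho>s i
    using that by (intro fsubset_refl) (auto simp: list_all2_conv_all_nth)
  have "deriv T ?\<Gamma> {body u x} (ball ?vs (shifts 1 V) (P ?u))"
    by (rule ball_mono [OF deriv.andE1 [OF hb] fmP [OF a(3)] PP w(1) VB(1) VB(1) refl [OF VB(1) w(1)]])
  moreover have "deriv T ?\<Gamma> {body u x} (ball (neg I A) (shifts 1 B) (Q ?x))"
    by (rule ball_mono [OF deriv.andE2 [OF hb] fmQ [OF a(4)] QQ w(2) VB(2) VB(2) refl [OF VB(2) w(2)]])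
  ultimately have "deriv T ?\<Gamma> {body u x} (body ?u ?x)"
    unfolding body_def by (rule deriv.andI)
  \<comment> \<open>The same object witnesses the existential quantifier before and after
    joining.\<close>
  then show ?case
    unfolding goal hyp by (rule deriv_ex_mono [OF _ fm [OF a(3,4)] fm [OF tu tx] stypes_ttypes [OF \<sigma>]])
qed

end

theorem lemma4p4:
  fixes L :: "('g, 'k, 'r) source"
    and T :: "('g, 'k, 'p) target"
    and I :: "('g, 'k, 'p, 'r) base_interp"
    and J :: "('g, 'k, 'r) joining"
    and A :: "('g, 'k, 'r) sfm"
    and \<Gamma> :: "'g ty list"
    and a b :: "('g, 'k) tm list"
  assumes "source_language L"
    and "target_theory L T"
    and "base_interpretation L T I"
    and "joining_of_bounds L T I J"
    and "set \<Gamma> \<subseteq> ttypes T"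
    and "is_sfm L \<Gamma> A"
    and "has_types T \<Gamma> a (pos I A)"
    and "has_types T \<Gamma> b (pos I A)"
  shows "proves_eq T \<Gamma> (join I J A a b) (join I J A b a) \<and>
    (\<forall>c. has_types T \<Gamma> c (neg I A) \<longrightarrow>
      proves T \<Gamma> (FImp (interp I Var A a c) (interp I Var A (join I J A a b) c)))"
proof -
  interpret joined_interpretation L T I J
    using assms(2-4) by unfold_locales
  \<comment> \<open>Taking \<open>r = Var\<close> recovers the interpretation of \<open>A\<close>
    itself; \<open>impI\<close> internalises the entailment.\<close>
  have "proves T \<Gamma> (FImp (interp I Var A a c) (interp I Var A (join I J A a b) c))"
    if "has_types T \<Gamma> c (neg I A)" for c
    unfolding proves_def
    using join_mono [OF assms(6) sub_typed_Var assms(7,8) that]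
      is_fm_interp [OF assms(6) sub_typed_Var assms(7) that]
    by (rule deriv.impI)
  then show ?thesis
    using join_commute [OF assms(6-8)] by blast
qed

end
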